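(* Let $q\in L^1(0,\pi)$ be real-valued, $A\subset\mathbb{N}$, $\alpha_1,\alpha_2,\beta\in[0,\pi)$ and $\sin(\alpha_2-\alpha_1)\ne0$. Let $\sigma_{\alpha_2,\beta}=\{a_n\}_{n\in\mathbb{N}}$ and $\sigma_{\alpha_1,\beta}=\{b_n\}_{n\in\mathbb{N}}$ be the two spectra of $q$, and let $\{\gamma_n\}_{n\in\mathbb{N}}$ be the point masses of the corresponding spectral measure $\mu_{\alpha_1,\alpha_2,\beta}=\sum_{n\in\mathbb{N}}\gamma_n\delta_{a_n}$. Then $\{a_n\}_{n\in\mathbb{N}}$, $\{b_n\}_{n\in\mathbb{N}\setminus A}$ and $\{\gamma_n\}_{n\in A}$ determine the potential $q$. That is: if $\widetilde q\in L^1(0,\pi)$ is real-valued, with corresponding quantities $\widetilde a_n,\widetilde b_n,\widetilde\gamma_n$ (for the same $\alpha_1,\alpha_2,\beta$), and $\widetilde a_n=a_n$ for all $n\in\mathbb{N}$, $\widetilde b_n=b_n$ for all $n\in\mathbb{N}\setminus A$, and $\widetilde\gamma_n=\gamma_n$ for all $n\in A$, then $\widetilde q=q$ almost everywhere on $(0,\pi)$.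
   Context: $\mathbb{N}=\{1,2,3,\dots\}$. For a real-valued potential $q\in L^1(0,\pi)$ and $\alpha,\beta\in[0,\pi)$, $\sigma_{\alpha,\beta}$ denotes the spectrum of the operator $u\mapsto-u''+qu$ on $(0,\pi)$ with boundary conditions $u(0)\cos\alpha-u'(0)\sin\alpha=0$ and $u(\pi)\cos\beta+u'(\pi)\sin\beta=0$. It is a discrete subset of $\mathbb{R}$, bounded below, and is enumerated in increasing order with index set $\mathbb{N}$. Let $u_z$ be the solution of $-u''+qu=zu$ with $u_z(\pi)=\sin\beta$, $u_z'(\pi)=-\cos\beta$. For $\alpha_1,\alpha_2,\beta\in[0,\pi)$ with $\sin(\alpha_2-\alpha_1)\neq0$, define $$m_{\alpha_1,\alpha_2,\beta}(z):=\frac{1}{\sin(\alpha_2-\alpha_1)}\left[\frac{-\sin(\alpha_1)u_z'(0)+\cos(\alpha_1)u_z(0)}{-\sin(\alpha_2)u_z'(0)+\cos(\alpha_2)u_z(0)}\right].$$ This is a meromorphic Herglotz function (real on the real line where defined, positive imaginary part on the upper half-plane) whose zero set is $\sigma_{\alpha_1,\beta}$ and whose poles are simple and form $\sigma_{\alpha_2,\beta}$. It has a Herglotz representation $m_{\alpha_1,\alpha_2,\beta}(z)=az+b+\int\left[\frac1{t-z}-\frac{t}{1+t^2}\right]d\mu_{\alpha_1,\alpha_2,\beta}(t)$ with $a,b\in\mathbb{R}$ and $\mu_{\alpha_1,\alpha_2,\beta}$ a positive discrete measure supported on $\sigma_{\alpha_2,\beta}$ with $\int\frac{d\mu_{\alpha_1,\alpha_2,\beta}(t)}{1+t^2}<\infty$;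 this measure is called the spectral measure corresponding to $(\alpha_1,\alpha_2,\beta)$. Thus its point mass at $a_n\in\sigma_{\alpha_2,\beta}$ is $\gamma_n=-\operatorname{Res}(m_{\alpha_1,\alpha_2,\beta},a_n)$. *)

theory Defs
  imports "HOL-Analysis.Analysis"
begin

definition d1 :: "(real \<Rightarrow> complex) \<Rightarrow> real \<Rightarrow> complex" where
  "d1 u x = vector_derivative u (at x within {0..pi})"

text \<open>\<open>u\<close> and \<open>u'\<close> are absolutely continuous on \<open>[0, \<pi>]\<close> and \<open>u'' = g\<close> a.e.;
  absolute continuity of \<open>u'\<close> is expressed by \<open>u'\<close> being an indefinite integral of an
  \<open>L\<^sup>1\<close> function (so \<open>u\<close> is \<open>C\<^sup>1\<close>).\<close>

definition has_second_deriv :: "(real \<Rightarrow> complex) \<Rightarrow> (real \<Rightarrow> complex) \<Rightarrow> bool" where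
  "has_second_deriv u g \<longleftrightarrow>
     (\<forall>x\<in>{0..pi}. u differentiable (at x within {0..pi})) \<and>
     g absolutely_integrable_on {0<..<pi} \<and>
     (\<forall>x\<in>{0..pi}. d1 u x = d1 u 0 + integral {0..x} g)"

text \<open>\<open>-u'' + q u = f\<close> almost everywhere on \<open>(0, \<pi>)\<close>.\<close>

definition schroedinger_eq :: "(real \<Rightarrow> real) \<Rightarrow> (real \<Rightarrow> complex) \<Rightarrow> (real \<Rightarrow> complex) \<Rightarrow> bool" where
  "schroedinger_eq q u f \<longleftrightarrow>
     (\<exists>g. has_second_deriv u g \<and>
          (AE x\<in>{0<..<pi} in lebesgue. - g x + of_real (q x) * u x = f x))"

definition boundary_cond :: "real \<Rightarrow> real \<Rightarrow> (real \<Rightarrow> complex) \<Rightarrow> bool" where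
  "boundary_cond \<alpha> \<beta> u \<longleftrightarrow>
     u 0 * of_real (cos \<alpha>) - d1 u 0 * of_real (sin \<alpha>) = 0 \<and>
     u pi * of_real (cos \<beta>) + d1 u pi * of_real (sin \<beta>) = 0"

definition L2 :: "(real \<Rightarrow> complex) set" where
  "L2 = {f. f \<in> borel_measurable (lebesgue_on {0<..<pi}) \<and>
            integrable (lebesgue_on {0<..<pi}) (\<lambda>x. (norm (f x))\<^sup>2)}"

definition L2_norm :: "(real \<Rightarrow> complex) \<Rightarrow> real" where
  "L2_norm f = sqrt (LINT x|lebesgue_on {0<..<pi}. (norm (f x))\<^sup>2)"

text \<open>Graph of the operator \<open>u \<mapsto> -u'' + q u\<close> in \<open>L\<^sup>2(0, \<pi>)\<close>: \<open>u\<close> lies in the domain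
  and is mapped to \<open>f\<close>. The domain consists of all \<open>u\<close> with \<open>u, u'\<close> absolutely continuous,
  \<open>-u'' + q u \<in> L\<^sup>2\<close> and the boundary conditions.\<close>

definition schroedinger_op ::
  "(real \<Rightarrow> real) \<Rightarrow> real \<Rightarrow> real \<Rightarrow> (real \<Rightarrow> complex) \<Rightarrow> (real \<Rightarrow> complex) \<Rightarrow> bool" where
  "schroedinger_op q \<alpha> \<beta> u f \<longleftrightarrow>
     f \<in> L2 \<and> schroedinger_eq q u f \<and> boundary_cond \<alpha> \<beta> u"

text \<open>\<open>T - z\<close> is onto \<open>L\<^sup>2(0, \<pi>)\<close> and bounded below; the latter says that \<open>T - z\<close> is injective
  with bounded inverse.\<close>

definition resolvent_set :: "(real \<Rightarrow> real) \<Rightarrow> real \<Rightarrow> real \<Rightarrow> complex set" where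
  "resolvent_set q \<alpha> \<beta> = {z.
     (\<forall>g\<in>L2. \<exists>u f. schroedinger_op q \<alpha> \<beta> u f \<and>
                    (AE x\<in>{0<..<pi} in lebesgue. f x - z * u x = g x)) \<and>
     (\<exists>C. \<forall>u f. schroedinger_op q \<alpha> \<beta> u f \<longrightarrow>
                  L2_norm u \<le> C * L2_norm (\<lambda>x. f x - z * u x))}"

definition spectrum :: "(real \<Rightarrow> real) \<Rightarrow> real \<Rightarrow> real \<Rightarrow> complex set" where
  "spectrum q \<alpha> \<beta> = - resolvent_set q \<alpha> \<beta>"

text \<open>Sequences indexed by \<open>{1, 2, 3, \<dots>}\<close> are functions on \<open>nat\<close> whose value at \<open>0\<close> is ignored.\<close>

definition enumerates_spectrum :: "(nat \<Rightarrow> real) \<Rightarrow> (real \<Rightarrow> real) \<Rightarrow> real \<Rightarrow> real \<Rightarrow> bool" where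
  "enumerates_spectrum a q \<alpha> \<beta> \<longleftrightarrow>
     strict_mono_on {1..} a \<and> spectrum q \<alpha> \<beta> = (\<lambda>n. complex_of_real (a n)) ` {1..}"

text \<open>The solution \<open>u\<^sub>z\<close>. It is unique on \<open>[0, \<pi>]\<close>; the choice operator only fixes
  irrelevant values outside of this interval.\<close>

definition sol :: "(real \<Rightarrow> real) \<Rightarrow> real \<Rightarrow> complex \<Rightarrow> real \<Rightarrow> complex" where
  "sol q \<beta> z = (SOME u. schroedinger_eq q u (\<lambda>x. z * u x) \<and>
                        u pi = of_real (sin \<beta>) \<and> d1 u pi = - of_real (cos \<beta>))"

definition m_fun :: "(real \<Rightarrow> real) \<Rightarrow> real \<Rightarrow> real \<Rightarrow> real \<Rightarrow> complex \<Rightarrow> complex" where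
  "m_fun q \<alpha>1 \<alpha>2 \<beta> z = 1 / of_real (sin (\<alpha>2 - \<alpha>1)) *
     ((- of_real (sin \<alpha>1) * d1 (sol q \<beta> z) 0 + of_real (cos \<alpha>1) * sol q \<beta> z 0) /
      (- of_real (sin \<alpha>2) * d1 (sol q \<beta> z) 0 + of_real (cos \<alpha>2) * sol q \<beta> z 0))"

text \<open>The spectral measure is specified through the Herglotz representation of the
  \<open>m\<close>-function, an identity away from the poles of \<open>m\<close>.\<close>

definition spectral_measure ::
  "real measure \<Rightarrow> (real \<Rightarrow> real) \<Rightarrow> real \<Rightarrow> real \<Rightarrow> real \<Rightarrow> bool" where
  "spectral_measure \<mu> q \<alpha>1 \<alpha>2 \<beta> \<longleftrightarrow>
     sets \<mu> = sets borel \<and>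
     (AE t in \<mu>. complex_of_real t \<in> spectrum q \<alpha>2 \<beta>) \<and>
     integrable \<mu> (\<lambda>t. 1 / (1 + t\<^sup>2)) \<and>
     (\<exists>a b :: real. \<forall>z. z \<notin> spectrum q \<alpha>2 \<beta> \<longrightarrow>
        m_fun q \<alpha>1 \<alpha>2 \<beta> z = of_real a * z + of_real b +
          (LINT t|\<mu>. 1 / (of_real t - z) - of_real (t / (1 + t\<^sup>2))))"

end

theory Submission
  imports Defs "HOL-Complex_Analysis.Complex_Analysis" "HOL-Real_Asymp.Real_Asymp"
begin

text \<open>
  Let \<open>m\<close>, \<open>m'\<close> be the two \<open>m\<close>-functions. Their poles agree, so \<open>M = m - m'\<close> has at most simple
  poles, located at the \<open>a\<^sub>n\<close> with \<open>n \<notin> A\<close>, and it vanishes at the \<open>b\<^sub>n\<close> with \<open>n \<notin> A\<close>. The spectra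
  interlace because \<open>m\<close> increases between its poles, hence \<open>P(z) = \<Prod> (1 - z/a\<^sub>n) / (1 - z/b\<^sub>n)\<close>
  over \<open>n \<notin> A\<close> converges and \<open>M P\<close> extends to an entire function. Both factors are bounded by a
  polynomial in \<open>\<bar>z\<bar>\<close> over a power of \<open>\<bar>Im z\<bar>\<close>, so \<open>M P\<close> is a polynomial; by the asymptotics of
  the solutions it tends to \<open>0\<close> along the negative axis, so \<open>M = 0\<close>.

  That \<open>m\<close> determines \<open>q\<close> follows Bennewitz's argument: with \<open>\<theta>, \<phi>\<close> the solutions normalised at \<open>0\<close>,
  equality of the \<open>m\<close>-functions gives \<open>\<theta> \<phi>' - \<theta>' \<phi> = \<psi> \<phi>' - \<psi>' \<phi>\<close>, where primes refer to the second
  potential and \<open>\<psi> = u\<^sub>z / u\<^sub>z(0)\<close>. The left side is entire in \<open>z\<close>, the right side is \<open>O(1/\<bar>\<surd>z\<bar>)\<close> away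
  from the positive axis, so both vanish. Differentiating \<open>\<phi>/\<theta> = \<phi>'/\<theta>'\<close> yields \<open>\<theta>\<^sup>2 = \<theta>'\<^sup>2\<close>.
\<close>

section \<open>Indefinite integrals and Gronwall's inequality\<close>

text \<open>The delicate point is the negative axis, where \<open>P\<close> may grow linearly: the
  decay of \<open>M\<close> has to match the growth of \<open>P\<close>, and both depend on
  \<alpha>2. The difference \<open>M\<close> is a Wronskian of the two solutions at 0 over the
  product of the two denominators. That Wronskian vanishes at pi, so at 0 it is an integral of the
  difference of the potentials against a product of two exponentially decaying solutions, hence o(1)
  relative to their values at 0. If sin \<alpha>2 is nonzero, each denominator gains a factor of
  order sqrt |z|, so M = o(1/|z|), which beats linear growth. If sin \<alpha>2 = 0, only M = o(1) is
  available; but then the lowest of all eigenvalues is a zero of \<open>m\<close>, so b_n < a_n for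
  all n and each factor of \<open>P\<close> is at most 1 there. The polynomial has degree at most 2
  because the off-axis bound is of order |z|^5 / |Im z|^3. A second obstacle is that the potential
  is merely integrable: derivatives of solutions are handled as indefinite integrals, and the
  spectra, given through resolvents, must first be identified with zero sets of entire
  functions.\<close>

lemma const_if_small_increments:
  fixes E :: "real \<Rightarrow> 'a::real_normed_vector" and N :: "real \<Rightarrow> real"
  assumes small: "\<And>\<epsilon>. \<epsilon> > 0 \<Longrightarrow> \<exists>\<delta>>0. \<forall>s t. a \<le> s \<and> s \<le> t \<and> t \<le> b \<and> t < s + \<delta> \<longrightarrow>
      norm (E t - E s) \<le> \<epsilon> * (N t - N s)"
    and x: "a \<le> x" "x \<le> b"
  shows "E x = E a"
proof -
  have "norm (E x - E a) \<le> \<epsilon> * (N x - N a)" if e0: "\<epsilon> > 0" for \<epsilon>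
  proof -
    obtain \<delta> where \<delta>: "\<delta> > 0" "\<And>s t. a \<le> s \<Longrightarrow> s \<le> t \<Longrightarrow> t \<le> b \<Longrightarrow> t < s + \<delta> \<Longrightarrow>
      norm (E t - E s) \<le> \<epsilon> * (N t - N s)"
      using small[OF e0] by blast
    \<comment> \<open>The interval is cut into equal steps shorter than \<open>\<delta>\<close>; the
      increment bounds telescope to a bound over all of it, and \<open>\<epsilon>\<close> is
      arbitrary. This replaces differentiation almost everywhere in what follows.\<close>
    obtain n :: nat where n: "n > 0" "(x - a) / n < \<delta>"
    proof -
      obtain n :: nat where "(x - a) / \<delta> < n" using reals_Archimedean2 by blast
      then have "(x - a) / \<delta> < Suc n" by simp
      then have "(x - a) / Suc n < \<delta>" using \<open>\<delta> > 0\<close> by (simp add: field_simps)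
      then show ?thesis using that[of "Suc n"] by simp
    qed
    define h where "h = (x - a) / n"
    have h: "0 \<le> h" "h < \<delta>" "n * h = x - a" using x n by (auto simp: h_def)
    have "norm (E (a + i * h) - E a) \<le> \<epsilon> * (N (a + i * h) - N a)" if "i \<le> n" for i :: nat
      using that
    proof (induction i)
      case (Suc i)
      have "Suc i * h \<le> n * h" using Suc.prems h by (intro mult_right_mono) auto
      then have le: "a + Suc i * h \<le> b" using h x by linarith
      have "norm (E (a + Suc i * h) - E (a + i * h)) \<le> \<epsilon> * (N (a + Suc i * h) - N (a + i * h))"
        using h le by (intro \<delta>(2)) (auto simp: algebra_simps)
      moreover have "norm (E (a + Suc i * h) - E a) \<le>
          norm (E (a + Suc i * h) - E (a + i * h)) + norm (E (a + i * h) - E a)"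
        by (metis diff_add_cancel norm_triangle_ineq add_diff_eq)
      ultimately show ?case using Suc by (simp add: algebra_simps)
    qed simp
    from this[of n] show ?thesis using h by simp
  qed
  note * = this
  have "norm (E x - E a) \<le> 0"
  proof (cases "N x - N a > 0")
    case True
    show ?thesis
    proof (rule field_le_epsilon)
      fix e :: real assume "e > 0"
      then show "norm (E x - E a) \<le> 0 + e" using *[of "e / (N x - N a)"] True by simp
    qed
  next
    case False
    then have "1 * (N x - N a) \<le> 0" by simp
    then show ?thesis using *[of 1] by linarith
  qed
  then show ?thesis by simp
qed

lemma absolutely_integrable_mult_continuous:
  fixes f g :: "real \<Rightarrow> 'a::{euclidean_space, real_normed_field}"
  assumes f: "f absolutely_integrable_on {a..b}" and g: "continuous_on {a..b} g"
  shows "(\<lambda>x. f x * g x) absolutely_integrable_on {a..b}"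
proof -
  have "(\<lambda>x. g x * f x) absolutely_integrable_on {a..b}"
    using f g
    by (intro absolutely_integrable_bounded_measurable_product[where h = "(*)"] bilinear_times)
       (auto intro: continuous_imp_measurable_on_sets_lebesgue compact_imp_bounded compact_continuous_image)
  then show ?thesis by (simp add: mult.commute)
qed

lemma continuous_on_indefinite:
  fixes f :: "real \<Rightarrow> 'a::euclidean_space"
  assumes "f absolutely_integrable_on {a..b}" "\<And>x. x \<in> {a..b} \<Longrightarrow> F x = c + integral {a..x} f"
  shows "continuous_on {a..b} F"
proof -
  have "continuous_on {a..b} (\<lambda>x. c + integral {a..x} f)"
    using assms(1) by (intro continuous_intros indefinite_integral_continuous_1)
      (simp add: absolutely_integrable_on_def)
  then show ?thesis by (rule continuous_on_eq) (use assms(2) in simp)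
qed

lemma indefinite_increment:
  fixes f :: "real \<Rightarrow> 'a::euclidean_space"
  assumes "f absolutely_integrable_on {a..b}" "\<And>x. x \<in> {a..b} \<Longrightarrow> F x = c + integral {a..x} f"
    "a \<le> s" "s \<le> t" "t \<le> b"
  shows "F t - F s = integral {s..t} f"
proof -
  have "f integrable_on {a..t}"
    using assms by (auto simp: absolutely_integrable_on_def intro: integrable_subinterval_real)
  then have "integral {a..s} f + integral {s..t} f = integral {a..t} f"
    using assms by (intro Henstock_Kurzweil_Integration.integral_combine) auto
  then show ?thesis using assms(2)[of t] assms(2)[of s] assms by (simp add: algebra_simps)
qed

text \<open>Integrable \<open>f\<close> and \<open>g\<close> give no pointwise derivatives, so the
  product rule is proved by increments: over \<open>{s..t}\<close> the error is the integral of
  \<open>f \<tau> * (G t - G \<tau>) + (F s - F \<tau>) * g \<tau>\<close>, and uniform continuity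
  makes this at most \<open>\<epsilon>\<close> times the integral of
  \<open>norm f + norm g\<close>.\<close>

lemma product_indefinite:
  fixes f g F G :: "real \<Rightarrow> 'a::{euclidean_space, real_normed_field}"
  assumes f: "f absolutely_integrable_on {a..b}" and F: "\<And>x. x \<in> {a..b} \<Longrightarrow> F x = c + integral {a..x} f"
    and g: "g absolutely_integrable_on {a..b}" and G: "\<And>x. x \<in> {a..b} \<Longrightarrow> G x = d + integral {a..x} g"
    and x: "x \<in> {a..b}"
  shows "F x * G x = F a * G a + integral {a..x} (\<lambda>t. f t * G t + F t * g t)"
proof -
  have cF: "continuous_on {a..b} F" and cG: "continuous_on {a..b} G"
    using continuous_on_indefinite[OF f F] continuous_on_indefinite[OF g G] by auto
  let ?k = "\<lambda>t. f t * G t + F t * g t"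
  have kk: "?k absolutely_integrable_on {a..b}"
    using absolutely_integrable_mult_continuous[OF f cG] absolutely_integrable_mult_continuous[OF g cF]
    by (intro set_integral_add(1)) (auto simp: mult.commute)
  let ?n = "\<lambda>t. norm (f t) + norm (g t)"
  have nn: "?n absolutely_integrable_on {a..b}"
    using f g by (intro set_integral_add(1)) (auto intro: set_integrable_norm)
  define N where "N = (\<lambda>x. integral {a..x} ?n)"
  define E where "E = (\<lambda>x. F x * G x - integral {a..x} ?k)"
  have sub: "h integrable_on {s..t}" if "h absolutely_integrable_on {a..b}" "a \<le> s" "t \<le> b"
    for h :: "real \<Rightarrow> 'b::euclidean_space" and s t
    using that integrable_subinterval_real[of h a b s t] by (auto simp: absolutely_integrable_on_def)
  have "E x = E a"
  proof (rule const_if_small_increments[where N = N and E = E and b = b])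
    fix \<epsilon> :: real assume \<epsilon>: "\<epsilon> > 0"
    have "uniformly_continuous_on {a..b} F" "uniformly_continuous_on {a..b} G"
      using cF cG by (auto intro: compact_uniformly_continuous)
    with \<epsilon> obtain \<delta>1 \<delta>2 where d1: "\<delta>1 > 0" "\<And>s t. s \<in> {a..b} \<Longrightarrow> t \<in> {a..b} \<Longrightarrow> dist t s < \<delta>1 \<Longrightarrow> dist (F t) (F s) < \<epsilon>"
      and d2: "\<delta>2 > 0" "\<And>s t. s \<in> {a..b} \<Longrightarrow> t \<in> {a..b} \<Longrightarrow> dist t s < \<delta>2 \<Longrightarrow> dist (G t) (G s) < \<epsilon>"
      unfolding uniformly_continuous_on_def by metis
    show "\<exists>\<delta>>0. \<forall>s t. a \<le> s \<and> s \<le> t \<and> t \<le> b \<and> t < s + \<delta> \<longrightarrow> norm (E t - E s) \<le> \<epsilon> * (N t - N s)"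
    proof (intro exI[of _ "min \<delta>1 \<delta>2"] conjI allI impI, goal_cases)
      case (2 s t)
      then have st: "a \<le> s" "s \<le> t" "t \<le> b" "t < s + \<delta>1" "t < s + \<delta>2" by auto
      let ?e = "\<lambda>\<tau>. f \<tau> * (G t - G \<tau>) + (F s - F \<tau>) * g \<tau>"
      have "E t - E s = (F t - F s) * G t + F s * (G t - G s) - integral {s..t} ?k"
        using indefinite_increment[OF kk, of "\<lambda>x. integral {a..x} ?k" 0 s t] st
        by (simp add: E_def algebra_simps)
      also have "\<dots> = integral {s..t} (\<lambda>\<tau>. f \<tau> * G t) + integral {s..t} (\<lambda>\<tau>. F s * g \<tau>) - integral {s..t} ?k"
        using indefinite_increment[OF f F, of s t] indefinite_increment[OF g G, of s t] st by simp
      also have "\<dots> = integral {s..t} (\<lambda>\<tau>. f \<tau> * G t + F s * g \<tau> - ?k \<tau>)"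
        using sub[OF f] sub[OF g] sub[OF kk] st
        by (subst Henstock_Kurzweil_Integration.integral_diff)
           (auto intro!: integrable_add integrable_on_mult_left integrable_on_mult_right
             simp: Henstock_Kurzweil_Integration.integral_add integrable_on_mult_left integrable_on_mult_right)
      also have "\<dots> = integral {s..t} ?e"
        by (rule arg_cong[of _ _ "integral {s..t}"]) (auto simp: algebra_simps)
      finally have E: "E t - E s = integral {s..t} ?e" .
      have "?e integrable_on {s..t}"
      proof -
        have "(\<lambda>\<tau>. f \<tau> * G t + F s * g \<tau> - ?k \<tau>) integrable_on {s..t}"
          using sub[OF f] sub[OF g] sub[OF kk] st
          by (intro integrable_diff[of "\<lambda>\<tau>. f \<tau> * G t + F s * g \<tau>"] integrable_add[of "\<lambda>\<tau>. f \<tau> * G t"]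
               integrable_on_mult_left integrable_on_mult_right) auto
        then show ?thesis by (rule integrable_eq) (simp add: algebra_simps)
      qed
      moreover have "norm (?e \<tau>) \<le> \<epsilon> * ?n \<tau>" if "\<tau> \<in> {s..t}" for \<tau>
      proof -
        have "norm (G t - G \<tau>) \<le> \<epsilon>" "norm (F s - F \<tau>) \<le> \<epsilon>"
          using d1(2)[of \<tau> s] d2(2)[of \<tau> t] st that by (simp_all add: dist_norm)
        then have "norm (f \<tau> * (G t - G \<tau>)) + norm ((F s - F \<tau>) * g \<tau>) \<le> norm (f \<tau>) * \<epsilon> + \<epsilon> * norm (g \<tau>)"
          by (auto simp: norm_mult intro!: add_mono mult_left_mono mult_right_mono)
        then show ?thesis
          using norm_triangle_ineq[of "f \<tau> * (G t - G \<tau>)" "(F s - F \<tau>) * g \<tau>"] by (simp add: algebra_simps)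
      qed
      ultimately have "norm (integral {s..t} ?e) \<le> integral {s..t} (\<lambda>\<tau>. \<epsilon> * ?n \<tau>)"
        using sub[OF nn] st by (intro integral_norm_bound_integral) (auto intro: integrable_on_mult_right)
      also have "\<dots> = \<epsilon> * (N t - N s)"
        using indefinite_increment[OF nn, of N 0 s t] st by (simp add: N_def)
      finally show ?case by (simp add: E)
    qed (use d1 d2 in auto)
  qed (use x in auto)
  then show ?thesis by (simp add: E_def algebra_simps)
qed

text \<open>As \<open>R\<close> is nondecreasing, the increment of \<open>exp (R x)\<close> and that
  of the integral both lie between \<open>(R t - R s) * exp (R s)\<close> and
  \<open>(R t - R s) * exp (R t)\<close>, so their difference is small compared with the increment
  of \<open>R\<close>.\<close>

lemma integral_exp_indefinite:
  fixes r R :: "real \<Rightarrow> real"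
  assumes r: "r absolutely_integrable_on {a..b}" and pos: "\<And>x. x \<in> {a..b} \<Longrightarrow> 0 \<le> r x"
    and R: "\<And>x. x \<in> {a..b} \<Longrightarrow> R x = integral {a..x} r" and x: "x \<in> {a..b}"
  shows "integral {a..x} (\<lambda>t. r t * exp (R t)) = exp (R x) - 1"
proof -
  have cR: "continuous_on {a..b} R"
    using continuous_on_indefinite[OF r, of R 0] R by simp
  let ?k = "\<lambda>t. r t * exp (R t)"
  have kk: "?k absolutely_integrable_on {a..b}"
    using cR by (intro absolutely_integrable_mult_continuous r continuous_intros)
  have sub: "h integrable_on {s..t}" if "h absolutely_integrable_on {a..b}" "a \<le> s" "t \<le> b"
    for h :: "real \<Rightarrow> 'b::euclidean_space" and s t
    using that integrable_subinterval_real[of h a b s t] by (auto simp: absolutely_integrable_on_def)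
  have inc: "R t - R s = integral {s..t} r" if "a \<le> s" "s \<le> t" "t \<le> b" for s t
    using indefinite_increment[OF r, of R 0 s t] R that by simp
  have mono: "R s \<le> R t" if "a \<le> s" "s \<le> t" "t \<le> b" for s t
    using inc[OF that] integral_nonneg[of r "{s..t}"] sub[OF r] pos that by force
  define E where "E = (\<lambda>x. exp (R x) - integral {a..x} ?k)"
  have "E x = E a"
  proof (rule const_if_small_increments[where N = R and E = E and b = b])
    fix \<epsilon> :: real assume \<epsilon>: "\<epsilon> > 0"
    have "uniformly_continuous_on {a..b} (\<lambda>x. exp (R x))"
      using cR by (intro compact_uniformly_continuous continuous_intros) auto
    with \<epsilon> obtain \<delta> where d: "\<delta> > 0" "\<And>s t. s \<in> {a..b} \<Longrightarrow> t \<in> {a..b} \<Longrightarrow> dist t s < \<delta> \<Longrightarrow> dist (exp (R t)) (exp (R s)) < \<epsilon>"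
      unfolding uniformly_continuous_on_def by metis
    show "\<exists>\<delta>>0. \<forall>s t. a \<le> s \<and> s \<le> t \<and> t \<le> b \<and> t < s + \<delta> \<longrightarrow> norm (E t - E s) \<le> \<epsilon> * (R t - R s)"
    proof (intro exI[of _ \<delta>] conjI allI impI, goal_cases)
      case (2 s t)
      then have st: "a \<le> s" "s \<le> t" "t \<le> b" "t < s + \<delta>" by auto
      have R_le: "exp (R \<tau>) \<le> exp (R t)" "exp (R s) \<le> exp (R \<tau>)" if "\<tau> \<in> {s..t}" for \<tau>
        using mono that st by auto
      have rI: "(\<lambda>\<tau>. r \<tau> * exp (R u)) integrable_on {s..t}" for u
        using sub[OF r] st by (intro integrable_on_mult_left) auto
      have kI: "?k integrable_on {s..t}" using sub[OF kk] st by auto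
      have I: "integral {s..t} ?k \<le> integral {s..t} (\<lambda>\<tau>. r \<tau> * exp (R t))"
        by (rule integral_le[OF kI rI]) (use R_le pos st in \<open>auto intro!: mult_left_mono\<close>)
      have J: "integral {s..t} (\<lambda>\<tau>. r \<tau> * exp (R s)) \<le> integral {s..t} ?k"
        by (rule integral_le[OF rI kI]) (use R_le pos st in \<open>auto intro!: mult_left_mono\<close>)
      then have I: "integral {s..t} ?k \<le> (R t - R s) * exp (R t)"
        "(R t - R s) * exp (R s) \<le> integral {s..t} ?k"
        using I J inc[of s t] st by simp_all
      have D: "exp (R t) - exp (R s) \<le> (R t - R s) * exp (R t)"
        "(R t - R s) * exp (R s) \<le> exp (R t) - exp (R s)"
      proof -
        have "exp (R t) * (1 + (R s - R t)) \<le> exp (R t) * exp (R s - R t)"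
          by (intro mult_left_mono exp_ge_add_one_self) auto
        then show "exp (R t) - exp (R s) \<le> (R t - R s) * exp (R t)"
          by (simp add: exp_diff algebra_simps)
        have "exp (R s) * (1 + (R t - R s)) \<le> exp (R s) * exp (R t - R s)"
          by (intro mult_left_mono exp_ge_add_one_self) auto
        then show "(R t - R s) * exp (R s) \<le> exp (R t) - exp (R s)"
          by (simp add: exp_diff algebra_simps)
      qed
      have "E t - E s = (exp (R t) - exp (R s)) - integral {s..t} ?k"
        using indefinite_increment[OF kk, of "\<lambda>x. integral {a..x} ?k" 0 s t] st by (simp add: E_def)
      then have "norm (E t - E s) \<le> (R t - R s) * (exp (R t) - exp (R s))"
        using I D by (auto simp: abs_if algebra_simps)
      also have "\<dots> \<le> (R t - R s) * \<epsilon>"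
        using mono d(2)[of t s] d(2)[of s t] st
        by (intro mult_left_mono) (auto simp: dist_norm)
      finally show ?case by (simp add: mult.commute)
    qed (use d in auto)
  qed (use x in auto)
  then show ?thesis using R[of a] x by (simp add: E_def)
qed

text \<open>The weight \<open>exp (- 2 \<integral> r)\<close> makes the Volterra operator a contraction with constant \<open>1/2\<close>.\<close>

lemma gronwall_step:
  fixes r R \<Phi> :: "real \<Rightarrow> real"
  assumes r: "r absolutely_integrable_on {a..b}" and pos: "\<And>x. x \<in> {a..b} \<Longrightarrow> 0 \<le> r x"
    and R: "\<And>x. x \<in> {a..b} \<Longrightarrow> R x = integral {a..x} r" and x: "x \<in> {a..b}"
    and le: "\<And>x. x \<in> {a..b} \<Longrightarrow> \<Phi> x \<le> M * exp (2 * R x)" and M: "M \<ge> 0"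
    and c: "continuous_on {a..b} \<Phi>"
  shows "integral {a..x} (\<lambda>t. r t * \<Phi> t) \<le> M / 2 * exp (2 * R x)"
proof -
  have cR: "continuous_on {a..b} R"
    using continuous_on_indefinite[OF r, of R 0] R by simp
  have 2: "integral {a..x} (\<lambda>t. (2 * r t) * exp (2 * R t)) = exp (2 * R x) - 1"
    by (rule integral_exp_indefinite[where r = "\<lambda>t. 2 * r t" and R = "\<lambda>t. 2 * R t" and b = b])
      (use pos R x set_integrable_mult_right[OF r, of 2] in auto)
  have sub: "h integrable_on {a..x}" if "h absolutely_integrable_on {a..b}" for h :: "real \<Rightarrow> real"
    using that integrable_subinterval_real[of h a b a x] x by (auto simp: absolutely_integrable_on_def)
  have "integral {a..x} (\<lambda>t. r t * \<Phi> t) \<le> integral {a..x} (\<lambda>t. M / 2 * ((2 * r t) * exp (2 * R t)))"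
  proof (rule integral_le)
    show "(\<lambda>t. r t * \<Phi> t) integrable_on {a..x}" by (rule sub) (intro absolutely_integrable_mult_continuous r c)
    have "(\<lambda>t. (M * r t) * exp (2 * R t)) absolutely_integrable_on {a..b}"
      using set_integrable_mult_right[OF r, of M] cR
      by (intro absolutely_integrable_mult_continuous[where f = "\<lambda>t. M * r t"]) (auto intro!: continuous_intros)
    from sub[OF this] show "(\<lambda>t. M / 2 * ((2 * r t) * exp (2 * R t))) integrable_on {a..x}" by (simp add: algebra_simps)
    show "r t * \<Phi> t \<le> M / 2 * ((2 * r t) * exp (2 * R t))" if "t \<in> {a..x}" for t
      using mult_left_mono[OF le[of t] pos[of t]] that x by (simp add: algebra_simps)
  qed
  also have "\<dots> = M / 2 * (exp (2 * R x) - 1)"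
    by (subst integral_mult_right) (simp only: 2)
  also have "\<dots> \<le> M / 2 * exp (2 * R x)" using M by (intro mult_left_mono) auto
  finally show ?thesis .
qed

text \<open>The weighted function \<open>\<Phi> x * exp (- 2 * R x)\<close> attains a maximum
  \<open>M\<close> on the compact interval. At that point \<open>gronwall_step\<close> turns the
  hypothesis into M <= A + M/2. This costs the non-sharp factor 2 but avoids any iteration.\<close>

lemma gronwall:
  fixes r R \<Phi> :: "real \<Rightarrow> real"
  assumes r: "r absolutely_integrable_on {a..b}" and pos: "\<And>x. x \<in> {a..b} \<Longrightarrow> 0 \<le> r x"
    and c: "continuous_on {a..b} \<Phi>" and \<Phi>0: "\<And>x. x \<in> {a..b} \<Longrightarrow> 0 \<le> \<Phi> x"
    and le: "\<And>x. x \<in> {a..b} \<Longrightarrow> \<Phi> x \<le> A + integral {a..x} (\<lambda>t. r t * \<Phi> t)"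
    and A: "A \<ge> 0" and x: "x \<in> {a..b}"
  shows "\<Phi> x \<le> 2 * A * exp (2 * integral {a..x} r)"
proof -
  define R where "R = (\<lambda>x. integral {a..x} r)"
  have cR: "continuous_on {a..b} R"
    using continuous_on_indefinite[OF r, of R 0] by (simp add: R_def)
  have "continuous_on {a..b} (\<lambda>x. \<Phi> x * exp (- 2 * R x))"
    using c cR by (intro continuous_intros)
  then obtain y where y: "y \<in> {a..b}" and ymax: "\<And>x. x \<in> {a..b} \<Longrightarrow> \<Phi> x * exp (- 2 * R x) \<le> \<Phi> y * exp (- 2 * R y)"
    using continuous_attains_sup[of "{a..b}" "\<lambda>x. \<Phi> x * exp (- 2 * R x)"] x by auto
  define M where "M = \<Phi> y * exp (- 2 * R y)"
  have M: "M \<ge> 0" using \<Phi>0[OF y] by (simp add: M_def)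
  have \<Phi>le: "\<Phi> x \<le> M * exp (2 * R x)" if "x \<in> {a..b}" for x
    using ymax[OF that] by (simp add: M_def exp_minus field_simps)
  have R0: "R y \<ge> 0"
    unfolding R_def using r pos y integrable_subinterval_real[of r a b a y]
    by (intro integral_nonneg) (auto simp: absolutely_integrable_on_def)
  have "\<Phi> y \<le> A + M / 2 * exp (2 * R y)"
    using le[OF y] gronwall_step[OF r pos _ y \<Phi>le M c] by (force simp: R_def)
  then have "M \<le> (A + M / 2 * exp (2 * R y)) * exp (- 2 * R y)"
    unfolding M_def by (intro mult_right_mono) auto
  also have "\<dots> = A * exp (- 2 * R y) + M / 2" by (simp add: exp_minus field_simps)
  also have "\<dots> \<le> A * 1 + M / 2" using A R0 by (intro add_mono mult_left_mono) auto
  finally have "M \<le> 2 * A" by simp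
  then have "M * exp (2 * R x) \<le> 2 * A * exp (2 * R x)" by (intro mult_right_mono) auto
  with \<Phi>le[OF x] show ?thesis unfolding R_def by (rule order_trans)
qed

section \<open>Linear initial value problems with integrable coefficients\<close>

text \<open>First-order form of u'' = p u + h. The first equation holds pointwise, the second only
  in integrated form because \<open>p\<close> and \<open>h\<close> are merely integrable. The
  coefficient will be q - z; the source term \<open>h\<close> serves differentiation in z and the
  resolvent.\<close>

definition ivp :: "(real \<Rightarrow> complex) \<Rightarrow> (real \<Rightarrow> complex) \<Rightarrow> (real \<Rightarrow> complex) \<Rightarrow> (real \<Rightarrow> complex) \<Rightarrow> bool" where
  "ivp p h u v \<longleftrightarrow>
     (\<forall>x\<in>{0..pi}. (u has_vector_derivative v x) (at x within {0..pi})) \<and>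
     (\<forall>x\<in>{0..pi}. v x = v 0 + integral {0..x} (\<lambda>t. p t * u t + h t))"

lemma ivp_deriv: "ivp p h u v \<Longrightarrow> x \<in> {0..pi} \<Longrightarrow> (u has_vector_derivative v x) (at x within {0..pi})"
  and ivp_integral: "ivp p h u v \<Longrightarrow> x \<in> {0..pi} \<Longrightarrow> v x = v 0 + integral {0..x} (\<lambda>t. p t * u t + h t)"
  unfolding ivp_def by blast+

lemma ivp_cont1: "ivp p h u v \<Longrightarrow> continuous_on {0..pi} u"
  unfolding ivp_def by (meson continuous_on_eq_continuous_within has_vector_derivative_continuous)

lemma ivp_rhs_integrable:
  assumes "p absolutely_integrable_on {0..pi}" "h absolutely_integrable_on {0..pi}" "continuous_on {0..pi} u"
  shows "(\<lambda>t. p t * u t + h t :: complex) absolutely_integrable_on {0..pi}"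
  using assms by (intro set_integral_add(1) absolutely_integrable_mult_continuous)

lemma ivp_cont2:
  assumes "p absolutely_integrable_on {0..pi}" "h absolutely_integrable_on {0..pi}" "ivp p h u v"
  shows "continuous_on {0..pi} v"
  using continuous_on_indefinite[OF ivp_rhs_integrable[OF assms(1,2) ivp_cont1[OF assms(3)]]]
    ivp_integral[OF assms(3)] by blast

lemma ivp_integral1:
  assumes "ivp p h u v" "x \<in> {0..pi}"
  shows "u x = u 0 + integral {0..x} v"
proof -
  have "(v has_integral u x - u 0) {0..x}"
  proof (rule fundamental_theorem_of_calculus)
    show "(u has_vector_derivative v y) (at y within {0..x})" if "y \<in> {0..x}" for y
      using ivp_deriv[OF assms(1), of y] that assms(2)
      by (auto intro: has_vector_derivative_within_subset)
  qed (use assms in auto)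
  then show ?thesis by (simp add: integral_unique)
qed

lemma absolutely_integrable_sub:
  fixes f :: "real \<Rightarrow> 'a::euclidean_space"
  assumes "f absolutely_integrable_on {a..b}" "a \<le> s" "t \<le> b"
  shows "f absolutely_integrable_on {s..t}"
  using assms by (meson absolutely_integrable_on_subinterval atLeastatMost_subset_iff)

lemma integral_mono_upper:
  fixes f :: "real \<Rightarrow> real"
  assumes "f absolutely_integrable_on {a..b}" "\<And>x. x \<in> {a..b} \<Longrightarrow> 0 \<le> f x" "x \<in> {a..b}"
  shows "integral {a..x} f \<le> integral {a..b} f" "0 \<le> integral {a..x} f"
  using absolutely_integrable_sub[OF assms(1), of a x] assms
  by (auto intro!: integral_subset_le integral_nonneg simp: absolutely_integrable_on_def)

definition growth_const :: "(real \<Rightarrow> complex) \<Rightarrow> real" where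
  "growth_const p = 2 * exp (2 * integral {0..pi} (\<lambda>t. 1 + norm (p t)))"

text \<open>The sum \<open>norm (u x) + norm (v x)\<close> satisfies a Gronwall inequality with
  weight \<open>1 + norm (p t)\<close>: the 1 comes from u' = v and the second term from v' = p u +
  h. Both factors 2 in \<open>growth_const\<close> are those of \<open>gronwall\<close>.\<close>

lemma ivp_bound:
  assumes p: "p absolutely_integrable_on {0..pi}" and h: "h absolutely_integrable_on {0..pi}"
    and u: "ivp p h u v" and x: "x \<in> {0..pi}"
  shows "norm (u x) + norm (v x) \<le> (norm (u 0) + norm (v 0) + integral {0..pi} (\<lambda>t. norm (h t))) * growth_const p"
proof -
  define A where "A = norm (u 0) + norm (v 0) + integral {0..pi} (\<lambda>t. norm (h t))"
  have cu: "continuous_on {0..pi} u" and cv: "continuous_on {0..pi} v"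
    using ivp_cont1[OF u] ivp_cont2[OF p h u] by auto
  define \<Phi> where "\<Phi> = (\<lambda>x. norm (u x) + norm (v x))"
  define r where "r = (\<lambda>t. 1 + norm (p t))"
  have np: "(\<lambda>t. norm (p t)) absolutely_integrable_on {0..pi}" and nh: "(\<lambda>t. norm (h t)) absolutely_integrable_on {0..pi}"
    using p h by (auto intro: set_integrable_norm)
  have r: "r absolutely_integrable_on {0..pi}"
    unfolding r_def using np by (intro set_integral_add(1)) auto
  have nh0: "integral {0..x} (\<lambda>t. norm (h t)) \<le> integral {0..pi} (\<lambda>t. norm (h t))" "0 \<le> integral {0..x} (\<lambda>t. norm (h t))"
    if "x \<in> {0..pi}" for x
    using integral_mono_upper[OF nh] that by auto
  have c\<Phi>: "continuous_on {0..pi} \<Phi>" unfolding \<Phi>_def using cu cv by (intro continuous_intros)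
  have le: "\<Phi> x \<le> A + integral {0..x} (\<lambda>t. r t * \<Phi> t)" if x: "x \<in> {0..pi}" for x
  proof -
    have iv: "(\<lambda>t. norm (v t)) integrable_on {0..x}"
      using cv x by (intro integrable_continuous_real continuous_intros continuous_on_subset[OF cv]) auto
    have "v integrable_on {0..x}"
      using x by (intro integrable_continuous_real continuous_on_subset[OF cv]) auto
    then have "norm (integral {0..x} v) \<le> integral {0..x} (\<lambda>t. norm (v t))"
      using iv by (intro integral_norm_bound_integral) auto
    then have 1: "norm (u x) \<le> norm (u 0) + integral {0..x} (\<lambda>t. norm (v t))"
      using ivp_integral1[OF u x] norm_triangle_ineq[of "u 0" "integral {0..x} v"] by simp
    have ipu: "(\<lambda>t. norm (p t) * norm (u t)) absolutely_integrable_on {0..pi}"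
      by (intro absolutely_integrable_mult_continuous np continuous_intros cu)
    have ipu': "(\<lambda>t. norm (p t) * norm (u t)) integrable_on {0..x}" and inh: "(\<lambda>t. norm (h t)) integrable_on {0..x}"
      using absolutely_integrable_sub[OF ipu, of 0 x] absolutely_integrable_sub[OF nh, of 0 x] x
      by (auto simp: absolutely_integrable_on_def)
    have "norm (integral {0..x} (\<lambda>t. p t * u t + h t)) \<le> integral {0..x} (\<lambda>t. norm (p t) * norm (u t) + norm (h t))"
    proof (rule integral_norm_bound_integral)
      show "(\<lambda>t. p t * u t + h t) integrable_on {0..x}"
        using absolutely_integrable_sub[OF ivp_rhs_integrable[OF p h cu], of 0 x] x by (simp add: absolutely_integrable_on_def)
      show "(\<lambda>t. norm (p t) * norm (u t) + norm (h t)) integrable_on {0..x}"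
        using ipu' inh by (rule integrable_add)
      show "norm (p t * u t + h t) \<le> norm (p t) * norm (u t) + norm (h t)" for t
        by (metis norm_mult norm_triangle_ineq)
    qed
    also have "\<dots> = integral {0..x} (\<lambda>t. norm (p t) * norm (u t)) + integral {0..x} (\<lambda>t. norm (h t))"
      using ipu' inh by (rule Henstock_Kurzweil_Integration.integral_add)
    finally have 2: "norm (v x) \<le> norm (v 0) + integral {0..x} (\<lambda>t. norm (p t) * norm (u t)) + integral {0..pi} (\<lambda>t. norm (h t))"
      using ivp_integral[OF u x] norm_triangle_ineq[of "v 0" "integral {0..x} (\<lambda>t. p t * u t + h t)"] nh0[OF x] by simp
    have "integral {0..x} (\<lambda>t. norm (v t)) + integral {0..x} (\<lambda>t. norm (p t) * norm (u t)) =
        integral {0..x} (\<lambda>t. norm (v t) + norm (p t) * norm (u t))"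
      using iv ipu' by (rule Henstock_Kurzweil_Integration.integral_add[symmetric])
    also have "\<dots> \<le> integral {0..x} (\<lambda>t. r t * \<Phi> t)"
    proof (rule integral_le)
      have "(\<lambda>t. r t * \<Phi> t) absolutely_integrable_on {0..pi}"
        by (intro absolutely_integrable_mult_continuous r c\<Phi>)
      then have "(\<lambda>t. r t * \<Phi> t) absolutely_integrable_on {0..x}"
        by (rule absolutely_integrable_sub) (use x in auto)
      then show "(\<lambda>t. r t * \<Phi> t) integrable_on {0..x}" by (simp add: absolutely_integrable_on_def)
      show "(\<lambda>t. norm (v t) + norm (p t) * norm (u t)) integrable_on {0..x}"
        using iv ipu' by (rule integrable_add)
    qed (auto simp: r_def \<Phi>_def algebra_simps)
    finally show ?thesis using 1 2 by (simp add: \<Phi>_def A_def)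
  qed
  have A0: "A \<ge> 0" unfolding A_def using nh0(2)[of pi] by simp
  have "\<Phi> x \<le> 2 * A * exp (2 * integral {0..x} r)"
    by (rule gronwall[OF r _ c\<Phi> _ le A0 x]) (auto simp: r_def \<Phi>_def)
  also have "\<dots> \<le> 2 * A * exp (2 * integral {0..pi} r)"
    using A0 integral_mono_upper[OF r _ x] by (intro mult_left_mono) (auto simp: r_def)
  finally show ?thesis by (simp add: \<Phi>_def A_def growth_const_def r_def algebra_simps)
qed

lemma growth_const_pos: "growth_const p > 0" by (simp add: growth_const_def)

lemma ivp_add_scale:
  assumes u: "ivp p h u v" and u': "ivp p h' u' v'"
    and p: "p absolutely_integrable_on {0..pi}" and h: "h absolutely_integrable_on {0..pi}"
    and h': "h' absolutely_integrable_on {0..pi}"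
  shows "ivp p (\<lambda>x. h x + c * h' x) (\<lambda>x. u x + c * u' x) (\<lambda>x. v x + c * v' x)"
  unfolding ivp_def
proof (intro conjI ballI)
  fix x assume x: "x \<in> {0..pi}"
  show "((\<lambda>x. u x + c * u' x) has_vector_derivative v x + c * v' x) (at x within {0..pi})"
    using ivp_deriv[OF u x] ivp_deriv[OF u' x]
    by (auto intro!: derivative_eq_intros has_vector_derivative_mult_right)
  have i: "(\<lambda>t. p t * u t + h t) integrable_on {0..x}" "(\<lambda>t. p t * u' t + h' t) integrable_on {0..x}"
    using absolutely_integrable_sub[OF ivp_rhs_integrable[OF p h ivp_cont1[OF u]], of 0 x]
      absolutely_integrable_sub[OF ivp_rhs_integrable[OF p h' ivp_cont1[OF u']], of 0 x] x
    by (auto simp: absolutely_integrable_on_def)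
  have "integral {0..x} (\<lambda>t. p t * (u t + c * u' t) + (h t + c * h' t)) =
    integral {0..x} (\<lambda>t. (p t * u t + h t) + c * (p t * u' t + h' t))"
    by (rule arg_cong[of _ _ "integral {0..x}"]) (auto simp: algebra_simps)
  also have "\<dots> = integral {0..x} (\<lambda>t. p t * u t + h t) + c * integral {0..x} (\<lambda>t. p t * u' t + h' t)"
    using i by (subst Henstock_Kurzweil_Integration.integral_add) (auto intro: integrable_on_mult_right)
  finally show "v x + c * v' x = v 0 + c * v' 0 + integral {0..x} (\<lambda>t. p t * (u t + c * u' t) + (h t + c * h' t))"
    using ivp_integral[OF u x] ivp_integral[OF u' x] by (simp add: algebra_simps)
qed

lemma ivp_unique:
  assumes p: "p absolutely_integrable_on {0..pi}" and h: "h absolutely_integrable_on {0..pi}"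
    and u: "ivp p h u v" and u': "ivp p h u' v'" and eq: "u 0 = u' 0" "v 0 = v' 0" and x: "x \<in> {0..pi}"
  shows "u x = u' x" "v x = v' x"
proof -
  have "ivp p (\<lambda>x. h x + (-1) * h x) (\<lambda>x. u x + (-1) * u' x) (\<lambda>x. v x + (-1) * v' x)"
    by (rule ivp_add_scale[OF u u' p h h])
  then have "ivp p (\<lambda>x. 0) (\<lambda>x. u x - u' x) (\<lambda>x. v x - v' x)" by simp
  from ivp_bound[OF p _ this x] eq have "norm (u x - u' x) + norm (v x - v' x) \<le> 0" by simp
  then show "u x = u' x" "v x = v' x"
    using norm_ge_zero[of "u x - u' x"] norm_ge_zero[of "v x - v' x"] by (smt (verit) norm_le_zero_iff right_minus_eq)+
qed

lemma tendsto_integral_mult_uniform: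
  fixes p u :: "real \<Rightarrow> complex"
  assumes p: "p absolutely_integrable_on {a..b}" and lim: "uniform_limit {a..b} f u sequentially"
    and cf: "\<And>n. continuous_on {a..b} (f n)"
  shows "(\<lambda>n. integral {a..b} (\<lambda>t. p t * f n t)) \<longlonglongrightarrow> integral {a..b} (\<lambda>t. p t * u t)"
proof (rule tendstoI)
  fix e :: real assume e: "e > 0"
  have cu: "continuous_on {a..b} u"
    by (rule uniform_limit_theorem[OF _ lim]) (auto simp: cf)
  have np: "(\<lambda>t. norm (p t)) integrable_on {a..b}" using p by (simp add: absolutely_integrable_on_def)
  define P where "P = integral {a..b} (\<lambda>t. norm (p t))"
  have P: "P \<ge> 0" unfolding P_def using np by (intro integral_nonneg) auto
  define d where "d = e / (P + 1)"
  have d: "d > 0" "d * P < e" using e P by (auto simp: d_def field_simps)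
  from uniform_limitD[OF lim d(1)]
  show "\<forall>\<^sub>F n in sequentially. dist (integral {a..b} (\<lambda>t. p t * f n t)) (integral {a..b} (\<lambda>t. p t * u t)) < e"
  proof eventually_elim
    case (elim n)
    have i: "(\<lambda>t. p t * f n t) integrable_on {a..b}" "(\<lambda>t. p t * u t) integrable_on {a..b}"
      using absolutely_integrable_mult_continuous[OF p cf] absolutely_integrable_mult_continuous[OF p cu]
      by (auto simp: absolutely_integrable_on_def)
    have "dist (integral {a..b} (\<lambda>t. p t * f n t)) (integral {a..b} (\<lambda>t. p t * u t)) =
       norm (integral {a..b} (\<lambda>t. p t * f n t - p t * u t))"
      using i by (simp add: dist_norm Henstock_Kurzweil_Integration.integral_diff)
    also have "\<dots> \<le> integral {a..b} (\<lambda>t. d * norm (p t))"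
    proof (rule integral_norm_bound_integral)
      show "norm (p t * f n t - p t * u t) \<le> d * norm (p t)" if "t \<in> {a..b}" for t
        using elim that mult_left_mono[of "norm (f n t - u t)" d "norm (p t)"]
        by (force simp: dist_norm norm_mult mult.commute simp flip: right_diff_distrib)
    qed (use i np in \<open>auto intro: integrable_diff integrable_on_mult_right\<close>)
    also have "\<dots> < e" using d by (simp add: P_def)
    finally show ?case .
  qed
qed

section \<open>Existence of solutions by Picard iteration\<close>

context
  fixes p h :: "real \<Rightarrow> complex" and c d :: complex
begin

primrec picard :: "nat \<Rightarrow> (real \<Rightarrow> complex) \<times> (real \<Rightarrow> complex)" where
  "picard 0 = (\<lambda>x. c, \<lambda>x. d)"
| "picard (Suc n) = (\<lambda>x. c + integral {0..x} (snd (picard n)),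
                     \<lambda>x. d + integral {0..x} (\<lambda>t. p t * fst (picard n) t + h t))"

lemma picard_continuous:
  assumes "p absolutely_integrable_on {0..pi}" "h absolutely_integrable_on {0..pi}"
  shows "continuous_on {0..pi} (fst (picard n)) \<and> continuous_on {0..pi} (snd (picard n))"
proof (induction n)
  case (Suc n)
  show ?case
  proof
    show "continuous_on {0..pi} (fst (picard (Suc n)))"
      by (rule continuous_on_indefinite[OF absolutely_integrable_continuous_real[OF Suc[THEN conjunct2]], of _ c]) simp
    show "continuous_on {0..pi} (snd (picard (Suc n)))"
      by (rule continuous_on_indefinite[OF ivp_rhs_integrable[OF assms Suc[THEN conjunct1]], of _ d]) simp
  qed
qed auto

text \<open>Relative to the weight \<open>exp (2 * R x)\<close> the Volterra operator halves norms
  (\<open>gronwall_step\<close>), so the increments decay geometrically with ratio 1/2;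
  \<open>R x \<le> R pi\<close> then makes the bound uniform in \<open>x\<close>.\<close>

lemma picard_increment:
  assumes p: "p absolutely_integrable_on {0..pi}" and h: "h absolutely_integrable_on {0..pi}"
  obtains M where "M \<ge> 0" "\<And>n x. x \<in> {0..pi} \<Longrightarrow>
    norm (fst (picard (Suc n)) x - fst (picard n) x) + norm (snd (picard (Suc n)) x - snd (picard n) x) \<le> M * (1/2) ^ n"
proof -
  define r where "r = (\<lambda>t. 1 + norm (p t))"
  define R where "R = (\<lambda>x. integral {0..x} r)"
  define \<Phi> where "\<Phi> = (\<lambda>n x. norm (fst (picard (Suc n)) x - fst (picard n) x) + norm (snd (picard (Suc n)) x - snd (picard n) x))"
  have cont: "continuous_on {0..pi} (fst (picard n))" "continuous_on {0..pi} (snd (picard n))" for n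
    using picard_continuous[OF p h, of n] by auto
  have c\<Phi>: "continuous_on {0..pi} (\<Phi> n)" for n
    unfolding \<Phi>_def by (intro continuous_intros cont)
  have np: "(\<lambda>t. norm (p t)) absolutely_integrable_on {0..pi}"
    using p by (auto intro: set_integrable_norm)
  have r: "r absolutely_integrable_on {0..pi}"
    unfolding r_def using np by (intro set_integral_add(1)) auto
  have r0: "0 \<le> r x" for x by (simp add: r_def)
  have R0: "0 \<le> R x" "R x \<le> R pi" if "x \<in> {0..pi}" for x
    unfolding R_def using integral_mono_upper[OF r r0 that] by auto
  obtain M where M: "M \<ge> 0" "\<And>x. x \<in> {0..pi} \<Longrightarrow> \<Phi> 0 x \<le> M"
  proof -
    obtain y where y: "y \<in> {0..pi}" "\<And>x. x \<in> {0..pi} \<Longrightarrow> \<Phi> 0 x \<le> \<Phi> 0 y"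
      using continuous_attains_sup[OF compact_Icc _ c\<Phi>[of 0]] pi_ge_zero by (metis atLeastatMost_empty_iff2 not_less)
    moreover have "\<Phi> 0 y \<ge> 0" by (simp add: \<Phi>_def)
    ultimately show ?thesis using that by blast
  qed
  have *: "\<Phi> n x \<le> M * (1/2) ^ n * exp (2 * R x)" if "x \<in> {0..pi}" for n x
    using that
  proof (induction n arbitrary: x)
    case 0
    have "M * 1 \<le> M * exp (2 * R x)" using M R0[OF 0] by (intro mult_left_mono) auto
    then show ?case using M(2)[OF 0] by simp
  next
    case (Suc n)
    let ?u = "\<lambda>n. fst (picard n)" and ?v = "\<lambda>n. snd (picard n)"
    have x: "x \<in> {0..pi}" by fact
    have iv: "?v k integrable_on {0..x}" for k
      using x by (intro integrable_continuous_real continuous_on_subset[OF cont(2)]) auto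
    have ip: "(\<lambda>t. p t * ?u k t + h t) integrable_on {0..x}" for k
      using absolutely_integrable_sub[OF ivp_rhs_integrable[OF p h cont(1)[of k]], of 0 x] x by (simp add: absolutely_integrable_on_def)
    have A1: "?u (Suc (Suc n)) x - ?u (Suc n) x = integral {0..x} (\<lambda>t. ?v (Suc n) t - ?v n t)"
      using Henstock_Kurzweil_Integration.integral_diff[OF iv[of "Suc n"] iv[of n]] by simp
    have A2: "?v (Suc (Suc n)) x - ?v (Suc n) x = integral {0..x} (\<lambda>t. p t * (?u (Suc n) t - ?u n t))"
      using Henstock_Kurzweil_Integration.integral_diff[OF ip[of "Suc n"] ip[of n]] by (simp add: right_diff_distrib)
    have iD: "(\<lambda>t. norm (?v (Suc n) t - ?v n t)) integrable_on {0..x}" "(\<lambda>t. ?v (Suc n) t - ?v n t) integrable_on {0..x}"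
      using x by (auto intro!: integrable_continuous_real continuous_intros continuous_on_subset[OF cont(2)] simp del: picard.simps)
    have B1: "norm (integral {0..x} (\<lambda>t. ?v (Suc n) t - ?v n t)) \<le> integral {0..x} (\<lambda>t. norm (?v (Suc n) t - ?v n t))"
      by (rule integral_norm_bound_integral) (use iD in auto)
    have pa: "(\<lambda>t. p t * (?u (Suc n) t - ?u n t)) absolutely_integrable_on {0..pi}"
      by (intro absolutely_integrable_mult_continuous p continuous_intros cont)
    have pn: "(\<lambda>t. norm (p t * (?u (Suc n) t - ?u n t))) integrable_on {0..x}" "(\<lambda>t. p t * (?u (Suc n) t - ?u n t)) integrable_on {0..x}"
      using absolutely_integrable_sub[OF pa, of 0 x] x by (auto simp: absolutely_integrable_on_def simp del: picard.simps)
    have B2: "norm (integral {0..x} (\<lambda>t. p t * (?u (Suc n) t - ?u n t))) \<le> integral {0..x} (\<lambda>t. norm (p t * (?u (Suc n) t - ?u n t)))"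
      by (rule integral_norm_bound_integral) (use pn in auto)
    have "\<Phi> (Suc n) x \<le> integral {0..x} (\<lambda>t. norm (?v (Suc n) t - ?v n t)) + integral {0..x} (\<lambda>t. norm (p t * (?u (Suc n) t - ?u n t)))"
      unfolding \<Phi>_def A1 A2 using B1 B2 by linarith
    also have "\<dots> = integral {0..x} (\<lambda>t. norm (?v (Suc n) t - ?v n t) + norm (p t * (?u (Suc n) t - ?u n t)))"
      using iD(1) pn(1) by (rule Henstock_Kurzweil_Integration.integral_add[symmetric])
    also have "\<dots> \<le> integral {0..x} (\<lambda>t. r t * \<Phi> n t)"
    proof (rule integral_le)
      have "(\<lambda>t. r t * \<Phi> n t) absolutely_integrable_on {0..pi}"
        by (intro absolutely_integrable_mult_continuous r c\<Phi>)
      then have "(\<lambda>t. r t * \<Phi> n t) absolutely_integrable_on {0..x}"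
        by (rule absolutely_integrable_sub) (use x in auto)
      then show "(\<lambda>t. r t * \<Phi> n t) integrable_on {0..x}" by (simp add: absolutely_integrable_on_def)
      show "(\<lambda>t. norm (?v (Suc n) t - ?v n t) + norm (p t * (?u (Suc n) t - ?u n t))) integrable_on {0..x}"
        using iD(1) pn(1) by (rule integrable_add)
    qed (simp add: r_def \<Phi>_def distrib_left distrib_right norm_mult del: picard.simps)
    also have "\<dots> \<le> (M * (1/2) ^ n) / 2 * exp (2 * R x)"
      by (rule gronwall_step[OF r r0 _ x Suc.IH _ c\<Phi>]) (use M in \<open>auto simp: R_def\<close>)
    finally show ?case by simp
  qed
  show ?thesis
  proof (rule that[of "M * exp (2 * R pi)"])
    fix n x assume x: "x \<in> {0..pi}"
    have "\<Phi> n x \<le> M * (1/2) ^ n * exp (2 * R x)" by (rule *[OF x])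
    also have "\<dots> \<le> M * (1/2) ^ n * exp (2 * R pi)" using M R0[OF x] by (intro mult_left_mono) auto
    finally show "norm (fst (picard (Suc n)) x - fst (picard n) x) + norm (snd (picard (Suc n)) x - snd (picard n) x)
        \<le> M * exp (2 * R pi) * (1/2) ^ n"
      by (simp add: \<Phi>_def mult_ac)
  qed (use M in auto)
qed

end

lemma uniform_limit_geometric_increments:
  fixes f :: "nat \<Rightarrow> 'a \<Rightarrow> 'b::banach"
  assumes "\<And>n x. x \<in> S \<Longrightarrow> norm (f (Suc n) x - f n x) \<le> M * (1/2) ^ n"
  obtains g where "uniform_limit S f g sequentially"
proof -
  have "uniform_limit S (\<lambda>n x. \<Sum>i<n. f (Suc i) x - f i x) (\<lambda>x. \<Sum>i. f (Suc i) x - f i x) sequentially"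
    by (rule Weierstrass_m_test[where M = "\<lambda>n. M * (1/2) ^ n"]) (auto intro!: assms summable_mult summable_geometric)
  then have "uniform_limit S (\<lambda>n x. f 0 x + (f n x - f 0 x)) (\<lambda>x. f 0 x + (\<Sum>i. f (Suc i) x - f i x)) sequentially"
  proof (intro uniform_limit_intros)
    assume "uniform_limit S (\<lambda>n x. \<Sum>i<n. f (Suc i) x - f i x) (\<lambda>x. \<Sum>i. f (Suc i) x - f i x) sequentially"
    moreover have "(\<lambda>n x. \<Sum>i<n. f (Suc i) x - f i x) = (\<lambda>n x. f n x - f 0 x)"
      by (intro ext) (rule sum_lessThan_telescope)
    ultimately show "uniform_limit S (\<lambda>n x. f n x - f 0 x) (\<lambda>x. \<Sum>i. f (Suc i) x - f i x) sequentially"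
      by simp
  qed
  then show ?thesis using that by simp
qed

lemma ivp_exists:
  assumes p: "p absolutely_integrable_on {0..pi}" and h: "h absolutely_integrable_on {0..pi}"
  obtains u v where "ivp p h u v" "u 0 = c" "v 0 = d"
proof -
  let ?P = "picard p h c d"
  obtain M where "M \<ge> 0" and M: "\<And>n x. x \<in> {0..pi} \<Longrightarrow>
    norm (fst (?P (Suc n)) x - fst (?P n) x) + norm (snd (?P (Suc n)) x - snd (?P n) x) \<le> M * (1/2) ^ n"
    by (rule picard_increment[OF p h, where c = c and d = d], rule that)
  have "norm (fst (?P (Suc n)) x - fst (?P n) x) \<le> M * (1/2) ^ n" "norm (snd (?P (Suc n)) x - snd (?P n) x) \<le> M * (1/2) ^ n"
    if "x \<in> {0..pi}" for n x
    by (rule order_trans[OF _ M[OF that]], simp del: picard.simps)+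
  note inc = this
  obtain u where u: "uniform_limit {0..pi} (\<lambda>n. fst (?P n)) u sequentially"
    by (rule uniform_limit_geometric_increments[of "{0..pi}" "\<lambda>n. fst (?P n)", OF inc(1)])
  obtain v where v: "uniform_limit {0..pi} (\<lambda>n. snd (?P n)) v sequentially"
    by (rule uniform_limit_geometric_increments[of "{0..pi}" "\<lambda>n. snd (?P n)", OF inc(2)])
  have cont: "continuous_on {0..pi} (fst (?P n))" "continuous_on {0..pi} (snd (?P n))" for n
    using picard_continuous[OF p h, of c d n] by auto
  have cu: "continuous_on {0..pi} u" and cv: "continuous_on {0..pi} v"
    by (rule uniform_limit_theorem[OF _ u] uniform_limit_theorem[OF _ v]; simp add: cont)+
  have ux: "u x = c + integral {0..x} v" and vx: "v x = d + integral {0..x} (\<lambda>t. p t * u t + h t)" if x: "x \<in> {0..pi}" for x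
  proof -
    have s: "{0..x} \<subseteq> {0..pi}" using x by auto
    have "(\<lambda>n. integral {0..x} (\<lambda>t. 1 * snd (?P n) t)) \<longlonglongrightarrow> integral {0..x} (\<lambda>t. 1 * v t)"
      by (rule tendsto_integral_mult_uniform[OF _ uniform_limit_on_subset[OF v s] continuous_on_subset[OF cont(2) s]]) auto
    then have "(\<lambda>n. c + integral {0..x} (snd (?P n))) \<longlonglongrightarrow> c + integral {0..x} v" by (intro tendsto_intros) simp
    then have "(\<lambda>n. fst (?P (Suc n)) x) \<longlonglongrightarrow> c + integral {0..x} v" by simp
    moreover have "(\<lambda>n. fst (?P n) x) \<longlonglongrightarrow> u x" using tendsto_uniform_limitI[OF u x] .
    ultimately show "u x = c + integral {0..x} v" using LIMSEQ_Suc LIMSEQ_unique by blast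
    have pI: "(\<lambda>t. p t * w t) integrable_on {0..x}" "h integrable_on {0..x}" if "continuous_on {0..pi} w" for w
      using absolutely_integrable_sub[OF absolutely_integrable_mult_continuous[OF p that], of 0 x]
        absolutely_integrable_sub[OF h, of 0 x] x by (auto simp: absolutely_integrable_on_def)
    have "(\<lambda>n. integral {0..x} (\<lambda>t. p t * fst (?P n) t)) \<longlonglongrightarrow> integral {0..x} (\<lambda>t. p t * u t)"
      by (rule tendsto_integral_mult_uniform[OF _ uniform_limit_on_subset[OF u s] continuous_on_subset[OF cont(1) s]])
        (use absolutely_integrable_sub[OF p, of 0 x] x in auto)
    then have "(\<lambda>n. d + (integral {0..x} (\<lambda>t. p t * fst (?P n) t) + integral {0..x} h)) \<longlonglongrightarrow> d + (integral {0..x} (\<lambda>t. p t * u t) + integral {0..x} h)"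
      by (intro tendsto_intros)
    then have "(\<lambda>n. snd (?P (Suc n)) x) \<longlonglongrightarrow> d + integral {0..x} (\<lambda>t. p t * u t + h t)"
      using pI[OF cont(1)] pI[OF cu] by (simp add: Henstock_Kurzweil_Integration.integral_add)
    moreover have "(\<lambda>n. snd (?P n) x) \<longlonglongrightarrow> v x" using tendsto_uniform_limitI[OF v x] .
    ultimately show "v x = d + integral {0..x} (\<lambda>t. p t * u t + h t)" using LIMSEQ_Suc LIMSEQ_unique by blast
  qed
  have 0: "u 0 = c" "v 0 = d" using ux[of 0] vx[of 0] by auto
  have "ivp p h u v"
    unfolding ivp_def
  proof (intro conjI ballI)
    fix x assume x: "x \<in> {0..pi}"
    have "((\<lambda>x. integral {0..x} v) has_vector_derivative v x) (at x within {0..pi})"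
      by (rule integral_has_vector_derivative[OF cv x])
    then have "((\<lambda>x. c + integral {0..x} v) has_vector_derivative v x) (at x within {0..pi})"
      by (auto intro!: derivative_eq_intros)
    then show "(u has_vector_derivative v x) (at x within {0..pi})"
      by (rule has_vector_derivative_transform[OF x, rotated]) (use ux in auto)
    show "v x = v 0 + integral {0..x} (\<lambda>t. p t * u t + h t)" using vx[OF x] 0 by simp
  qed
  then show ?thesis using that 0 by blast
qed

section \<open>Reflection of the interval [0, pi]\<close>

lemma has_integral_reflect:
  fixes f :: "real \<Rightarrow> 'a::euclidean_space"
  assumes "f integrable_on {b - x..b - a}"
  shows "((\<lambda>t. f (b - t)) has_integral integral {b - x..b - a} f) {a..x}"
proof -
  have "(f has_integral integral {b - x..b - a} f) (cbox (b - x) (b - a))" using assms by (simp add: integrable_integral)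
  from has_integral_affinity[OF this, of "-1" b]
  have "((\<lambda>t. f (b - t)) has_integral integral {b - x..b - a} f) ((\<lambda>t. b - t) ` {b - x..b - a})"
    by simp
  moreover have "(\<lambda>t. b - t) ` {b - x..b - a} = {a..x}"
    by (auto simp: image_iff intro: bexI[of _ "b - _"])
  ultimately show ?thesis by simp
qed

lemma absolutely_integrable_reflect:
  fixes f :: "real \<Rightarrow> 'a::euclidean_space"
  assumes "f absolutely_integrable_on {0..pi}"
  shows "(\<lambda>t. f (pi - t)) absolutely_integrable_on {0..pi}"
  using assms has_integral_reflect[of f pi pi 0] has_integral_reflect[of "\<lambda>t. norm (f t)" pi pi 0]
  by (auto simp: absolutely_integrable_on_def)

text \<open>Initial value problems are solved from 0, whereas \<open>sol\<close> is normalised at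
  pi. Substituting pi - x passes between the two; the derivative changes sign, the coefficient and
  the source are merely reflected.\<close>

lemma ivp_reflect:
  assumes u: "ivp p h u v" and p: "p absolutely_integrable_on {0..pi}" and h: "h absolutely_integrable_on {0..pi}"
  shows "ivp (\<lambda>x. p (pi - x)) (\<lambda>x. h (pi - x)) (\<lambda>x. u (pi - x)) (\<lambda>x. - v (pi - x))"
  unfolding ivp_def
proof (intro conjI ballI)
  fix x assume x: "x \<in> {0..pi}"
  have im: "(\<lambda>x. pi - x) ` {0..pi} = {0..pi}" by (auto simp: image_iff intro: bexI[of _ "pi - _"])
  have "(u has_vector_derivative v (pi - x)) (at (pi - x) within (\<lambda>x. pi - x) ` {0..pi})"
    unfolding im using x by (intro ivp_deriv[OF u]) auto
  moreover have "((\<lambda>x. pi - x) has_vector_derivative - 1) (at x within {0..pi})"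
    by (auto intro!: derivative_eq_intros)
  ultimately have "((u \<circ> (\<lambda>x. pi - x)) has_vector_derivative (- 1) *\<^sub>R v (pi - x)) (at x within {0..pi})"
    by (intro vector_diff_chain_within)
  then show "((\<lambda>x. u (pi - x)) has_vector_derivative - v (pi - x)) (at x within {0..pi})" by (simp add: o_def)
  let ?f = "\<lambda>t. p t * u t + h t"
  have f: "?f absolutely_integrable_on {0..pi}" by (rule ivp_rhs_integrable[OF p h ivp_cont1[OF u]])
  have "v pi - v (pi - x) = integral {pi - x..pi} ?f"
    using x by (intro indefinite_increment[OF f ivp_integral[OF u]]) auto
  also have "\<dots> = integral {0..x} (\<lambda>t. ?f (pi - t))"
    using has_integral_reflect[of ?f pi x 0] absolutely_integrable_sub[OF f, of "pi - x" pi] x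
    by (simp add: integral_unique absolutely_integrable_on_def)
  finally show "- v (pi - x) = - v (pi - 0) + integral {0..x} (\<lambda>t. p (pi - t) * u (pi - t) + h (pi - t))"
    by (simp add: algebra_simps)
qed

section \<open>Dependence on the spectral parameter and exponential asymptotics\<close>

text \<open>The data \<open>c\<close>, \<open>d\<close> are imposed at 0. By
  \<open>ivp_unique\<close> the choice is determined on [0, pi], and only there; later statements
  are therefore restricted to that interval.\<close>

definition fund :: "(real \<Rightarrow> complex) \<Rightarrow> complex \<Rightarrow> complex \<Rightarrow> complex \<Rightarrow> (real \<Rightarrow> complex) \<times> (real \<Rightarrow> complex)" where
  "fund q c d z = (SOME w. ivp (\<lambda>x. q x - z) (\<lambda>x. 0) (fst w) (snd w) \<and> fst w 0 = c \<and> snd w 0 = d)"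

definition fundu :: "(real \<Rightarrow> complex) \<Rightarrow> complex \<Rightarrow> complex \<Rightarrow> complex \<Rightarrow> real \<Rightarrow> complex" where
  "fundu q c d z = fst (fund q c d z)"

definition fundv :: "(real \<Rightarrow> complex) \<Rightarrow> complex \<Rightarrow> complex \<Rightarrow> complex \<Rightarrow> real \<Rightarrow> complex" where
  "fundv q c d z = snd (fund q c d z)"

lemma shift_integrable:
  fixes q :: "real \<Rightarrow> complex"
  assumes "q absolutely_integrable_on {0..pi}"
  shows "(\<lambda>x. q x - z) absolutely_integrable_on {0..pi}"
  using assms by (intro set_integral_diff(1)) auto

lemma fund_ivp:
  assumes "q absolutely_integrable_on {0..pi}"
  shows "ivp (\<lambda>x. q x - z) (\<lambda>x. 0) (fundu q c d z) (fundv q c d z)" "fundu q c d z 0 = c" "fundv q c d z 0 = d"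
proof -
  have "(\<lambda>x. 0 :: complex) absolutely_integrable_on {0..pi}" by simp
  then obtain u v where "ivp (\<lambda>x. q x - z) (\<lambda>x. 0) u v" "u 0 = c" "v 0 = d"
    by (rule ivp_exists[OF shift_integrable[OF assms]])
  then have "\<exists>w. ivp (\<lambda>x. q x - z) (\<lambda>x. 0) (fst w) (snd w) \<and> fst w 0 = c \<and> snd w 0 = d"
    by (intro exI[of _ "(u, v)"]) simp
  from someI_ex[OF this] show "ivp (\<lambda>x. q x - z) (\<lambda>x. 0) (fundu q c d z) (fundv q c d z)"
    "fundu q c d z 0 = c" "fundv q c d z 0 = d"
    by (simp_all add: fundu_def fundv_def fund_def)
qed

lemma fund_unique:
  assumes "q absolutely_integrable_on {0..pi}" "ivp (\<lambda>x. q x - z) (\<lambda>x. 0) u v" "x \<in> {0..pi}"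
  shows "u x = fundu q (u 0) (v 0) z x" "v x = fundv q (u 0) (v 0) z x"
  using ivp_unique[OF shift_integrable[OF assms(1)] _ assms(2) fund_ivp(1)[OF assms(1)] _ _ assms(3)]
    fund_ivp(2,3)[OF assms(1)] by auto

lemma growth_const_shift_le:
  fixes q :: "real \<Rightarrow> complex"
  assumes q: "q absolutely_integrable_on {0..pi}" and z: "norm z \<le> B"
  shows "growth_const (\<lambda>x. q x - z) \<le> 2 * exp (2 * (pi * (1 + B) + integral {0..pi} (\<lambda>x. norm (q x))))"
proof -
  have nq: "(\<lambda>x. norm (q x)) integrable_on {0..pi}" using q by (simp add: absolutely_integrable_on_def)
  have nz: "(\<lambda>x. norm (q x - z)) integrable_on {0..pi}" using shift_integrable[OF q] by (simp add: absolutely_integrable_on_def)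
  have "integral {0..pi} (\<lambda>t. 1 + norm (q t - z)) \<le> integral {0..pi} (\<lambda>t. (1 + B) + norm (q t))"
  proof (rule integral_le)
    show "(\<lambda>t. 1 + norm (q t - z)) integrable_on {0..pi}" using nz by (intro integrable_add) auto
    show "(\<lambda>t. (1 + B) + norm (q t)) integrable_on {0..pi}" using nq by (intro integrable_add) auto
    show "1 + norm (q t - z) \<le> (1 + B) + norm (q t)" for t
      using norm_triangle_ineq4[of "q t" z] z by linarith
  qed
  also have "\<dots> = pi * (1 + B) + integral {0..pi} (\<lambda>t. norm (q t))"
    using nq by (subst Henstock_Kurzweil_Integration.integral_add) auto
  finally show ?thesis unfolding growth_const_def by (intro mult_left_mono) auto
qed

lemma fund_bound:
  assumes q: "q absolutely_integrable_on {0..pi}" and z: "norm z \<le> B" and x: "x \<in> {0..pi}"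
  shows "norm (fundu q c d z x) + norm (fundv q c d z x) \<le>
    (norm c + norm d) * (2 * exp (2 * (pi * (1 + B) + integral {0..pi} (\<lambda>x. norm (q x)))))"
proof -
  have "norm (fundu q c d z x) + norm (fundv q c d z x) \<le> (norm c + norm d) * growth_const (\<lambda>x. q x - z)"
    using ivp_bound[OF shift_integrable[OF q] _ fund_ivp(1)[OF q, where z = z and c = c and d = d] x] fund_ivp(2,3)[OF q] by simp
  also have "\<dots> \<le> (norm c + norm d) * (2 * exp (2 * (pi * (1 + B) + integral {0..pi} (\<lambda>x. norm (q x)))))"
    by (intro mult_left_mono growth_const_shift_le[OF q z]) simp
  finally show ?thesis .
qed

lemma has_field_derivative_quadratic:
  fixes f :: "complex \<Rightarrow> complex"
  assumes "\<And>h. norm h \<le> 1 \<Longrightarrow> norm (f (z + h) - f z - h * D) \<le> C * (norm h)\<^sup>2"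
  shows "(f has_field_derivative D) (at z)"
proof -
  have "((\<lambda>h. (f (z + h) - f z) / h - D) \<longlongrightarrow> 0) (at 0)"
  proof (rule Lim_null_comparison)
    show "((\<lambda>h. C * norm h) \<longlongrightarrow> 0) (at (0::complex))"
      by (auto intro!: tendsto_eq_intros)
    have "\<forall>\<^sub>F h in at 0. norm (h::complex) < 1"
      using eventually_at_ball[of 1 "0::complex" UNIV] by (auto simp: dist_norm elim: eventually_mono)
    moreover have "\<forall>\<^sub>F h in at 0. h \<noteq> (0::complex)" by (auto simp: eventually_at_filter)
    ultimately show "\<forall>\<^sub>F h in at 0. norm ((f (z + h) - f z) / h - D) \<le> C * norm h"
    proof eventually_elim
      case (elim h)
      then have "norm (f (z + h) - f z - h * D) / norm h \<le> C * norm h"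
        using assms[of h] by (simp add: field_simps power2_eq_square)
      moreover have "(f (z + h) - f z) / h - D = (f (z + h) - f z - h * D) / h"
        using elim by (simp add: field_simps)
      ultimately show ?case by (simp add: norm_divide)
    qed
  qed
  then show ?thesis unfolding DERIV_def by (simp add: LIM_zero_iff)
qed

lemma ivp_cong:
  assumes "ivp p h u v" "\<And>t. p t * u t + h t = p' t * u t + h' t"
  shows "ivp p' h' u v"
  using assms(1) unfolding ivp_def assms(2) .

text \<open>Formal differentiation of u'' = (q - z) u in z shows that the derivative
  \<open>y\<close> must solve the same problem with source - u and zero data. With this candidate
  the remainder is estimated by applying \<open>ivp_bound\<close> twice: the change of
  \<open>u\<close> is O(|h|), and the remainder has source - h times this change, hence is
  O(|h|^2).\<close>

lemma fund_holomorphic: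
  assumes q: "q absolutely_integrable_on {0..pi}" and x: "x \<in> {0..pi}"
  shows "(\<lambda>z. fundu q c d z x) holomorphic_on UNIV" "(\<lambda>z. fundv q c d z x) holomorphic_on UNIV"
proof -
  have "(\<exists>D. ((\<lambda>z. fundu q c d z x) has_field_derivative D) (at z)) \<and> (\<exists>D. ((\<lambda>z. fundv q c d z x) has_field_derivative D) (at z))" for z
  proof -
    let ?p = "\<lambda>x. q x - z"
    have p: "?p absolutely_integrable_on {0..pi}" by (rule shift_integrable[OF q])
    have c0: "(\<lambda>t. 0::complex) absolutely_integrable_on {0..pi}" by simp
    define u v where "u = fundu q c d z" and "v = fundv q c d z"
    have uv: "ivp ?p (\<lambda>x. 0) u v" "u 0 = c" "v 0 = d" unfolding u_def v_def by (rule fund_ivp[OF q])+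
    have iu: "(\<lambda>t. - u t) absolutely_integrable_on {0..pi}"
      by (intro absolutely_integrable_continuous_real continuous_intros ivp_cont1[OF uv(1)])
    obtain y w where yw: "ivp ?p (\<lambda>t. - u t) y w" "y 0 = 0" "w 0 = 0"
      using ivp_exists[OF p iu] by metis
    define B where "B = (norm c + norm d) * (2 * exp (2 * (pi * (1 + (norm z + 1)) + integral {0..pi} (\<lambda>x. norm (q x)))))"
    have B0: "B \<ge> 0" by (simp add: B_def)
    define C where "C = pi * (pi * B * growth_const ?p) * growth_const ?p"
    have main: "norm (fundu q c d (z + h) x - fundu q c d z x - h * y x) \<le> C * (norm h)\<^sup>2 \<and>
        norm (fundv q c d (z + h) x - fundv q c d z x - h * w x) \<le> C * (norm h)\<^sup>2" if h: "norm h \<le> 1" for h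
    proof -
      define u' v' where "u' = fundu q c d (z + h)" and "v' = fundv q c d (z + h)"
      have uv': "ivp (\<lambda>x. q x - (z + h)) (\<lambda>x. 0) u' v'" "u' 0 = c" "v' 0 = d" unfolding u'_def v'_def by (rule fund_ivp[OF q])+
      have cu': "continuous_on {0..pi} u'" and cu: "continuous_on {0..pi} u" using ivp_cont1 uv uv' by auto
      have u'B: "norm (u' t) \<le> B" if "t \<in> {0..pi}" for t
      proof -
        have "norm (z + h) \<le> norm z + 1" using norm_triangle_ineq[of z h] h by linarith
        from fund_bound[OF q this that, of c d] show ?thesis
          unfolding B_def u'_def using norm_ge_zero[of "fundv q c d (z + h) t"] by linarith
      qed
      \<comment> \<open>The equation at z + h is read as the equation at z with source - h u', so
        that all three problems share one coefficient and can be combined linearly.\<close>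
      have 1: "ivp ?p (\<lambda>t. - h * u' t) u' v'"
        by (rule ivp_cong[OF uv'(1)]) (simp add: algebra_simps)
      have i1: "(\<lambda>t. - h * u' t) absolutely_integrable_on {0..pi}"
        by (intro absolutely_integrable_continuous_real continuous_intros cu')
      have 2: "ivp ?p (\<lambda>t. - h * u' t + (-1) * 0) (\<lambda>t. u' t + (-1) * u t) (\<lambda>t. v' t + (-1) * v t)"
        by (rule ivp_add_scale[OF 1 uv(1) p i1 c0])
      have d: "norm (u' t - u t) \<le> norm h * (pi * B * growth_const ?p)" if t: "t \<in> {0..pi}" for t
      proof -
        have "norm (u' t - u t) + norm (v' t - v t) \<le> integral {0..pi} (\<lambda>t. norm (h * u' t)) * growth_const ?p"
          using ivp_bound[OF p _ 2 t] i1 uv uv' by simp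
        also have "\<dots> \<le> integral {0..pi} (\<lambda>t. norm h * B) * growth_const ?p"
          using growth_const_pos[of ?p] u'B
          by (intro mult_right_mono integral_le integrable_continuous_real continuous_intros cu')
             (auto simp: norm_mult intro!: mult_left_mono)
        finally have "norm (u' t - u t) + norm (v' t - v t) \<le> norm h * (pi * B * growth_const ?p)" by (simp add: mult_ac)
        then show ?thesis using norm_ge_zero[of "v' t - v t"] by linarith
      qed
      have i2: "(\<lambda>t. - h * u' t + (-1) * 0) absolutely_integrable_on {0..pi}" using i1 by simp
      \<comment> \<open>Subtracting \<open>h * y\<close> replaces the source - h u' by - h (u' - u),
        which the preceding bound makes of second order.\<close>
      have 3: "ivp ?p (\<lambda>t. - h * u' t + (-1) * 0 + (- h) * (- u t)) (\<lambda>t. u' t + (-1) * u t + (- h) * y t) (\<lambda>t. v' t + (-1) * v t + (- h) * w t)"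
        by (rule ivp_add_scale[OF 2 yw(1) p i2 iu])
      have i3: "(\<lambda>t. - h * u' t + (-1) * 0 + (- h) * (- u t)) absolutely_integrable_on {0..pi}"
        by (intro absolutely_integrable_continuous_real continuous_intros cu' cu)
      have "norm (u' x - u x - h * y x) + norm (v' x - v x - h * w x) \<le> integral {0..pi} (\<lambda>t. norm (- h * u' t + (- h) * (- u t))) * growth_const ?p"
        using ivp_bound[OF p i3 3 x] uv uv' yw by simp
      also have "\<dots> \<le> integral {0..pi} (\<lambda>t. norm h * (norm h * (pi * B * growth_const ?p))) * growth_const ?p"
      proof (intro mult_right_mono integral_le integrable_continuous_real continuous_intros cu' cu)
        fix t assume t: "t \<in> {0..pi}"
        have "- h * u' t + (- h) * (- u t) = - h * (u' t - u t)" by (simp add: algebra_simps)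
        then show "norm (- h * u' t + (- h) * (- u t)) \<le> norm h * (norm h * (pi * B * growth_const ?p))"
          using d[OF t] by (simp add: norm_mult mult_left_mono)
      qed (use growth_const_pos[of ?p] in auto)
      also have "\<dots> = C * (norm h)\<^sup>2" by (simp add: C_def power2_eq_square mult_ac)
      finally show ?thesis unfolding u'_def v'_def u_def v_def
        using norm_ge_zero by (smt (verit))
    qed
    from main show ?thesis by (blast intro: has_field_derivative_quadratic)
  qed
  then show "(\<lambda>z. fundu q c d z x) holomorphic_on UNIV" "(\<lambda>z. fundv q c d z x) holomorphic_on UNIV"
    by (auto simp: holomorphic_on_open)
qed

text \<open>The product rule is applied to \<open>u * v'\<close> and \<open>v * u'\<close>, where
  the terms \<open>v * v'\<close> cancel. For equal coefficients the Wronskian is constant; for two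
  potentials at the same z the parameter drops out of \<open>p' - p\<close>, which later expresses
  the difference of two m-functions.\<close>

lemma ivp_wronskian:
  assumes p: "p absolutely_integrable_on {0..pi}" and p': "p' absolutely_integrable_on {0..pi}"
    and u: "ivp p (\<lambda>x. 0) u v" and u': "ivp p' (\<lambda>x. 0) u' v'" and x: "x \<in> {0..pi}"
  shows "u x * v' x - v x * u' x = u 0 * v' 0 - v 0 * u' 0 + integral {0..x} (\<lambda>t. (p' t - p t) * (u t * u' t))"
proof -
  have c: "continuous_on {0..pi} u" "continuous_on {0..pi} v" "continuous_on {0..pi} u'" "continuous_on {0..pi} v'"
    using ivp_cont1[OF u] ivp_cont1[OF u'] ivp_cont2[OF p _ u] ivp_cont2[OF p' _ u'] by auto
  have iv: "v absolutely_integrable_on {0..pi}" "v' absolutely_integrable_on {0..pi}"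
    using c by (auto intro: absolutely_integrable_continuous_real)
  have ip: "(\<lambda>t. p t * u t) absolutely_integrable_on {0..pi}" "(\<lambda>t. p' t * u' t) absolutely_integrable_on {0..pi}"
    by (intro absolutely_integrable_mult_continuous p p' c)+
  have I: "\<And>x. x \<in> {0..pi} \<Longrightarrow> v x = v 0 + integral {0..x} (\<lambda>t. p t * u t)"
    "\<And>x. x \<in> {0..pi} \<Longrightarrow> v' x = v' 0 + integral {0..x} (\<lambda>t. p' t * u' t)"
    using ivp_integral[OF u] ivp_integral[OF u'] by (simp_all only: add_0_right)
  have 1: "u x * v' x = u 0 * v' 0 + integral {0..x} (\<lambda>t. v t * v' t + u t * (p' t * u' t))"
    by (rule product_indefinite[OF iv(1) ivp_integral1[OF u] ip(2) I(2) x])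
  have 2: "v x * u' x = v 0 * u' 0 + integral {0..x} (\<lambda>t. (p t * u t) * u' t + v t * v' t)"
    by (rule product_indefinite[OF ip(1) I(1) iv(2) ivp_integral1[OF u'] x])
  have "(\<lambda>t. u t * (p' t * u' t)) absolutely_integrable_on {0..pi}" "(\<lambda>t. (p t * u t) * u' t) absolutely_integrable_on {0..pi}"
    using absolutely_integrable_mult_continuous[OF ip(2) c(1)] absolutely_integrable_mult_continuous[OF ip(1) c(3)]
    by (simp_all add: mult_ac)
  moreover have "(\<lambda>t. v t * v' t) absolutely_integrable_on {0..pi}"
    by (intro absolutely_integrable_continuous_real continuous_intros c)
  ultimately have i: "(\<lambda>t. v t * v' t + u t * (p' t * u' t)) absolutely_integrable_on {0..pi}"
    "(\<lambda>t. (p t * u t) * u' t + v t * v' t) absolutely_integrable_on {0..pi}"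
    by (auto intro: set_integral_add(1))
  have "integral {0..x} (\<lambda>t. v t * v' t + u t * (p' t * u' t)) - integral {0..x} (\<lambda>t. (p t * u t) * u' t + v t * v' t) =
     integral {0..x} (\<lambda>t. (v t * v' t + u t * (p' t * u' t)) - ((p t * u t) * u' t + v t * v' t))"
    using absolutely_integrable_sub[OF i(1), of 0 x] absolutely_integrable_sub[OF i(2), of 0 x] x
    by (intro Henstock_Kurzweil_Integration.integral_diff[symmetric]) (auto simp: absolutely_integrable_on_def)
  also have "\<dots> = integral {0..x} (\<lambda>t. (p' t - p t) * (u t * u' t))"
    by (rule arg_cong[of _ _ "integral {0..x}"]) (auto simp: algebra_simps)
  finally show ?thesis using 1 2 by (simp add: algebra_simps)
qed

text \<open>With \<open>\<kappa>\<^sup>2 = - z\<close> the equation factors as (d/dx -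
  \<kappa>)(d/dx + \<kappa>) u = q u, so v + \<kappa> u solves a first-order equation with
  integrating factor exp (- \<kappa> x). No sign is imposed on \<open>\<kappa>\<close>, so both
  roots can be inserted.\<close>

lemma ivp_exponential_factor:
  assumes q: "q absolutely_integrable_on {0..pi}" and u: "ivp (\<lambda>x. q x - z) (\<lambda>x. 0) u v" and x: "x \<in> {0..pi}"
    and \<kappa>: "\<kappa>\<^sup>2 = - z"
  shows "exp (- \<kappa> * of_real x) * (v x + \<kappa> * u x) = v 0 + \<kappa> * u 0 + integral {0..x} (\<lambda>t. exp (- \<kappa> * of_real t) * (q t * u t))"
proof -
  let ?e = "\<lambda>t::real. exp (- \<kappa> * of_real t)"
  let ?f = "\<lambda>t. - \<kappa> * ?e t" and ?g = "\<lambda>t. (q t - z) * u t + \<kappa> * v t"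
  have p: "(\<lambda>x. q x - z) absolutely_integrable_on {0..pi}" by (rule shift_integrable[OF q])
  have cu: "continuous_on {0..pi} u" and cv: "continuous_on {0..pi} v"
    using ivp_cont1[OF u] ivp_cont2[OF p _ u] by auto
  have f: "?f absolutely_integrable_on {0..pi}"
    by (intro absolutely_integrable_continuous_real continuous_intros)
  have pu: "(\<lambda>t. (q t - z) * u t) absolutely_integrable_on {0..pi}"
    by (intro absolutely_integrable_mult_continuous p cu)
  have kv: "(\<lambda>t. \<kappa> * v t) absolutely_integrable_on {0..pi}"
    by (intro absolutely_integrable_continuous_real continuous_intros cv)
  have g: "?g absolutely_integrable_on {0..pi}" using pu kv by (rule set_integral_add(1))
  have F: "?e x = 1 + integral {0..x} ?f" if x: "x \<in> {0..pi}" for x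
  proof -
    have "(?f has_integral ?e x - ?e 0) {0..x}"
    proof (rule fundamental_theorem_of_calculus)
      show "(?e has_vector_derivative ?f t) (at t within {0..x})" for t
        by (rule has_vector_derivative_real_field) (auto intro!: derivative_eq_intros)
    qed (use x in auto)
    from integral_unique[OF this] show ?thesis by (simp only: algebra_simps) simp
  qed
  have G: "v x + \<kappa> * u x = (v 0 + \<kappa> * u 0) + integral {0..x} ?g" if x: "x \<in> {0..pi}" for x
  proof -
    have "integral {0..x} ?g = integral {0..x} (\<lambda>t. (q t - z) * u t) + integral {0..x} (\<lambda>t. \<kappa> * v t)"
      using absolutely_integrable_sub[OF pu, of 0 x] absolutely_integrable_sub[OF kv, of 0 x] x
      by (intro Henstock_Kurzweil_Integration.integral_add) (auto simp: absolutely_integrable_on_def)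
    then show ?thesis using ivp_integral[OF u x] ivp_integral1[OF u x] by (simp add: algebra_simps)
  qed
  have "?e x * (v x + \<kappa> * u x) = ?e 0 * (v 0 + \<kappa> * u 0) + integral {0..x} (\<lambda>t. ?f t * (v t + \<kappa> * u t) + ?e t * ?g t)"
    by (rule product_indefinite[OF f F g G x])
  also have "(\<lambda>t. ?f t * (v t + \<kappa> * u t) + ?e t * ?g t) = (\<lambda>t. ?e t * (q t * u t))"
  proof
    fix t
    have "z = - (\<kappa> * \<kappa>)" using \<kappa> by (simp add: power2_eq_square)
    then show "?f t * (v t + \<kappa> * u t) + ?e t * ?g t = ?e t * (q t * u t)" by (simp add: algebra_simps)
  qed
  finally show ?thesis by simp
qed

definition pnorm :: "(real \<Rightarrow> complex) \<Rightarrow> real" where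
  "pnorm q = integral {0..pi} (\<lambda>t. norm (q t))"

lemma pnorm_nonneg: "q absolutely_integrable_on {0..pi} \<Longrightarrow> 0 \<le> pnorm q"
  unfolding pnorm_def by (intro integral_nonneg) (auto simp: absolutely_integrable_on_def)

text \<open>For t <= x the kernel exp (\<kappa> (x - t)) is bounded by exp (\<tau> (x - t)). Keeping
  \<open>\<tau>\<close> apart from \<open>Re \<kappa>\<close> allows the same bound for \<kappa> and
  - \<kappa>.\<close>

lemma ivp_exponential_estimate:
  assumes q: "q absolutely_integrable_on {0..pi}" and u: "ivp (\<lambda>x. q x - z) (\<lambda>x. 0) u v"
    and \<kappa>: "\<kappa>\<^sup>2 = - z" and \<tau>: "\<bar>Re \<kappa>\<bar> \<le> \<tau>" and x: "x \<in> {0..pi}"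
  shows "norm (v x + \<kappa> * u x - exp (\<kappa> * of_real x) * (v 0 + \<kappa> * u 0)) \<le>
     exp (\<tau> * x) * integral {0..x} (\<lambda>t. norm (q t) * (exp (- \<tau> * t) * norm (u t)))"
proof -
  let ?e = "\<lambda>t::real. exp (- \<kappa> * of_real t)"
  have cu: "continuous_on {0..pi} u" using ivp_cont1[OF u] .
  have "v x + \<kappa> * u x = exp (\<kappa> * of_real x) * (?e x * (v x + \<kappa> * u x))"
    by (simp add: mult.assoc[symmetric] exp_add[symmetric])
  also have "\<dots> = exp (\<kappa> * of_real x) * (v 0 + \<kappa> * u 0) + exp (\<kappa> * of_real x) * integral {0..x} (\<lambda>t. ?e t * (q t * u t))"
    unfolding ivp_exponential_factor[OF q u x \<kappa>] by (simp add: algebra_simps)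
  finally have "v x + \<kappa> * u x - exp (\<kappa> * of_real x) * (v 0 + \<kappa> * u 0) = exp (\<kappa> * of_real x) * integral {0..x} (\<lambda>t. ?e t * (q t * u t))" by simp
  also have "\<dots> = integral {0..x} (\<lambda>t. exp (\<kappa> * of_real x) * (?e t * (q t * u t)))" by simp
  also have "norm \<dots> \<le> integral {0..x} (\<lambda>t. exp (\<tau> * x) * (norm (q t) * (exp (- \<tau> * t) * norm (u t))))"
  proof (rule integral_norm_bound_integral)
    have "(\<lambda>t. q t * (exp (\<kappa> * of_real x) * ?e t * u t)) absolutely_integrable_on {0..pi}"
      by (intro absolutely_integrable_mult_continuous q continuous_intros cu)
    from absolutely_integrable_sub[OF this, of 0 x] x
    show "(\<lambda>t. exp (\<kappa> * of_real x) * (?e t * (q t * u t))) integrable_on {0..x}"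
      by (simp add: absolutely_integrable_on_def mult_ac)
    have "(\<lambda>t. norm (q t) * (exp (\<tau> * x) * (exp (- \<tau> * t) * norm (u t)))) absolutely_integrable_on {0..pi}"
      by (intro absolutely_integrable_mult_continuous set_integrable_norm q continuous_intros cu)
    from absolutely_integrable_sub[OF this, of 0 x] x
    show "(\<lambda>t. exp (\<tau> * x) * (norm (q t) * (exp (- \<tau> * t) * norm (u t)))) integrable_on {0..x}"
      by (simp add: absolutely_integrable_on_def mult_ac)
    fix t assume t: "t \<in> {0..x}"
    have "Re \<kappa> * (x - t) \<le> \<tau> * (x - t)" using t \<tau> by (intro mult_right_mono) auto
    then have "exp (Re \<kappa> * x) * exp (- Re \<kappa> * t) \<le> exp (\<tau> * x) * exp (- \<tau> * t)"
      by (simp add: exp_add[symmetric] algebra_simps)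
    then have "exp (Re \<kappa> * x) * exp (- Re \<kappa> * t) * (norm (q t) * norm (u t)) \<le> exp (\<tau> * x) * exp (- \<tau> * t) * (norm (q t) * norm (u t))"
      by (intro mult_right_mono) auto
    then show "norm (exp (\<kappa> * of_real x) * (?e t * (q t * u t))) \<le> exp (\<tau> * x) * (norm (q t) * (exp (- \<tau> * t) * norm (u t)))"
      by (simp add: norm_mult mult_ac)
  qed
  finally show ?thesis by simp
qed

text \<open>Here \<open>z = - \<kappa>\<^sup>2\<close> with \<open>Re \<kappa> \<ge> 0\<close>, that is \<open>\<kappa> = - \<i> k\<close> for the usual \<open>k = \<surd>z\<close>.\<close>

lemma fund_exponential_asymptotics:
  fixes c d \<kappa> :: complex
  assumes q: "q absolutely_integrable_on {0..pi}" and \<kappa>: "norm \<kappa> \<ge> 1" "Re \<kappa> \<ge> 0" and x: "x \<in> {0..pi}"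
  defines "\<rho> \<equiv> norm c + norm d / norm \<kappa>"
  shows fundu_upper: "norm (fundu q c d (- \<kappa>\<^sup>2) x) \<le> 2 * exp (2 * pnorm q) * \<rho> * exp (Re \<kappa> * x)"
    and fund_growing: "norm (fundv q c d (- \<kappa>\<^sup>2) x + \<kappa> * fundu q c d (- \<kappa>\<^sup>2) x - exp (\<kappa> * of_real x) * (d + \<kappa> * c)) \<le>
       2 * pnorm q * exp (2 * pnorm q) * \<rho> * exp (Re \<kappa> * x)"
    and fund_decaying: "norm (fundv q c d (- \<kappa>\<^sup>2) x - \<kappa> * fundu q c d (- \<kappa>\<^sup>2) x - exp (- \<kappa> * of_real x) * (d - \<kappa> * c)) \<le>
       2 * pnorm q * exp (2 * pnorm q) * \<rho> * exp (Re \<kappa> * x)"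
proof -
  define z where "z = - \<kappa>\<^sup>2"
  define u v where "u = fundu q c d z" and "v = fundv q c d z"
  define \<tau> where "\<tau> = Re \<kappa>"
  have uv: "ivp (\<lambda>x. q x - z) (\<lambda>x. 0) u v" "u 0 = c" "v 0 = d" unfolding u_def v_def by (rule fund_ivp[OF q])+
  have k: "\<kappa>\<^sup>2 = - z" "(- \<kappa>)\<^sup>2 = - z" by (auto simp: z_def)
  have t: "\<bar>Re \<kappa>\<bar> \<le> \<tau>" "\<bar>Re (- \<kappa>)\<bar> \<le> \<tau>" using \<kappa> by (auto simp: \<tau>_def)
  have cu: "continuous_on {0..pi} u" using ivp_cont1[OF uv(1)] .
  have Q: "(\<lambda>t. norm (q t)) absolutely_integrable_on {0..pi}" using q by (rule set_integrable_norm)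
  define \<Phi> where "\<Phi> = (\<lambda>t. exp (- \<tau> * t) * norm (u t))"
  have c\<Phi>: "continuous_on {0..pi} \<Phi>" unfolding \<Phi>_def by (intro continuous_intros cu)
  have E: "norm (v x + \<kappa> * u x - exp (\<kappa> * of_real x) * (d + \<kappa> * c)) \<le> exp (\<tau> * x) * integral {0..x} (\<lambda>t. norm (q t) * \<Phi> t)"
    "norm (v x - \<kappa> * u x - exp (- \<kappa> * of_real x) * (d - \<kappa> * c)) \<le> exp (\<tau> * x) * integral {0..x} (\<lambda>t. norm (q t) * \<Phi> t)"
    if x: "x \<in> {0..pi}" for x
    using ivp_exponential_estimate[OF q uv(1) k(1) t(1) x] ivp_exponential_estimate[OF q uv(1) k(2) t(2) x] uv(2,3)
    by (simp_all add: \<Phi>_def)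
  have \<rho>: "\<rho> \<ge> 0" by (simp add: \<rho>_def)
  have n0: "norm (d + \<kappa> * c) \<le> norm \<kappa> * \<rho>" "norm (d - \<kappa> * c) \<le> norm \<kappa> * \<rho>"
    using norm_triangle_ineq[of d "\<kappa> * c"] norm_triangle_ineq4[of d "\<kappa> * c"] \<kappa>(1)
    by (auto simp: \<rho>_def norm_mult field_simps)
  \<comment> \<open>The quantities v + \<kappa> u and v - \<kappa> u differ by 2 \<kappa> u.
    Dividing by |\<kappa>| yields a Volterra inequality with the small kernel |q| / |\<kappa>|;
    \<open>\<rho>\<close> is chosen so that |\<kappa>| \<rho> bounds both d + \<kappa> c and d -
    \<kappa> c.\<close>
  have \<Phi>le: "\<Phi> x \<le> \<rho> + integral {0..x} (\<lambda>t. (norm (q t) / norm \<kappa>) * \<Phi> t)" if x: "x \<in> {0..pi}" for x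
  proof -
    let ?I = "integral {0..x} (\<lambda>t. norm (q t) * \<Phi> t)"
    let ?E = "exp (\<tau> * x)"
    have e: "norm (exp (\<kappa> * of_real x)) \<le> ?E" "norm (exp (- \<kappa> * of_real x)) \<le> ?E"
      using \<kappa> x by (auto simp: \<tau>_def intro: order_trans[of _ 0])
    have "2 * \<kappa> * u x = (v x + \<kappa> * u x - exp (\<kappa> * of_real x) * (d + \<kappa> * c)) - (v x - \<kappa> * u x - exp (- \<kappa> * of_real x) * (d - \<kappa> * c))
        + (exp (\<kappa> * of_real x) * (d + \<kappa> * c) - exp (- \<kappa> * of_real x) * (d - \<kappa> * c))"
      by (simp add: algebra_simps)
    also have "norm \<dots> \<le> (?E * ?I + ?E * ?I) + (?E * (norm \<kappa> * \<rho>) + ?E * (norm \<kappa> * \<rho>))"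
    proof -
      have tri: "norm ((X - Y) + (P - R)) \<le> (norm X + norm Y) + (norm P + norm R)" for X Y P R :: complex
        by (intro order_trans[OF norm_triangle_ineq] add_mono norm_triangle_ineq4)
      have "norm (exp (\<kappa> * of_real x) * (d + \<kappa> * c)) \<le> ?E * (norm \<kappa> * \<rho>)" "norm (exp (- \<kappa> * of_real x) * (d - \<kappa> * c)) \<le> ?E * (norm \<kappa> * \<rho>)"
        unfolding norm_mult[of "exp _"] using e n0 by (auto intro!: mult_mono)
      then show ?thesis using E[OF x] by (intro order_trans[OF tri] add_mono)
    qed
    finally have "norm \<kappa> * norm (u x) \<le> ?E * (norm \<kappa> * \<rho> + ?I)" by (simp add: norm_mult algebra_simps)
    then have "norm (u x) \<le> ?E * (norm \<kappa> * \<rho> + ?I) / norm \<kappa>"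
      using \<kappa>(1) by (subst pos_le_divide_eq) (auto simp: mult.commute)
    also have "\<dots> = ?E * (\<rho> + ?I / norm \<kappa>)"
    proof -
      have "\<kappa> \<noteq> 0" using \<kappa>(1) by auto
      then show ?thesis by (simp add: field_simps)
    qed
    finally have "\<Phi> x \<le> \<rho> + ?I / norm \<kappa>" by (simp add: \<Phi>_def exp_minus field_simps)
    also have "?I / norm \<kappa> = integral {0..x} (\<lambda>t. (norm (q t) / norm \<kappa>) * \<Phi> t)"
      by (simp flip: integral_divide)
    finally show ?thesis .
  qed
  \<comment> \<open>Since |\<kappa>| >= 1, the exponent \<open>pnorm q / norm \<kappa>\<close> may
    be replaced by \<open>pnorm q\<close>, so the constants do not depend on \<kappa>.\<close>
  have \<Phi>B: "\<Phi> x \<le> 2 * exp (2 * pnorm q) * \<rho>" if x: "x \<in> {0..pi}" for x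
  proof -
    have qk: "(\<lambda>t. norm (q t) / norm \<kappa>) absolutely_integrable_on {0..pi}"
      using Q by (rule set_integrable_divide)
    have "\<Phi> x \<le> 2 * \<rho> * exp (2 * integral {0..x} (\<lambda>t. norm (q t) / norm \<kappa>))"
      by (rule gronwall[OF qk _ c\<Phi> _ \<Phi>le \<rho> x]) (auto simp: \<Phi>_def)
    also have "integral {0..x} (\<lambda>t. norm (q t) / norm \<kappa>) \<le> integral {0..pi} (\<lambda>t. norm (q t) / norm \<kappa>)"
      using integral_mono_upper[OF qk _ x] by simp
    also have "\<dots> = pnorm q / norm \<kappa>" by (simp add: pnorm_def)
    also have "\<dots> \<le> pnorm q" using pnorm_nonneg[OF q] \<kappa>(1) by (simp add: divide_le_eq mult_le_cancel_left1)
    finally show ?thesis using \<rho> by (simp add: mult_left_mono mult_ac)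
  qed
  have I: "integral {0..x} (\<lambda>t. norm (q t) * \<Phi> t) \<le> 2 * pnorm q * exp (2 * pnorm q) * \<rho>" if x: "x \<in> {0..pi}" for x
  proof -
    have a: "(\<lambda>t. norm (q t) * \<Phi> t) absolutely_integrable_on {0..pi}" by (intro absolutely_integrable_mult_continuous Q c\<Phi>)
    have "integral {0..x} (\<lambda>t. norm (q t) * \<Phi> t) \<le> integral {0..pi} (\<lambda>t. norm (q t) * \<Phi> t)"
      using integral_mono_upper[OF a _ x] by (simp add: \<Phi>_def)
    also have "\<dots> \<le> integral {0..pi} (\<lambda>t. norm (q t) * (2 * exp (2 * pnorm q) * \<rho>))"
      using a Q \<Phi>B by (intro integral_le mult_left_mono integrable_on_mult_left) (auto simp: absolutely_integrable_on_def)
    also have "\<dots> = 2 * pnorm q * exp (2 * pnorm q) * \<rho>" by (simp add: pnorm_def mult_ac)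
    finally show ?thesis .
  qed
  show "norm (fundu q c d (- \<kappa>\<^sup>2) x) \<le> 2 * exp (2 * pnorm q) * \<rho> * exp (Re \<kappa> * x)"
    using \<Phi>B[OF x] by (simp add: \<Phi>_def exp_minus field_simps u_def z_def \<tau>_def)
  show "norm (fundv q c d (- \<kappa>\<^sup>2) x + \<kappa> * fundu q c d (- \<kappa>\<^sup>2) x - exp (\<kappa> * of_real x) * (d + \<kappa> * c)) \<le>
       2 * pnorm q * exp (2 * pnorm q) * \<rho> * exp (Re \<kappa> * x)"
    "norm (fundv q c d (- \<kappa>\<^sup>2) x - \<kappa> * fundu q c d (- \<kappa>\<^sup>2) x - exp (- \<kappa> * of_real x) * (d - \<kappa> * c)) \<le>
       2 * pnorm q * exp (2 * pnorm q) * \<rho> * exp (Re \<kappa> * x)"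
    using order_trans[OF E(1)[OF x] mult_left_mono[OF I[OF x]]] order_trans[OF E(2)[OF x] mult_left_mono[OF I[OF x]]]
    by (simp_all add: u_def v_def z_def \<tau>_def mult_ac)
qed

section \<open>Solutions, spectrum and the characteristic function\<close>

lemma AE_interval_negligible:
  assumes "AE x\<in>{0<..<pi} in lebesgue. f x = g x"
  obtains N where "negligible N" "\<And>x. x \<in> {0..pi} - N \<Longrightarrow> f x = g x"
proof -
  obtain N where N: "negligible N" "{x. \<not> (x \<in> {0<..<pi} \<longrightarrow> f x = g x)} \<subseteq> N"
    using assms unfolding eventually_ae_filter_negligible by blast
  have "f x = g x" if "x \<in> {0..pi} - (N \<union> {0, pi})" for x
  proof (rule ccontr)
    assume "f x \<noteq> g x"
    then have "x \<in> N" using that by (intro subsetD[OF N(2)]) auto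
    then show False using that by simp
  qed
  moreover have "negligible (N \<union> {0, pi})" using N by (simp add: negligible_Un)
  ultimately show ?thesis using that by blast
qed

lemma AE_interval_integral:
  fixes f g :: "real \<Rightarrow> 'a::euclidean_space"
  assumes "AE x\<in>{0<..<pi} in lebesgue. f x = g x"
    and x: "x \<in> {0..pi}"
  shows "integral {0..x} f = integral {0..x} g"
proof -
  obtain N where N: "negligible N" "\<And>x. x \<in> {0..pi} - N \<Longrightarrow> f x = g x"
    using AE_interval_negligible[OF assms(1)] by blast
  show ?thesis by (rule integral_spike[OF N(1)]) (use N(2) x in auto)
qed

lemma absolutely_integrable_uminus:
  fixes f :: "real \<Rightarrow> complex"
  assumes "f absolutely_integrable_on S"
  shows "(\<lambda>x. - f x) absolutely_integrable_on S"
  using set_integrable_mult_right[OF assms, of "-1"] by simp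

lemma d1_eq:
  assumes "(u has_vector_derivative v) (at x within {0..pi})" "x \<in> {0..pi}"
  shows "d1 u x = v"
  unfolding d1_def using assms by (intro vector_derivative_within_closed_interval) auto

context
  fixes q :: "real \<Rightarrow> real"
  assumes q: "q absolutely_integrable_on {0<..<pi}"
begin

abbreviation (input) qc :: "real \<Rightarrow> complex" where "qc \<equiv> \<lambda>x. complex_of_real (q x)"
abbreviation (input) qr :: "real \<Rightarrow> complex" where "qr \<equiv> \<lambda>x. complex_of_real (q (pi - x))"

lemma qc_integrable: "qc absolutely_integrable_on {0..pi}"
proof -
  have "q absolutely_integrable_on {0..pi}" using q by (simp add: absolutely_integrable_on_Icc_iff_Ioo)
  then show ?thesis by (rule absolutely_integrable_linear[unfolded o_def]) (rule bounded_linear_of_real)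
qed

lemma qr_integrable: "qr absolutely_integrable_on {0..pi}"
  using absolutely_integrable_reflect[OF qc_integrable] .

text \<open>From - u'' + q u = z u + g one gets u'' = (q - z) u - g, hence the sign of the source.
  The almost everywhere identity suffices because \<open>ivp\<close> sees the right-hand side only
  under an integral.\<close>

lemma schroedinger_eq_imp_ivp:
  assumes "schroedinger_eq q u f" and g: "g absolutely_integrable_on {0..pi}"
    and fg: "AE x\<in>{0<..<pi} in lebesgue. f x - z * u x = g x"
  shows "ivp (\<lambda>x. qc x - z) (\<lambda>x. - g x) u (d1 u)"
proof -
  obtain g0 where g0: "has_second_deriv u g0" "AE x\<in>{0<..<pi} in lebesgue. - g0 x + of_real (q x) * u x = f x"
    using assms(1) by (auto simp: schroedinger_eq_def)
  have eq: "AE x\<in>{0<..<pi} in lebesgue. g0 x = (qc x - z) * u x + - g x"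
    using g0(2) fg by eventually_elim (auto simp: algebra_simps)
  show ?thesis unfolding ivp_def
  proof (intro conjI ballI)
    fix x assume x: "x \<in> {0..pi}"
    show "(u has_vector_derivative d1 u x) (at x within {0..pi})"
      unfolding d1_def using g0(1) x unfolding has_second_deriv_def vector_derivative_works by blast
    have "d1 u x = d1 u 0 + integral {0..x} g0" using g0(1) x unfolding has_second_deriv_def by blast
    then show "d1 u x = d1 u 0 + integral {0..x} (\<lambda>t. (qc t - z) * u t + - g t)"
      using AE_interval_integral[OF eq x] by simp
  qed
qed

lemma ivp_imp_schroedinger_eq:
  assumes u: "ivp (\<lambda>x. qc x - z) (\<lambda>x. - g x) u v" and g: "g absolutely_integrable_on {0..pi}"
  shows "schroedinger_eq q u (\<lambda>x. z * u x + g x)" "\<And>x. x \<in> {0..pi} \<Longrightarrow> d1 u x = v x"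
proof -
  show d: "d1 u x = v x" if "x \<in> {0..pi}" for x
    using d1_eq[OF ivp_deriv[OF u that] that] .
  let ?g = "\<lambda>x. (qc x - z) * u x + - g x"
  have "?g absolutely_integrable_on {0..pi}"
    using g by (intro ivp_rhs_integrable shift_integrable qc_integrable ivp_cont1[OF u] absolutely_integrable_uminus)
  then have i: "?g absolutely_integrable_on {0<..<pi}" by (simp add: absolutely_integrable_on_Icc_iff_Ioo)
  have "has_second_deriv u ?g"
    unfolding has_second_deriv_def
  proof (intro conjI ballI i)
    fix x assume x: "x \<in> {0..pi}"
    show "u differentiable at x within {0..pi}"
      using ivp_deriv[OF u x] by (rule differentiableI_vector)
    show "d1 u x = d1 u 0 + integral {0..x} ?g"
      unfolding d[OF x] using d[of 0] ivp_integral[OF u x] by simp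
  qed
  moreover have "AE x\<in>{0<..<pi} in lebesgue. - ?g x + of_real (q x) * u x = z * u x + g x"
    by (simp add: algebra_simps)
  ultimately show "schroedinger_eq q u (\<lambda>x. z * u x + g x)" unfolding schroedinger_eq_def by blast
qed

lemma fund_reflected_ivp:
  "ivp (\<lambda>x. qc x - z) (\<lambda>x. 0) (\<lambda>x. fundu qr c d z (pi - x)) (\<lambda>x. - fundv qr c d z (pi - x))"
  using ivp_reflect[OF fund_ivp(1)[OF qr_integrable, of z c d] shift_integrable[OF qr_integrable]] by simp

lemma sol_spec:
  "schroedinger_eq q (sol q \<beta> z) (\<lambda>x. z * sol q \<beta> z x) \<and>
     sol q \<beta> z pi = of_real (sin \<beta>) \<and> d1 (sol q \<beta> z) pi = - of_real (cos \<beta>)"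
proof -
  let ?u = "\<lambda>x. fundu qr (of_real (sin \<beta>)) (of_real (cos \<beta>)) z (pi - x)"
  define P where "P = (\<lambda>u. schroedinger_eq q u (\<lambda>x. z * u x) \<and> u pi = of_real (sin \<beta>) \<and> d1 u pi = - of_real (cos \<beta>))"
  have "P ?u" unfolding P_def
  proof (intro conjI)
    have z0: "(\<lambda>x. 0::complex) absolutely_integrable_on {0..pi}" by simp
    have iv: "ivp (\<lambda>x. qc x - z) (\<lambda>x. - 0) ?u (\<lambda>x. - fundv qr (of_real (sin \<beta>)) (of_real (cos \<beta>)) z (pi - x))"
      unfolding minus_zero by (rule fund_reflected_ivp)
    show "schroedinger_eq q ?u (\<lambda>x. z * ?u x)"
      using ivp_imp_schroedinger_eq(1)[OF iv z0] by (simp only: add_0_right)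
    have *: "d1 ?u pi = - fundv qr (of_real (sin \<beta>)) (of_real (cos \<beta>)) z (pi - pi)"
      using ivp_imp_schroedinger_eq(2)[OF iv z0, of pi] by simp
    show "?u pi = of_real (sin \<beta>)" by (simp add: fund_ivp[OF qr_integrable])
    show "d1 ?u pi = - of_real (cos \<beta>)" using * by (simp add: fund_ivp[OF qr_integrable])
  qed
  then have "P (Eps P)" by (rule someI[of P])
  moreover have "sol q \<beta> z = Eps P" unfolding sol_def P_def ..
  ultimately show ?thesis by (simp only: P_def)
qed

lemma sol_ivp: "ivp (\<lambda>x. qc x - z) (\<lambda>x. 0) (sol q \<beta> z) (d1 (sol q \<beta> z))"
proof -
  have "(\<lambda>x. 0::complex) absolutely_integrable_on {0..pi}" by simp
  moreover have "AE x\<in>{0<..<pi} in lebesgue. z * sol q \<beta> z x - z * sol q \<beta> z x = 0" by simp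
  ultimately have "ivp (\<lambda>x. qc x - z) (\<lambda>x. - 0) (sol q \<beta> z) (d1 (sol q \<beta> z))"
    by (rule schroedinger_eq_imp_ivp[OF conjunct1[OF sol_spec]])
  then show ?thesis by (simp only: minus_zero)
qed

lemma ivp_eq_fund_reflected:
  assumes u: "ivp (\<lambda>x. qc x - z) (\<lambda>x. 0) u v" and x: "x \<in> {0..pi}"
  shows "u x = fundu qr (u pi) (- v pi) z (pi - x)" "v x = - fundv qr (u pi) (- v pi) z (pi - x)"
proof -
  have "ivp (\<lambda>x. qr x - z) (\<lambda>x. 0) (\<lambda>x. u (pi - x)) (\<lambda>x. - v (pi - x))"
    using ivp_reflect[OF u shift_integrable[OF qc_integrable]] by simp
  from fund_unique[OF qr_integrable this, of "pi - x"] x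
  show "u x = fundu qr (u pi) (- v pi) z (pi - x)" "v x = - fundv qr (u pi) (- v pi) z (pi - x)"
    by (auto simp: minus_equation_iff[of "v x"])
qed

lemma sol_eq_fund:
  assumes "x \<in> {0..pi}"
  shows "sol q \<beta> z x = fundu qr (of_real (sin \<beta>)) (of_real (cos \<beta>)) z (pi - x)"
    "d1 (sol q \<beta> z) x = - fundv qr (of_real (sin \<beta>)) (of_real (cos \<beta>)) z (pi - x)"
  using ivp_eq_fund_reflected[OF sol_ivp assms] sol_spec[of \<beta> z] by auto

text \<open>The left boundary form, evaluated at the solution that satisfies the right boundary
  condition by construction. Its zeros will be the eigenvalues, and the m-function is, up to a
  constant, a quotient of two such functions.\<close>

definition char_fun :: "real \<Rightarrow> real \<Rightarrow> complex \<Rightarrow> complex" where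
  "char_fun \<alpha> \<beta> z = of_real (cos \<alpha>) * sol q \<beta> z 0 - of_real (sin \<alpha>) * d1 (sol q \<beta> z) 0"

lemma char_fun_holomorphic: "char_fun \<alpha> \<beta> holomorphic_on UNIV"
proof -
  have "char_fun \<alpha> \<beta> = (\<lambda>z. of_real (cos \<alpha>) * fundu qr (of_real (sin \<beta>)) (of_real (cos \<beta>)) z pi
      + of_real (sin \<alpha>) * fundv qr (of_real (sin \<beta>)) (of_real (cos \<beta>)) z pi)"
    by (simp add: char_fun_def fun_eq_iff sol_eq_fund)
  then show ?thesis
    using fund_holomorphic[OF qr_integrable, of pi] by (auto intro!: holomorphic_intros)
qed

end

section \<open>Square integrable functions on (0, pi)\<close>

lemma integrable_lebesgue_on_iff:
  fixes f :: "real \<Rightarrow> 'a::euclidean_space"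
  shows "integrable (lebesgue_on {0<..<pi}) f \<longleftrightarrow> f absolutely_integrable_on {0..pi}"
  unfolding absolutely_integrable_on_Icc_iff_Ioo by (simp add: integrable_restrict_space set_integrable_def)

lemma L2_iff:
  "f \<in> L2 \<longleftrightarrow> f \<in> borel_measurable (lebesgue_on {0<..<pi}) \<and> (\<lambda>x. (norm (f x))\<^sup>2) absolutely_integrable_on {0..pi}"
  by (simp add: L2_def integrable_lebesgue_on_iff)

lemma L2_norm_eq:
  assumes "f \<in> L2"
  shows "L2_norm f = sqrt (integral {0..pi} (\<lambda>x. (norm (f x))\<^sup>2))"
  using assms unfolding L2_norm_def L2_def
  by (subst lebesgue_integral_eq_integral) (auto simp: integral_open_interval_real)

lemma continuous_L2:
  assumes "continuous_on {0..pi} u"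
  shows "u \<in> L2"
  unfolding L2_iff
proof
  show "u \<in> borel_measurable (lebesgue_on {0<..<pi})"
    by (intro continuous_imp_measurable_on_sets_lebesgue continuous_on_subset[OF assms]) auto
  show "(\<lambda>x. (norm (u x))\<^sup>2) absolutely_integrable_on {0..pi}"
    by (intro absolutely_integrable_continuous_real continuous_intros assms)
qed

lemma L2_add:
  assumes f: "f \<in> L2" and g: "g \<in> L2"
  shows "(\<lambda>x. f x + g x) \<in> L2"
proof -
  have m: "f \<in> borel_measurable (lebesgue_on {0<..<pi})" "g \<in> borel_measurable (lebesgue_on {0<..<pi})"
    using f g by (auto simp: L2_def)
  have i: "integrable (lebesgue_on {0<..<pi}) (\<lambda>x. 2 * (norm (f x))\<^sup>2 + 2 * (norm (g x))\<^sup>2)"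
    using f g by (auto simp: L2_def)
  have "integrable (lebesgue_on {0<..<pi}) (\<lambda>x. (norm (f x + g x))\<^sup>2)"
  proof (rule Bochner_Integration.integrable_bound[OF i])
    show "(\<lambda>x. (norm (f x + g x))\<^sup>2) \<in> borel_measurable (lebesgue_on {0<..<pi})" using m by measurable
    have "(norm (f x + g x))\<^sup>2 \<le> 2 * (norm (f x))\<^sup>2 + 2 * (norm (g x))\<^sup>2" for x
    proof -
      have "(norm (f x + g x))\<^sup>2 \<le> (norm (f x) + norm (g x))\<^sup>2" by (intro power_mono norm_triangle_ineq) auto
      also have "\<dots> \<le> 2 * (norm (f x))\<^sup>2 + 2 * (norm (g x))\<^sup>2"
        using zero_le_power2[of "norm (f x) - norm (g x)"] by (simp add: power2_eq_square algebra_simps)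
      finally show ?thesis .
    qed
    then show "AE x in lebesgue_on {0<..<pi}. norm ((norm (f x + g x))\<^sup>2) \<le> norm (2 * (norm (f x))\<^sup>2 + 2 * (norm (g x))\<^sup>2)"
      by auto
  qed
  then show ?thesis using m by (auto simp: L2_def)
qed

lemma L2_integrable:
  assumes g: "g \<in> L2"
  shows "g absolutely_integrable_on {0..pi}"
proof -
  have i: "integrable (lebesgue_on {0<..<pi}) (\<lambda>x. 1 + (norm (g x))\<^sup>2)"
    using g unfolding L2_def
    by (intro Bochner_Integration.integrable_add) (auto simp: integrable_lebesgue_on_iff)
  have "integrable (lebesgue_on {0<..<pi}) g"
  proof (rule Bochner_Integration.integrable_bound[OF i])
    show "g \<in> borel_measurable (lebesgue_on {0<..<pi})" using g by (simp add: L2_def)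
    have "norm (g x) \<le> 1 + (norm (g x))\<^sup>2" for x
    proof -
      have "0 \<le> (norm (g x) - 1)\<^sup>2" by simp
      also have "\<dots> = 1 + (norm (g x))\<^sup>2 - 2 * norm (g x)" by (simp add: power2_eq_square algebra_simps)
      finally show ?thesis using norm_ge_zero[of "g x"] by linarith
    qed
    then show "AE x in lebesgue_on {0<..<pi}. norm (g x) \<le> norm (1 + (norm (g x))\<^sup>2)" by auto
  qed
  then show ?thesis by (simp add: integrable_lebesgue_on_iff)
qed

text \<open>Cauchy-Schwarz against the constant 1, obtained by integrating the square of
  \<open>norm (g x) - N / pi\<close>, the deviation of |g| from its mean.\<close>

lemma L1_le_L2_norm:
  assumes g: "g \<in> L2"
  shows "integral {0..pi} (\<lambda>x. norm (g x)) \<le> sqrt pi * L2_norm g"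
proof -
  define N where "N = integral {0..pi} (\<lambda>x. norm (g x))"
  define S where "S = integral {0..pi} (\<lambda>x. (norm (g x))\<^sup>2)"
  have i1: "(\<lambda>x. norm (g x)) integrable_on {0..pi}" and i2: "(\<lambda>x. (norm (g x))\<^sup>2) integrable_on {0..pi}"
    using L2_integrable[OF g] g by (auto simp: L2_iff absolutely_integrable_on_def)
  have ex: "(norm (g x) - N / pi)\<^sup>2 = (norm (g x))\<^sup>2 + ((- 2 * N / pi) * norm (g x) + (N / pi)\<^sup>2)" for x
    by (simp add: power2_eq_square algebra_simps)
  have i: "(\<lambda>x. (- 2 * N / pi) * norm (g x)) integrable_on {0..pi}"
    using i1 by (rule integrable_on_mult_right)
  have i': "(\<lambda>x. (- 2 * N / pi) * norm (g x) + (N / pi)\<^sup>2) integrable_on {0..pi}"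
    using i integrable_const_ivl by (rule integrable_add)
  have "(\<lambda>x. (norm (g x) - N / pi)\<^sup>2) integrable_on {0..pi}"
    unfolding ex using i2 i' by (rule integrable_add)
  then have "0 \<le> integral {0..pi} (\<lambda>x. (norm (g x) - N / pi)\<^sup>2)"
    by (intro integral_nonneg) auto
  also have "\<dots> = S + ((- 2 * N / pi) * N + pi * (N / pi)\<^sup>2)"
    unfolding ex Henstock_Kurzweil_Integration.integral_add[OF i2 i']
      Henstock_Kurzweil_Integration.integral_add[OF i integrable_const_ivl] integral_mult_right
    by (simp add: S_def N_def)
  also have "\<dots> = S - N\<^sup>2 / pi" by (simp add: power2_eq_square field_simps)
  finally have "N\<^sup>2 \<le> pi * S" by (simp add: field_simps)
  then have "N \<le> sqrt (pi * S)" by (rule real_le_rsqrt)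
  then show ?thesis unfolding L2_norm_eq[OF g] by (simp add: N_def S_def real_sqrt_mult)
qed

lemma L2_norm_le_sup:
  assumes u: "continuous_on {0..pi} u" and B: "\<And>x. x \<in> {0..pi} \<Longrightarrow> norm (u x) \<le> B"
  shows "L2_norm u \<le> sqrt pi * B"
proof -
  have B0: "B \<ge> 0" using order_trans[OF norm_ge_zero B[of 0]] by simp
  have "integral {0..pi} (\<lambda>x. (norm (u x))\<^sup>2) \<le> integral {0..pi} (\<lambda>x. B\<^sup>2)"
    by (intro integral_le integrable_continuous_real continuous_intros u power_mono B) auto
  then have "sqrt (integral {0..pi} (\<lambda>x. (norm (u x))\<^sup>2)) \<le> sqrt (pi * B\<^sup>2)" by (simp add: mult.commute)
  then show ?thesis using B0 by (simp add: L2_norm_eq continuous_L2 u real_sqrt_mult)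
qed

lemma L2_norm_eq_0_continuous:
  assumes u: "continuous_on {0..pi} u" and "L2_norm u \<le> 0" and x: "x \<in> {0..pi}"
  shows "u x = 0"
proof -
  have n: "0 \<le> integral {0..pi} (\<lambda>x. (norm (u x))\<^sup>2)"
    by (intro integral_nonneg integrable_continuous_real continuous_intros u) auto
  then have "integral {0..pi} (\<lambda>x. (norm (u x))\<^sup>2) = 0"
    using assms(2) by (simp add: L2_norm_eq continuous_L2 u)
  then have "\<forall>x\<in>{0..pi}. (norm (u x))\<^sup>2 = 0"
    by (subst (asm) integral_eq_0_iff) (auto intro!: continuous_intros u)
  then show ?thesis using x by simp
qed

text \<open>A zero of \<open>char_fun\<close> makes \<open>sol\<close> satisfy both boundary
  conditions, hence an eigenfunction. In the resolvent set the lower bound would force it to vanish,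
  yet its data (sin \<beta>, - cos \<beta>) at pi are not both zero.\<close>

lemma char_fun_zero_imp_spectrum:
  assumes q: "q absolutely_integrable_on {0<..<pi}" and zero: "char_fun q \<alpha> \<beta> z = 0"
  shows "z \<in> spectrum q \<alpha> \<beta>"
proof (rule ccontr)
  define u where "u = sol q \<beta> z"
  have c: "continuous_on {0..pi} u" unfolding u_def by (rule ivp_cont1[OF sol_ivp[OF q]])
  have s: "schroedinger_eq q u (\<lambda>x. z * u x)" "u pi = of_real (sin \<beta>)" "d1 u pi = - of_real (cos \<beta>)"
    using sol_spec[OF q, of \<beta> z] by (auto simp: u_def)
  assume "z \<notin> spectrum q \<alpha> \<beta>"
  then obtain C where C: "\<And>u f. schroedinger_op q \<alpha> \<beta> u f \<Longrightarrow> L2_norm u \<le> C * L2_norm (\<lambda>x. f x - z * u x)"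
    by (auto simp: spectrum_def resolvent_set_def)
  have "schroedinger_op q \<alpha> \<beta> u (\<lambda>x. z * u x)"
    unfolding schroedinger_op_def
  proof (intro conjI s continuous_L2 continuous_intros c)
    show "boundary_cond \<alpha> \<beta> u"
      using s(2,3) zero unfolding boundary_cond_def char_fun_def[OF q] u_def[symmetric]
      by (simp add: mult.commute)
  qed
  from C[OF this] have "L2_norm u \<le> 0" by (simp add: L2_norm_def)
  then have u0: "u x = 0" if "x \<in> {0..pi}" for x using L2_norm_eq_0_continuous[OF c _ that] by simp
  have "((\<lambda>x. 0) has_vector_derivative 0) (at pi within {0..pi})" by simp
  then have "(u has_vector_derivative 0) (at pi within {0..pi})"
    by (rule has_vector_derivative_transform[rotated 2]) (use u0 in auto)
  then have "d1 u pi = 0" by (intro d1_eq) auto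
  then have "sin \<beta> = 0" "cos \<beta> = 0" using u0[of pi] s(2,3) by auto
  then show False using sin_cos_squared_add[of \<beta>] by simp
qed

text \<open>Any solution with the right boundary condition is a particular solution with zero data
  at pi plus a multiple \<open>c\<close> of \<open>sol\<close>; the left boundary condition
  determines \<open>c\<close> upon division by \<open>char_fun\<close>. This gives surjectivity, and
  the same decomposition, with Gronwall for the particular part, bounds the inverse.\<close>

lemma char_fun_nonzero_imp_resolvent:
  assumes q: "q absolutely_integrable_on {0<..<pi}" and nz: "char_fun q \<alpha> \<beta> z \<noteq> 0"
  shows "z \<in> resolvent_set q \<alpha> \<beta>"
proof -
  let ?qc = "\<lambda>x. complex_of_real (q x)" and ?qr = "\<lambda>x. complex_of_real (q (pi - x))"
  define s where "s = sol q \<beta> z"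
  define ch where "ch = char_fun q \<alpha> \<beta> z"
  have s: "ivp (\<lambda>x. ?qc x - z) (\<lambda>x. 0) s (d1 s)" unfolding s_def by (rule sol_ivp[OF q])
  have sb: "s pi = of_real (sin \<beta>)" "d1 s pi = - of_real (cos \<beta>)" using sol_spec[OF q, of \<beta> z] by (auto simp: s_def)
  have ch: "ch = of_real (cos \<alpha>) * s 0 - of_real (sin \<alpha>) * d1 s 0" by (simp add: ch_def char_fun_def[OF q] s_def)
  have cs: "continuous_on {0..pi} s" by (rule ivp_cont1[OF s])
  have p: "(\<lambda>x. ?qc x - z) absolutely_integrable_on {0..pi}" by (rule shift_integrable[OF qc_integrable[OF q]])
  have c0: "(\<lambda>x. 0::complex) absolutely_integrable_on {0..pi}" by simp
  have surj: "\<exists>u f. schroedinger_op q \<alpha> \<beta> u f \<and> (AE x\<in>{0<..<pi} in lebesgue. f x - z * u x = g x)" if g: "g \<in> L2" for g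
  proof -
    have gi: "g absolutely_integrable_on {0..pi}" by (rule L2_integrable[OF g])
    have gr: "(\<lambda>x. - g (pi - x)) absolutely_integrable_on {0..pi}"
      using absolutely_integrable_uminus[OF absolutely_integrable_reflect[OF gi]] .
    have pr: "(\<lambda>x. ?qr x - z) absolutely_integrable_on {0..pi}" by (rule shift_integrable[OF qr_integrable[OF q]])
    obtain y w where yw: "ivp (\<lambda>x. ?qr x - z) (\<lambda>x. - g (pi - x)) y w" "y 0 = 0" "w 0 = 0"
      using ivp_exists[OF pr gr] by metis
    have y: "ivp (\<lambda>x. ?qc x - z) (\<lambda>x. - g x) (\<lambda>x. y (pi - x)) (\<lambda>x. - w (pi - x))"
      using ivp_reflect[OF yw(1) pr gr] by simp
    \<comment> \<open>The reflected function has value \<open>y pi\<close> and derivative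
      \<open>- w pi\<close> at 0, so this multiple of \<open>s\<close> cancels its left boundary
      form.\<close>
    define c where "c = - (of_real (cos \<alpha>) * y pi + of_real (sin \<alpha>) * w pi) / ch"
    define u where "u = (\<lambda>x. y (pi - x) + c * s x)"
    define v where "v = (\<lambda>x. - w (pi - x) + c * d1 s x)"
    have mg: "(\<lambda>x. - g x) absolutely_integrable_on {0..pi}" using gi by (rule absolutely_integrable_uminus)
    have "ivp (\<lambda>x. ?qc x - z) (\<lambda>x. - g x + c * 0) u v"
      unfolding u_def v_def by (rule ivp_add_scale[OF y s p mg c0])
    then have u: "ivp (\<lambda>x. ?qc x - z) (\<lambda>x. - g x) u v" by simp
    have "schroedinger_op q \<alpha> \<beta> u (\<lambda>x. z * u x + g x)"
      unfolding schroedinger_op_def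
    proof (intro conjI ivp_imp_schroedinger_eq(1)[OF q u gi])
      show "(\<lambda>x. z * u x + g x) \<in> L2"
        by (rule L2_add[OF continuous_L2 g]) (intro continuous_intros ivp_cont1[OF u])
      have d: "d1 u 0 = - w pi + c * d1 s 0" "d1 u pi = c * d1 s pi"
        using ivp_imp_schroedinger_eq(2)[OF q u gi] yw(3) by (auto simp: v_def)
      have "c * ch = - (of_real (cos \<alpha>) * y pi + of_real (sin \<alpha>) * w pi)"
        using nz by (simp add: c_def ch_def)
      then show "boundary_cond \<alpha> \<beta> u"
        unfolding boundary_cond_def d unfolding ch u_def using sb yw(2) by (simp add: algebra_simps)
    qed
    then show ?thesis by (intro exI[of _ u] exI[of _ "\<lambda>x. z * u x + g x"]) simp
  qed
  obtain S where S: "\<And>x. x \<in> {0..pi} \<Longrightarrow> norm (s x) \<le> S"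
    using compact_imp_bounded[OF compact_continuous_image[OF cs compact_Icc]] unfolding bounded_iff by blast
  define G where "G = growth_const (\<lambda>x. ?qr x - z)"
  have G: "G > 0" by (simp add: G_def growth_const_pos)
  have S0: "S \<ge> 0" using order_trans[OF norm_ge_zero S[of 0]] by simp
  define K where "K = G + 2 * G / norm ch * S"
  have bound: "L2_norm u \<le> pi * K * L2_norm (\<lambda>x. f x - z * u x)" if op: "schroedinger_op q \<alpha> \<beta> u f" for u f
  proof -
    have eq: "schroedinger_eq q u f" and bc: "boundary_cond \<alpha> \<beta> u" and f: "f \<in> L2" using op by (auto simp: schroedinger_op_def)
    have "continuous_on {0..pi} u"
      using eq unfolding schroedinger_eq_def has_second_deriv_def
      by (meson continuous_on_eq_continuous_within differentiable_imp_continuous_within)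
    then have "continuous_on {0..pi} (\<lambda>x. - (z * u x))" by (intro continuous_intros)
    from L2_add[OF f continuous_L2[OF this]] have g: "(\<lambda>x. f x - z * u x) \<in> L2" by simp
    define g where "g = (\<lambda>x. f x - z * u x)"
    have g: "g \<in> L2" and gi: "g absolutely_integrable_on {0..pi}" using g L2_integrable by (auto simp: g_def)
    have mg: "(\<lambda>x. - g x) absolutely_integrable_on {0..pi}" using gi by (rule absolutely_integrable_uminus)
    have u: "ivp (\<lambda>x. ?qc x - z) (\<lambda>x. - g x) u (d1 u)"
      by (rule schroedinger_eq_imp_ivp[OF q eq gi]) (simp add: g_def)
    \<comment> \<open>The right boundary condition makes the data of \<open>u\<close> at pi parallel
      to the unit vector (sin \<beta>, - cos \<beta>), which are the data of \<open>s\<close>. Here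
      \<open>c\<close> is the component along it, so \<open>u - c s\<close> has zero data at
      pi.\<close>
    define c where "c = u pi * of_real (sin \<beta>) - d1 u pi * of_real (cos \<beta>)"
    define y where "y = (\<lambda>x. u x + (- c) * s x)"
    define w where "w = (\<lambda>x. d1 u x + (- c) * d1 s x)"
    have "ivp (\<lambda>x. ?qc x - z) (\<lambda>x. - g x + (- c) * 0) y w"
      unfolding y_def w_def by (rule ivp_add_scale[OF u s p mg c0])
    then have y: "ivp (\<lambda>x. ?qc x - z) (\<lambda>x. - g x) y w" by simp
    have bpi: "u pi * of_real (cos \<beta>) + d1 u pi * of_real (sin \<beta>) = 0"
      and b0: "u 0 * of_real (cos \<alpha>) - d1 u 0 * of_real (sin \<alpha>) = 0"
      using bc by (auto simp: boundary_cond_def)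
    have cs2: "complex_of_real (sin \<beta>) * of_real (sin \<beta>) + of_real (cos \<beta>) * of_real (cos \<beta>) = 1"
      by (metis of_real_1 of_real_add of_real_mult power2_eq_square sin_cos_squared_add)
    have "y pi = 0" "w pi = 0"
      unfolding y_def w_def c_def sb using bpi cs2 by algebra+
    have yr: "ivp (\<lambda>x. ?qr x - z) (\<lambda>x. - g (pi - x)) (\<lambda>x. y (pi - x)) (\<lambda>x. - w (pi - x))"
      by (rule ivp_reflect[OF y p mg])
    have gr: "(\<lambda>x. - g (pi - x)) absolutely_integrable_on {0..pi}"
      using absolutely_integrable_uminus[OF absolutely_integrable_reflect[OF gi]] .
    have n: "integral {0..pi} (\<lambda>x. norm (- g (pi - x))) = integral {0..pi} (\<lambda>x. norm (g x))"
      using integral_unique[OF has_integral_reflect[of "\<lambda>t. norm (g t)" pi pi 0]] gi by (simp add: absolutely_integrable_on_def)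
    define N where "N = integral {0..pi} (\<lambda>x. norm (g x))"
    have N: "N \<ge> 0" unfolding N_def using gi by (intro integral_nonneg) (auto simp: absolutely_integrable_on_def)
    have yB: "norm (y x) + norm (w x) \<le> N * G" if "x \<in> {0..pi}" for x
      using ivp_bound[OF shift_integrable[OF qr_integrable[OF q]] gr yr, of "pi - x"] that \<open>y pi = 0\<close> \<open>w pi = 0\<close>
      by (simp only: n) (simp add: N_def G_def)
    have "c * ch = - (y 0 * of_real (cos \<alpha>) - w 0 * of_real (sin \<alpha>))"
      using b0 by (simp add: ch y_def w_def algebra_simps)
    then have "norm c * norm ch \<le> norm (y 0 * of_real (cos \<alpha>)) + norm (w 0 * of_real (sin \<alpha>))"
      by (metis norm_minus_cancel norm_mult norm_triangle_ineq4)
    also have "\<dots> \<le> norm (y 0) * 1 + norm (w 0) * 1"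
      unfolding norm_mult by (intro add_mono mult_left_mono) auto
    also have "\<dots> \<le> N * G" using yB[of 0] by simp
    finally have c: "norm c \<le> N * G / norm ch" using nz by (simp add: ch_def field_simps)
    have uB: "norm (u x) \<le> N * K" if x: "x \<in> {0..pi}" for x
    proof -
      have "norm (u x) = norm (y x + c * s x)" by (simp add: y_def)
      also have "\<dots> \<le> N * G + (N * G / norm ch) * S"
      proof (intro order_trans[OF norm_triangle_ineq] add_mono)
        show "norm (y x) \<le> N * G" using yB[OF x] norm_ge_zero[of "w x"] by linarith
        show "norm (c * s x) \<le> (N * G / norm ch) * S"
          unfolding norm_mult using c S[OF x] N G by (intro mult_mono) auto
      qed
      also have "\<dots> \<le> N * K" using N G S0 by (simp add: K_def distrib_left mult.assoc divide_right_mono mult_left_mono)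
      finally show ?thesis .
    qed
    have "L2_norm u \<le> sqrt pi * (N * K)" using uB by (intro L2_norm_le_sup ivp_cont1[OF u])
    also have "\<dots> \<le> sqrt pi * ((sqrt pi * L2_norm g) * K)"
      using L1_le_L2_norm[OF g] G S0 by (intro mult_left_mono mult_right_mono) (auto simp: N_def K_def)
    also have "\<dots> = pi * K * L2_norm g" by (simp add: mult.assoc[symmetric])
    finally show ?thesis by (simp add: g_def)
  qed
  show ?thesis unfolding resolvent_set_def using surj bound by blast
qed

lemma spectrum_iff_char_fun:
  assumes "q absolutely_integrable_on {0<..<pi}"
  shows "z \<in> spectrum q \<alpha> \<beta> \<longleftrightarrow> char_fun q \<alpha> \<beta> z = 0"
  using char_fun_zero_imp_spectrum[OF assms] char_fun_nonzero_imp_resolvent[OF assms]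
  unfolding spectrum_def by blast

text \<open>For Re \<kappa> >= 1 the growing exponential dominates 2 \<kappa> u. With
  \<open>T = norm \<kappa> * (\<rho> * E)\<close> its term is at least T/2; the decaying exponential
  costs T/7, since exp (2 pi) >= 7, and the potential costs 2 S <= T/10. More than T/4 remains,
  which leaves |\<kappa>| |u| >= T/8.\<close>

lemma fundu_lower:
  fixes c d :: real
  assumes q: "q absolutely_integrable_on {0..pi}" and cd: "c \<noteq> 0 \<or> d \<noteq> 0"
  obtains k0 where "k0 \<ge> 1" "\<And>\<kappa>. norm \<kappa> \<ge> k0 \<Longrightarrow> Re \<kappa> \<ge> 1 \<Longrightarrow>
    norm (fundu q (of_real c) (of_real d) (- \<kappa>\<^sup>2) pi) \<ge> (\<bar>c\<bar> + \<bar>d\<bar> / norm \<kappa>) * exp (Re \<kappa> * pi) / 8"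
proof -
  define K where "K = 2 * pnorm q * exp (2 * pnorm q)"
  have K: "K \<ge> 0" using pnorm_nonneg[OF q] by (simp add: K_def)
  \<comment> \<open>The term 20 K makes the error from the potential a tenth of the main term. If c
    is nonzero, |\<kappa>| |c| >= 3 |d| prevents cancellation in d + \<kappa> c; if c = 0 there is
    nothing to cancel.\<close>
  define k0 where "k0 = 1 + 20 * K + (if c = 0 then 0 else 3 * \<bar>d\<bar> / \<bar>c\<bar>)"
  show ?thesis
  proof (rule that[of k0])
    show "k0 \<ge> 1" using K by (simp add: k0_def)
    fix \<kappa> :: complex assume \<kappa>: "norm \<kappa> \<ge> k0" "Re \<kappa> \<ge> 1"
    have k1: "norm \<kappa> \<ge> 1" "norm \<kappa> \<ge> 20 * K" using \<kappa> K \<open>k0 \<ge> 1\<close> by (auto simp: k0_def split: if_splits intro: order_trans[rotated])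
    define \<rho> where "\<rho> = \<bar>c\<bar> + \<bar>d\<bar> / norm \<kappa>"
    define u v where "u = fundu q (of_real c) (of_real d) (- \<kappa>\<^sup>2) pi" and "v = fundv q (of_real c) (of_real d) (- \<kappa>\<^sup>2) pi"
    define E where "E = exp (Re \<kappa> * pi)"
    have \<rho>: "\<rho> \<ge> 0" by (simp add: \<rho>_def)
    have E: "E > 0" by (simp add: E_def)
    have A: "norm (v + \<kappa> * u - exp (\<kappa> * of_real pi) * (of_real d + \<kappa> * of_real c)) \<le> K * \<rho> * E"
      "norm (v - \<kappa> * u - exp (- \<kappa> * of_real pi) * (of_real d - \<kappa> * of_real c)) \<le> K * \<rho> * E"
      using fund_growing[OF q k1(1) _ , of pi "of_real c" "of_real d"] fund_decaying[OF q k1(1) _ , of pi "of_real c" "of_real d"] \<kappa>(2)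
      by (auto simp: K_def \<rho>_def u_def v_def E_def)
    have real_kernel: "norm \<kappa> * \<rho> = norm \<kappa> * \<bar>c\<bar> + \<bar>d\<bar>" using k1 by (simp add: \<rho>_def distrib_left) (metis norm_zero not_one_le_zero)
    have lo: "norm (of_real d + \<kappa> * of_real c) \<ge> norm \<kappa> * \<rho> / 2"
    proof (cases "c = 0")
      case False
      have "norm \<kappa> \<ge> 3 * \<bar>d\<bar> / \<bar>c\<bar>" using \<kappa>(1) False K by (simp add: k0_def)
      then have "norm \<kappa> * \<bar>c\<bar> \<ge> 3 * \<bar>d\<bar>" using False by (simp add: field_simps)
      moreover have "norm (of_real d + \<kappa> * of_real c) \<ge> norm \<kappa> * \<bar>c\<bar> - \<bar>d\<bar>"
        using norm_diff_ineq[of "\<kappa> * of_real c" "of_real d"] by (simp add: norm_mult add.commute)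
      ultimately show ?thesis using real_kernel by simp
    qed (use real_kernel in simp)
    have hi: "norm (of_real d - \<kappa> * of_real c) \<le> norm \<kappa> * \<rho>"
      using norm_triangle_ineq4[of "of_real d" "\<kappa> * of_real c"] real_kernel by (simp add: norm_mult)
    have n1: "norm (exp (\<kappa> * of_real pi)) = E" by (simp add: E_def)
    have n2: "norm (exp (- \<kappa> * of_real pi)) \<le> E / 7"
    proof -
      have "7 \<le> 1 + 2 * (Re \<kappa> * pi)" using mult_right_mono[OF \<kappa>(2), of pi] pi_gt3 by linarith
      also have "\<dots> \<le> exp (2 * (Re \<kappa> * pi))" by (rule exp_ge_add_one_self)
      also have "\<dots> = E * E" by (simp add: E_def exp_add[symmetric])
      finally have "inverse E \<le> E / 7" using E by (simp add: field_simps)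
      moreover have "norm (exp (- \<kappa> * of_real pi)) = inverse E" by (simp add: E_def flip: exp_minus)
      ultimately show ?thesis by simp
    qed
    define X where "X = v + \<kappa> * u - exp (\<kappa> * of_real pi) * (of_real d + \<kappa> * of_real c)"
    define Y where "Y = v - \<kappa> * u - exp (- \<kappa> * of_real pi) * (of_real d - \<kappa> * of_real c)"
    have "exp (\<kappa> * of_real pi) * (of_real d + \<kappa> * of_real c) = 2 * \<kappa> * u - X + Y + exp (- \<kappa> * of_real pi) * (of_real d - \<kappa> * of_real c)"
      by (simp add: X_def Y_def algebra_simps)
    then have "norm (exp (\<kappa> * of_real pi) * (of_real d + \<kappa> * of_real c)) \<le> norm (2 * \<kappa> * u) + norm X + norm Y + norm (exp (- \<kappa> * of_real pi) * (of_real d - \<kappa> * of_real c))"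
      by (metis (no_types) add_mono norm_triangle_ineq norm_triangle_ineq4 norm_triangle_le order_refl)
    moreover have "norm (exp (- \<kappa> * of_real pi) * (of_real d - \<kappa> * of_real c)) \<le> E / 7 * (norm \<kappa> * \<rho>)"
      unfolding norm_mult[of "exp _"] using n2 hi E by (intro mult_mono) auto
    moreover have "norm (exp (\<kappa> * of_real pi) * (of_real d + \<kappa> * of_real c)) \<ge> E * (norm \<kappa> * \<rho> / 2)"
      unfolding norm_mult[of "exp _"] n1 using lo E by (intro mult_left_mono) auto
    ultimately have 1: "E * (norm \<kappa> * \<rho> / 2) \<le> 2 * (norm \<kappa> * norm u) + 2 * (K * \<rho> * E) + E / 7 * (norm \<kappa> * \<rho>)"
      using A by (simp add: X_def Y_def norm_mult)
    define T S W where "T = norm \<kappa> * (\<rho> * E)" and "S = K * \<rho> * E" and "W = norm \<kappa> * norm u"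
    have "T / 2 \<le> 2 * W + 2 * S + T / 7" using 1 by (simp add: T_def S_def W_def mult_ac)
    moreover have "20 * S \<le> T"
    proof -
      have "(20 * K) * (\<rho> * E) \<le> norm \<kappa> * (\<rho> * E)" using k1 \<rho> E by (intro mult_right_mono) auto
      then show ?thesis by (simp add: T_def S_def mult_ac)
    qed
    moreover have "T \<ge> 0" using \<rho> E by (simp add: T_def)
    ultimately have "T / 8 \<le> W" by linarith
    then have "norm \<kappa> * (\<rho> * E / 8) \<le> norm \<kappa> * norm u" by (simp add: T_def W_def)
    then show "(\<bar>c\<bar> + \<bar>d\<bar> / norm \<kappa>) * exp (Re \<kappa> * pi) / 8 \<le> norm (fundu q (of_real c) (of_real d) (- \<kappa>\<^sup>2) pi)"
      unfolding \<rho>_def E_def u_def by (rule mult_left_le_imp_le) (use k1 in linarith)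
  qed
qed

text \<open>After reflection, the upper bound at pi - x is divided by the lower bound at pi, so
  \<open>sol\<close> is controlled relative to its own value at 0, the form needed for quotients.
  For real \<kappa> = t the bound for v - \<kappa> u says that the logarithmic derivative at 0 is -
  t + O(1).\<close>

lemma sol_asymptotics:
  assumes q: "q absolutely_integrable_on {0<..<pi}"
  obtains k0 C where "k0 \<ge> 1" "C \<ge> 0"
    "\<And>\<kappa>. norm \<kappa> \<ge> k0 \<Longrightarrow> Re \<kappa> \<ge> 1 \<Longrightarrow> sol q \<beta> (- \<kappa>\<^sup>2) 0 \<noteq> 0"
    "\<And>\<kappa> x. norm \<kappa> \<ge> k0 \<Longrightarrow> Re \<kappa> \<ge> 1 \<Longrightarrow> x \<in> {0..pi} \<Longrightarrow>
       norm (sol q \<beta> (- \<kappa>\<^sup>2) x) \<le> C * exp (- Re \<kappa> * x) * norm (sol q \<beta> (- \<kappa>\<^sup>2) 0)"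
    "\<And>t. t \<ge> k0 \<Longrightarrow> norm (d1 (sol q \<beta> (- (of_real t)\<^sup>2)) 0 + of_real t * sol q \<beta> (- (of_real t)\<^sup>2) 0) \<le> C * norm (sol q \<beta> (- (of_real t)\<^sup>2) 0)"
proof -
  let ?qr = "\<lambda>x. complex_of_real (q (pi - x))"
  have qr: "?qr absolutely_integrable_on {0..pi}" by (rule qr_integrable[OF q])
  let ?c = "sin \<beta>" and ?d = "cos \<beta>"
  define \<rho> where "\<rho> = (\<lambda>\<kappa>::complex. \<bar>?c\<bar> + \<bar>?d\<bar> / norm \<kappa>)"
  define L where "L = exp (2 * pnorm ?qr)"
  define K where "K = 2 * pnorm ?qr * L"
  have L: "L > 0" and K: "K \<ge> 0" using pnorm_nonneg[OF qr] by (auto simp: L_def K_def)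
  have cd: "?c \<noteq> 0 \<or> ?d \<noteq> 0" using sin_cos_squared_add[of \<beta>] by force
  obtain k0 where k0: "k0 \<ge> 1" and lo: "\<And>\<kappa>. norm \<kappa> \<ge> k0 \<Longrightarrow> Re \<kappa> \<ge> 1 \<Longrightarrow>
    norm (fundu ?qr (of_real ?c) (of_real ?d) (- \<kappa>\<^sup>2) pi) \<ge> \<rho> \<kappa> * exp (Re \<kappa> * pi) / 8"
    using fundu_lower[OF qr cd] unfolding \<rho>_def by blast
  have \<rho>: "\<rho> \<kappa> > 0" if "norm \<kappa> \<ge> k0" for \<kappa>
  proof -
    have "norm \<kappa> > 0" using that k0 by linarith
    then show ?thesis using cd unfolding \<rho>_def
      by (metis abs_ge_zero add_nonneg_pos add_pos_nonneg divide_nonneg_pos divide_pos_pos zero_less_abs_iff)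
  qed
  have lo': "\<rho> \<kappa> * exp (Re \<kappa> * pi) \<le> 8 * norm (sol q \<beta> (- \<kappa>\<^sup>2) 0)" if "norm \<kappa> \<ge> k0" "Re \<kappa> \<ge> 1" for \<kappa>
    using lo[OF that] by (simp add: sol_eq_fund[OF q])
  show ?thesis
  \<comment> \<open>16 L is the upper constant 2 L times the 8 of the lower bound; 8 (K + 1) comes
    from the derivative estimate, where the 1 accounts for the decaying exponential. The sum serves
    both.\<close>
  proof (rule that[of k0 "16 * L + 8 * (K + 1)"])
    show "0 \<le> 16 * L + 8 * (K + 1)" using L K by simp
    show "sol q \<beta> (- \<kappa>\<^sup>2) 0 \<noteq> 0" if "norm \<kappa> \<ge> k0" "Re \<kappa> \<ge> 1" for \<kappa>
      using lo'[OF that] \<rho>[OF that(1)] by (auto simp: mult_le_0_iff)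
    show "norm (sol q \<beta> (- \<kappa>\<^sup>2) x) \<le> (16 * L + 8 * (K + 1)) * exp (- Re \<kappa> * x) * norm (sol q \<beta> (- \<kappa>\<^sup>2) 0)"
      if k: "norm \<kappa> \<ge> k0" "Re \<kappa> \<ge> 1" and x: "x \<in> {0..pi}" for \<kappa> x
    proof -
      have "norm (sol q \<beta> (- \<kappa>\<^sup>2) x) \<le> 2 * L * \<rho> \<kappa> * exp (Re \<kappa> * (pi - x))"
        using fundu_upper[OF qr, of \<kappa> "pi - x" "of_real ?c" "of_real ?d"] k k0 x by (simp add: sol_eq_fund[OF q x] L_def \<rho>_def)
      also have "\<dots> = 2 * L * exp (- Re \<kappa> * x) * (\<rho> \<kappa> * exp (Re \<kappa> * pi))"
      proof -
        have "exp (Re \<kappa> * (pi - x)) = exp (- Re \<kappa> * x) * exp (Re \<kappa> * pi)"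
          by (simp add: exp_add[symmetric] algebra_simps)
        then show ?thesis by simp
      qed
      also have "\<dots> \<le> 2 * L * exp (- Re \<kappa> * x) * (8 * norm (sol q \<beta> (- \<kappa>\<^sup>2) 0))"
        using lo'[OF k] L by (intro mult_left_mono) auto
      also have "\<dots> = (16 * L) * (exp (- Re \<kappa> * x) * norm (sol q \<beta> (- \<kappa>\<^sup>2) 0))" by simp
      also have "\<dots> \<le> (16 * L + 8 * (K + 1)) * (exp (- Re \<kappa> * x) * norm (sol q \<beta> (- \<kappa>\<^sup>2) 0))"
        using K by (intro mult_right_mono) auto
      finally show ?thesis by (simp add: mult.assoc)
    qed
    show "norm (d1 (sol q \<beta> (- (of_real t)\<^sup>2)) 0 + of_real t * sol q \<beta> (- (of_real t)\<^sup>2) 0) \<le> (16 * L + 8 * (K + 1)) * norm (sol q \<beta> (- (of_real t)\<^sup>2) 0)"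
      if t: "t \<ge> k0" for t
    proof -
      define \<kappa> where "\<kappa> = complex_of_real t"
      have k: "norm \<kappa> \<ge> k0" "Re \<kappa> \<ge> 1" "norm \<kappa> = t" "Re \<kappa> = t" using t k0 by (auto simp: \<kappa>_def)
      define u v where "u = fundu ?qr (of_real ?c) (of_real ?d) (- \<kappa>\<^sup>2) pi" and "v = fundv ?qr (of_real ?c) (of_real ?d) (- \<kappa>\<^sup>2) pi"
      define E where "E = exp (Re \<kappa> * pi)"
      have E: "E > 0" by (simp add: E_def)
      have r: "\<rho> \<kappa> > 0" using \<rho> k by simp
      have 1: "norm (v - \<kappa> * u - exp (- \<kappa> * of_real pi) * (of_real ?d - \<kappa> * of_real ?c)) \<le> K * \<rho> \<kappa> * E"
        using fund_decaying[OF qr _ _ , of \<kappa> pi "of_real ?c" "of_real ?d"] k k0 by (simp add: K_def L_def \<rho>_def u_def v_def E_def)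
      have "norm (of_real ?d - \<kappa> * of_real ?c) \<le> t * \<rho> \<kappa>"
        using norm_triangle_ineq4[of "of_real ?d" "\<kappa> * of_real ?c"] k t k0 by (simp add: norm_mult \<rho>_def distrib_left)
      then have "norm (exp (- \<kappa> * of_real pi) * (of_real ?d - \<kappa> * of_real ?c)) \<le> exp (- t * pi) * (t * \<rho> \<kappa>)"
        unfolding norm_mult[of "exp _"] using k by (intro mult_mono) auto
      also have "\<dots> \<le> E * \<rho> \<kappa>"
      proof -
        have "t * 1 \<le> t * pi" using t k0 pi_gt3 by (intro mult_left_mono) auto
        also have "t * pi \<le> exp (t * pi)" using exp_ge_add_one_self[of "t * pi"] by linarith
        also have "\<dots> \<le> E * E" using k t k0 by (simp add: E_def flip: exp_add)
        finally have "exp (- t * pi) * t \<le> E" using k by (simp add: E_def exp_minus field_simps)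
        then show ?thesis using r by (simp add: mult.assoc[symmetric] mult_right_mono)
      qed
      finally have "norm (v - \<kappa> * u) \<le> (K + 1) * (\<rho> \<kappa> * E)"
        using 1 norm_triangle_ineq[of "v - \<kappa> * u - exp (- \<kappa> * of_real pi) * (of_real ?d - \<kappa> * of_real ?c)" "exp (- \<kappa> * of_real pi) * (of_real ?d - \<kappa> * of_real ?c)"]
        by (simp add: algebra_simps)
      also have "\<dots> \<le> (K + 1) * (8 * norm u)"
        using lo[OF k(1,2)] K by (intro mult_left_mono) (auto simp: E_def u_def)
      also have "\<dots> = 8 * (K + 1) * norm u" by simp
      also have "\<dots> \<le> (16 * L + 8 * (K + 1)) * norm u" using L by (intro mult_right_mono) auto
      finally have "norm (v - \<kappa> * u) \<le> (16 * L + 8 * (K + 1)) * norm u" .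
      moreover have "d1 (sol q \<beta> (- \<kappa>\<^sup>2)) 0 + \<kappa> * sol q \<beta> (- \<kappa>\<^sup>2) 0 = - (v - \<kappa> * u)"
        by (simp add: sol_eq_fund[OF q] u_def v_def)
      ultimately show ?thesis by (simp add: norm_minus_commute \<kappa>_def sol_eq_fund[OF q] u_def)
    qed
  qed (use k0 in auto)
qed

section \<open>The Borg--Marchenko theorem\<close>

text \<open>All integrals of \<open>f\<close> over subintervals vanish, so a Riemann sum of |f|
  equals the sum of the deviations that Henstock's lemma makes small. Hence |f| has integral
  0.\<close>

lemma indefinite_integral_zero_imp_AE_zero:
  fixes f :: "real \<Rightarrow> complex"
  assumes f: "f absolutely_integrable_on {a..b}" and zero: "\<And>x. x \<in> {a..b} \<Longrightarrow> integral {a..x} f = 0"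
  shows "AE x\<in>{a<..<b} in lebesgue. f x = 0"
proof -
  have fi: "f integrable_on cbox a b" using f by (simp add: absolutely_integrable_on_def)
  have 0: "integral K f = 0" if K: "K = cbox c d" "K \<subseteq> {a..b}" for K c d
  proof (cases "c \<le> d")
    case True
    have "integral {a..d} f - integral {a..c} f = integral {c..d} f"
      using K True by (intro indefinite_increment[OF f, where c = 0]) auto
    moreover have "c \<in> {a..b}" "d \<in> {a..b}" using K True by auto
    ultimately show ?thesis using zero K by simp
  qed (use K in simp)
  have "((\<lambda>x. norm (f x)) has_integral 0) (cbox a b)"
    unfolding has_integral
  proof (intro allI impI)
    fix e :: real assume e: "e > 0"
    obtain \<gamma> where \<gamma>: "gauge \<gamma>" "\<And>p. \<lbrakk>p tagged_partial_division_of (cbox a b); \<gamma> fine p\<rbrakk> \<Longrightarrow>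
             sum (\<lambda>(x,k). norm(measure lborel k *\<^sub>R f x - integral k f)) p < e"
      by (rule Henstock_lemma[OF fi e], rule that)
    show "\<exists>\<gamma>. gauge \<gamma> \<and> (\<forall>\<D>. \<D> tagged_division_of cbox a b \<and> \<gamma> fine \<D> \<longrightarrow>
          norm ((\<Sum>(x,k)\<in>\<D>. measure lborel k *\<^sub>R norm (f x)) - 0) < e)"
    proof (intro exI[of _ \<gamma>] conjI \<gamma>(1) allI impI; elim conjE)
      fix \<D> assume D: "\<D> tagged_division_of cbox a b" "\<gamma> fine \<D>"
      have "(\<Sum>(x,k)\<in>\<D>. measure lborel k *\<^sub>R norm (f x)) = (\<Sum>(x,k)\<in>\<D>. norm (measure lborel k *\<^sub>R f x - integral k f))"
      proof (rule sum.cong[OF refl], clarify)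
        fix x K assume "(x, K) \<in> \<D>"
        obtain c d where "K = cbox c d" using tagged_division_ofD(4)[OF D(1) \<open>(x, K) \<in> \<D>\<close>] by blast
        moreover have "K \<subseteq> {a..b}" using tagged_division_ofD(3)[OF D(1) \<open>(x, K) \<in> \<D>\<close>] by simp
        ultimately have "integral K f = 0" by (rule 0)
        then show "measure lborel K *\<^sub>R norm (f x) = norm (measure lborel K *\<^sub>R f x - integral K f)" by simp
      qed
      moreover have "(\<Sum>(x,k)\<in>\<D>. norm (measure lborel k *\<^sub>R f x - integral k f)) < e"
        using D unfolding tagged_division_of_def by (intro \<gamma>(2)) simp_all
      moreover have "0 \<le> (\<Sum>(x,k)\<in>\<D>. norm (measure lborel k *\<^sub>R f x - integral k f))"
        by (intro sum_nonneg) auto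
      ultimately show "norm ((\<Sum>(x,k)\<in>\<D>. measure lborel k *\<^sub>R norm (f x)) - 0) < e" by simp
    qed
  qed
  then have i0: "integral {a..b} (\<lambda>x. norm (f x)) = 0" by (simp add: integral_unique)
  have i: "integrable (lebesgue_on {a<..<b}) (\<lambda>x. norm (f x))"
    using set_integrable_norm[OF f] unfolding absolutely_integrable_on_Icc_iff_Ioo
    by (simp add: integrable_restrict_space set_integrable_def)
  have "integral\<^sup>L (lebesgue_on {a<..<b}) (\<lambda>x. norm (f x)) = 0"
    using i0 by (subst lebesgue_integral_eq_integral[OF i]) (auto simp: integral_open_interval_real)
  then have "AE x in lebesgue_on {a<..<b}. norm (f x) = 0"
    using i by (subst (asm) integral_nonneg_eq_0_iff_AE) auto
  then show ?thesis by (subst (asm) AE_restrict_space_iff) auto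
qed

section \<open>From the boundary values of \<open>sol\<close> at 0 to the solutions normalised at
  0\<close>

lemma fund_linear:
  assumes q: "q absolutely_integrable_on {0..pi}" and x: "x \<in> {0..pi}"
  shows "fundu q c d z x = c * fundu q 1 0 z x + d * fundu q 0 1 z x"
proof -
  have z: "(\<lambda>x. 0::complex) absolutely_integrable_on {0..pi}" by simp
  have zz: "ivp (\<lambda>x. q x - z) (\<lambda>x. 0) (\<lambda>x. 0) (\<lambda>x. 0)" unfolding ivp_def by simp
  have "ivp (\<lambda>x. q x - z) (\<lambda>x. 0 + c * 0) (\<lambda>x. 0 + c * fundu q 1 0 z x) (\<lambda>x. 0 + c * fundv q 1 0 z x)"
    by (rule ivp_add_scale[OF zz fund_ivp(1)[OF q] shift_integrable[OF q] z z])
  then have "ivp (\<lambda>x. q x - z) (\<lambda>x. 0) (\<lambda>x. c * fundu q 1 0 z x) (\<lambda>x. c * fundv q 1 0 z x)"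
    by (simp only: mult_zero_right add_0_left)
  from ivp_add_scale[OF this fund_ivp(1)[OF q, where c = 0 and d = 1] shift_integrable[OF q] z z, of d]
  have "ivp (\<lambda>x. q x - z) (\<lambda>x. 0) (\<lambda>x. c * fundu q 1 0 z x + d * fundu q 0 1 z x) (\<lambda>x. c * fundv q 1 0 z x + d * fundv q 0 1 z x)"
    by (simp only: mult_zero_right add_0_left)
  from fund_unique(1)[OF q this x] show ?thesis by (simp add: fund_ivp[OF q])
qed

lemma fund_wronskian:
  assumes q: "q absolutely_integrable_on {0..pi}" and x: "x \<in> {0..pi}"
  shows "fundu q 1 0 z x * fundv q 0 1 z x - fundv q 1 0 z x * fundu q 0 1 z x = 1"
  using ivp_wronskian[OF shift_integrable[OF q] shift_integrable[OF q] 
    fund_ivp(1)[OF q, where c = 1 and d = 0 and z = z] fund_ivp(1)[OF q, where c = 0 and d = 1 and z = z] x]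
  by (simp add: fund_ivp[OF q])

text \<open>A zero of the cosine-type solution at x would give t (exp (t x) + exp (- t x)) <= 2 K
  exp (t x) on comparing both asymptotics, which is impossible for t > 2 K. It provides a point z at
  which division by this solution is allowed on the whole interval.\<close>

lemma cosine_solution_nonzero:
  assumes q: "q absolutely_integrable_on {0..pi}"
  obtains t0 where "t0 \<ge> 1" "\<And>t x. t \<ge> t0 \<Longrightarrow> x \<in> {0..pi} \<Longrightarrow> fundu q 1 0 (- (complex_of_real t)\<^sup>2) x \<noteq> 0"
proof (rule that[of "1 + 4 * pnorm q * exp (2 * pnorm q)"])
  define K where "K = 2 * pnorm q * exp (2 * pnorm q)"
  have K: "K \<ge> 0" using pnorm_nonneg[OF q] by (simp add: K_def)
  then show "1 \<le> 1 + 4 * pnorm q * exp (2 * pnorm q)" by (simp add: K_def)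
  fix t x assume t: "t \<ge> 1 + 4 * pnorm q * exp (2 * pnorm q)" and x: "x \<in> {0..pi}"
  then have t: "t \<ge> 1" "t > 2 * K" using K by (auto simp: K_def)
  define \<kappa> where "\<kappa> = complex_of_real t"
  have k: "norm \<kappa> \<ge> 1" "Re \<kappa> \<ge> 0" "norm \<kappa> = t" "Re \<kappa> = t" using t by (auto simp: \<kappa>_def)
  define u v where "u = fundu q 1 0 (- \<kappa>\<^sup>2) x" and "v = fundv q 1 0 (- \<kappa>\<^sup>2) x"
  have A: "norm (v + \<kappa> * u - exp (\<kappa> * of_real x) * \<kappa>) \<le> K * exp (t * x)"
    "norm (v - \<kappa> * u + exp (- \<kappa> * of_real x) * \<kappa>) \<le> K * exp (t * x)"
    using fund_growing[OF q k(1,2) x, of 1 0] fund_decaying[OF q k(1,2) x, of 1 0]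
    by (simp_all add: K_def u_def v_def k)
  show "fundu q 1 0 (- (complex_of_real t)\<^sup>2) x \<noteq> 0"
  proof
    assume "fundu q 1 0 (- (complex_of_real t)\<^sup>2) x = 0"
    then have "u = 0" by (simp add: u_def \<kappa>_def)
    then have "norm (exp (\<kappa> * of_real x) * \<kappa> + exp (- \<kappa> * of_real x) * \<kappa>) \<le> 2 * (K * exp (t * x))"
      using norm_triangle_ineq4[of "v + exp (- \<kappa> * of_real x) * \<kappa>" "v - exp (\<kappa> * of_real x) * \<kappa>"] A
      by (simp add: algebra_simps)
    moreover have "exp (\<kappa> * of_real x) * \<kappa> + exp (- \<kappa> * of_real x) * \<kappa> = of_real (exp (t * x) * t + exp (- t * x) * t)"
      by (simp add: \<kappa>_def exp_of_real[symmetric])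
    ultimately have "exp (t * x) * t + exp (- t * x) * t \<le> 2 * (K * exp (t * x))"
      using t by (simp only: norm_of_real)
    moreover have "exp (- t * x) * t \<ge> 0" using t by simp
    moreover have "(2 * K) * exp (t * x) < t * exp (t * x)" using t by (intro mult_strict_right_mono) auto
    ultimately show False by (simp add: mult_ac)
  qed
qed

text \<open>Here \<open>a\<close>, \<open>b\<close> are the cosine- and sine-type solutions of one
  potential and \<open>u\<close>, \<open>v\<close> the values at 0 of its \<open>sol\<close> and of
  the derivative, so \<open>u * a + v * b\<close> is \<open>sol\<close> itself. The right side thus
  pairs a decaying with a growing function.\<close>

lemma cross_identity:
  fixes u v u' v' a b a' b' :: complex
  assumes "u * v' = v * u'"
  shows "u * u' * (a * b' - a' * b) = u' * ((u * a + v * b) * b') - u * ((u' * a' + v' * b') * b)"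
  using assms by algebra

text \<open>In the region Re \<kappa> >= 1 the decay of \<open>sol\<close> cancels the growth of the
  sine-type solutions, which contribute the factor 1 / |\<kappa>|. Near the positive axis this
  argument gives nothing, but boundedness suffices there for Liouville's theorem; the constant is
  then found to be 0 along the negative axis.\<close>

lemma fund_cross_vanishes:
  fixes q q' :: "real \<Rightarrow> real"
  assumes q: "q absolutely_integrable_on {0<..<pi}" and q': "q' absolutely_integrable_on {0<..<pi}"
    and m: "\<And>z. sol q \<beta> z 0 * d1 (sol q' \<beta> z) 0 = d1 (sol q \<beta> z) 0 * sol q' \<beta> z 0"
    and x: "x \<in> {0..pi}"
  defines "p \<equiv> \<lambda>x. complex_of_real (q x)" and "p' \<equiv> \<lambda>x. complex_of_real (q' x)"
  shows "fundu p 1 0 z x * fundu p' 0 1 z x = fundu p' 1 0 z x * fundu p 0 1 z x"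
proof -
  have p: "p absolutely_integrable_on {0..pi}" and p': "p' absolutely_integrable_on {0..pi}"
    unfolding p_def p'_def by (intro qc_integrable q q')+
  define F where "F = (\<lambda>z. fundu p 1 0 z x * fundu p' 0 1 z x - fundu p' 1 0 z x * fundu p 0 1 z x)"
  have hol: "F holomorphic_on UNIV"
    unfolding F_def by (intro holomorphic_intros fund_holomorphic p p' x)
  obtain k1 C1 where k1: "k1 \<ge> 1" "C1 \<ge> 0" "\<And>\<kappa>. norm \<kappa> \<ge> k1 \<Longrightarrow> Re \<kappa> \<ge> 1 \<Longrightarrow> sol q \<beta> (- \<kappa>\<^sup>2) 0 \<noteq> 0"
    "\<And>\<kappa> x. norm \<kappa> \<ge> k1 \<Longrightarrow> Re \<kappa> \<ge> 1 \<Longrightarrow> x \<in> {0..pi} \<Longrightarrow>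
       norm (sol q \<beta> (- \<kappa>\<^sup>2) x) \<le> C1 * exp (- Re \<kappa> * x) * norm (sol q \<beta> (- \<kappa>\<^sup>2) 0)"
    by (rule sol_asymptotics[OF q, of \<beta>], rule that)
  obtain k2 C2 where k2: "k2 \<ge> 1" "C2 \<ge> 0" "\<And>\<kappa>. norm \<kappa> \<ge> k2 \<Longrightarrow> Re \<kappa> \<ge> 1 \<Longrightarrow> sol q' \<beta> (- \<kappa>\<^sup>2) 0 \<noteq> 0"
    "\<And>\<kappa> x. norm \<kappa> \<ge> k2 \<Longrightarrow> Re \<kappa> \<ge> 1 \<Longrightarrow> x \<in> {0..pi} \<Longrightarrow>
       norm (sol q' \<beta> (- \<kappa>\<^sup>2) x) \<le> C2 * exp (- Re \<kappa> * x) * norm (sol q' \<beta> (- \<kappa>\<^sup>2) 0)"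
    by (rule sol_asymptotics[OF q', of \<beta>], rule that)
  define k0 where "k0 = max k1 k2"
  define L L' where "L = 2 * exp (2 * pnorm p)" and "L' = 2 * exp (2 * pnorm p')"
  have L: "L \<ge> 0" "L' \<ge> 0" by (auto simp: L_def L'_def)
  have up: "norm (fundu p 1 0 (- \<kappa>\<^sup>2) x) \<le> L * exp (Re \<kappa> * x)" "norm (fundu p 0 1 (- \<kappa>\<^sup>2) x) \<le> L / norm \<kappa> * exp (Re \<kappa> * x)"
    "norm (fundu p' 1 0 (- \<kappa>\<^sup>2) x) \<le> L' * exp (Re \<kappa> * x)" "norm (fundu p' 0 1 (- \<kappa>\<^sup>2) x) \<le> L' / norm \<kappa> * exp (Re \<kappa> * x)"
    if "norm \<kappa> \<ge> 1" "Re \<kappa> \<ge> 0" for \<kappa>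
    using fundu_upper[OF p that x, of 1 0] fundu_upper[OF p that x, of 0 1] fundu_upper[OF p' that x, of 1 0] fundu_upper[OF p' that x, of 0 1]
    by (simp_all add: L_def L'_def)
  have far: "norm (F (- \<kappa>\<^sup>2)) \<le> (C1 * L' + C2 * L) / norm \<kappa>" if k: "norm \<kappa> \<ge> k0" "Re \<kappa> \<ge> 1" for \<kappa>
  proof -
    have kk: "norm \<kappa> \<ge> k1" "norm \<kappa> \<ge> k2" "norm \<kappa> \<ge> 1" "Re \<kappa> \<ge> 0" using k k1(1) by (auto simp: k0_def)
    define z where "z = - \<kappa>\<^sup>2"
    define u0 v0 u0' v0' where "u0 = sol q \<beta> z 0" "v0 = d1 (sol q \<beta> z) 0" "u0' = sol q' \<beta> z 0" "v0' = d1 (sol q' \<beta> z) 0"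
    note d = this
    have nz: "u0 \<noteq> 0" "u0' \<noteq> 0" using k1(3)[OF kk(1) k(2)] k2(3)[OF kk(2) k(2)] by (auto simp: d z_def)
    have iq: "ivp (\<lambda>x. p x - z) (\<lambda>x. 0) (sol q \<beta> z) (d1 (sol q \<beta> z))" "ivp (\<lambda>x. p' x - z) (\<lambda>x. 0) (sol q' \<beta> z) (d1 (sol q' \<beta> z))"
      unfolding p_def p'_def by (rule sol_ivp q q')+
    have s: "sol q \<beta> z x = u0 * fundu p 1 0 z x + v0 * fundu p 0 1 z x"
      unfolding d by (rule trans[OF fund_unique(1)[OF p iq(1) x] fund_linear[OF p x]])
    have s': "sol q' \<beta> z x = u0' * fundu p' 1 0 z x + v0' * fundu p' 0 1 z x"
      unfolding d by (rule trans[OF fund_unique(1)[OF p' iq(2) x] fund_linear[OF p' x]])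
    have "u0 * v0' = v0 * u0'" unfolding d by (rule m)
    then have "u0 * u0' * F z = u0' * (sol q \<beta> z x * fundu p' 0 1 z x) - u0 * (sol q' \<beta> z x * fundu p 0 1 z x)"
      unfolding F_def s s' by (rule cross_identity)
    then have "norm u0 * norm u0' * norm (F z) \<le> norm u0' * (norm (sol q \<beta> z x) * norm (fundu p' 0 1 z x)) + norm u0 * (norm (sol q' \<beta> z x) * norm (fundu p 0 1 z x))"
      by (metis norm_mult norm_triangle_ineq4)
    also have "\<dots> \<le> norm u0' * ((C1 * exp (- Re \<kappa> * x) * norm u0) * (L' / norm \<kappa> * exp (Re \<kappa> * x))) +
        norm u0 * ((C2 * exp (- Re \<kappa> * x) * norm u0') * (L / norm \<kappa> * exp (Re \<kappa> * x)))"
      using k1(4)[OF kk(1) k(2) x] k2(4)[OF kk(2) k(2) x] up[OF kk(3,4)] k1(2) k2(2)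
      by (intro add_mono mult_left_mono mult_mono) (auto simp: d z_def)
    also have "\<dots> = norm u0 * norm u0' * ((C1 * L' + C2 * L) / norm \<kappa>)"
      by (simp add: exp_minus add_divide_distrib[symmetric] field_simps)
    finally show ?thesis unfolding z_def by (rule mult_left_le_imp_le) (use nz in simp)
  qed
  have "bounded (range F)"
  proof -
    obtain B where B: "\<And>z. norm z \<le> k0\<^sup>2 \<Longrightarrow> norm (F z) \<le> B"
    proof -
      have "continuous_on (cball 0 (k0\<^sup>2)) F" using hol holomorphic_on_imp_continuous_on continuous_on_subset by blast
      from compact_imp_bounded[OF compact_continuous_image[OF this compact_cball]]
      obtain B where "\<forall>w\<in>F ` cball 0 (k0\<^sup>2). norm w \<le> B" unfolding bounded_iff by blast
      then show ?thesis by (intro that[of B]) auto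
    qed
    have "norm (F z) \<le> max B (max (C1 * L' + C2 * L) (2 * (L * L' * exp pi * exp pi)))" for z
    proof -
      define \<kappa> where "\<kappa> = csqrt (- z)"
      have z: "z = - \<kappa>\<^sup>2" and Re0: "Re \<kappa> \<ge> 0" using Re_csqrt[of "- z"] by (auto simp: \<kappa>_def)
      \<comment> \<open>A compact disc, the region of decay, and the strip Re \<kappa> <= 1, where
        every exponential is at most exp pi.\<close>
      consider "norm \<kappa> \<le> k0" | "norm \<kappa> \<ge> k0" "Re \<kappa> \<ge> 1" | "norm \<kappa> \<ge> k0" "Re \<kappa> \<le> 1" by linarith
      then show ?thesis
      proof cases
        case 1
        then have "norm z \<le> k0\<^sup>2" by (simp add: z norm_power power_mono)
        then show ?thesis using B[of z] by simp
      next
        case 2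
        have "(C1 * L' + C2 * L) / norm \<kappa> \<le> (C1 * L' + C2 * L) / 1"
          using 2 k1 k2 L by (intro divide_left_mono) (auto simp: k0_def)
        then show ?thesis using far[OF 2] by (simp add: z)
      next
        case 3
        have k: "norm \<kappa> \<ge> 1" using 3 k1 by (simp add: k0_def)
        have e: "exp (Re \<kappa> * x) \<le> exp pi" using 3 x Re0 mult_mono[of "Re \<kappa>" 1 x pi] by simp
        have l: "L / norm \<kappa> \<le> L" "L' / norm \<kappa> \<le> L'" using k L by (auto simp: divide_le_eq mult_le_cancel_left1)
        have "norm (F z) \<le> norm (fundu p 1 0 z x) * norm (fundu p' 0 1 z x) + norm (fundu p' 1 0 z x) * norm (fundu p 0 1 z x)"
          unfolding F_def by (metis norm_mult norm_triangle_ineq4)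
        also have "\<dots> \<le> (L * exp pi) * (L' * exp pi) + (L' * exp pi) * (L * exp pi)"
        proof -
          have "norm (fundu p 1 0 z x) \<le> L * exp pi" "norm (fundu p' 1 0 z x) \<le> L' * exp pi"
            "norm (fundu p 0 1 z x) \<le> L * exp pi" "norm (fundu p' 0 1 z x) \<le> L' * exp pi"
            unfolding z using L l e
            by (auto intro!: order_trans[OF up(1)[OF k Re0]] order_trans[OF up(2)[OF k Re0]]
                order_trans[OF up(3)[OF k Re0]] order_trans[OF up(4)[OF k Re0]] mult_mono simp del: times_divide_eq_left)
          then show ?thesis using L by (intro add_mono mult_mono) auto
        qed
        finally show ?thesis by (simp add: mult_ac)
      qed
    qed
    then show ?thesis unfolding bounded_iff by blast
  qed
  from Liouville_theorem[OF hol this] obtain c where c: "\<And>z. F z = c" by (auto simp: constant_on_def)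
  have "c = 0"
  proof (rule ccontr)
    assume "c \<noteq> 0"
    define D where "D = C1 * L' + C2 * L"
    have D: "D \<ge> 0" using k1 k2 L by (simp add: D_def)
    define t where "t = max k0 ((D + 1) / norm c)"
    have t0: "t \<ge> k0" "(D + 1) / norm c \<le> t" by (auto simp: t_def)
    then have t: "t \<ge> k0" "t \<ge> 1" "t * norm c \<ge> D + 1"
      using k1(1) \<open>c \<noteq> 0\<close> by (auto simp: k0_def divide_le_eq)
    have "norm (F (- (complex_of_real t)\<^sup>2)) \<le> D / norm (complex_of_real t)"
      unfolding D_def by (rule far) (use t in auto)
    then have "norm c * t \<le> D" using t by (simp add: c field_simps)
    then show False using t by (simp add: mult.commute)
  qed
  then show ?thesis using c[of z] by (simp add: F_def)
qed

lemma quotient_has_vector_derivative: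
  fixes f g :: "real \<Rightarrow> complex"
  assumes f: "(f has_vector_derivative f') (at x within S)" and g: "(g has_vector_derivative g') (at x within S)" and "g x \<noteq> 0"
  shows "((\<lambda>x. f x / g x) has_vector_derivative (f' * g x - f x * g') / (g x)\<^sup>2) (at x within S)"
  using f g assms(3) unfolding has_vector_derivative_def
  by (auto intro!: derivative_eq_intros simp: fun_eq_iff field_simps power2_eq_square scaleR_conv_of_real)

theorem borg_marchenko:
  fixes q q' :: "real \<Rightarrow> real"
  assumes q: "q absolutely_integrable_on {0<..<pi}" and q': "q' absolutely_integrable_on {0<..<pi}"
    and m: "\<And>z. sol q \<beta> z 0 * d1 (sol q' \<beta> z) 0 = d1 (sol q \<beta> z) 0 * sol q' \<beta> z 0"
  shows "AE x\<in>{0<..<pi} in lebesgue. q' x = q x"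
proof -
  define p p' where "p = (\<lambda>x. complex_of_real (q x))" and "p' = (\<lambda>x. complex_of_real (q' x))"
  have p: "p absolutely_integrable_on {0..pi}" and p': "p' absolutely_integrable_on {0..pi}"
    unfolding p_def p'_def by (intro qc_integrable q q')+
  obtain t1 where t1: "t1 \<ge> 1" "\<And>t x. t \<ge> t1 \<Longrightarrow> x \<in> {0..pi} \<Longrightarrow> fundu p 1 0 (- (complex_of_real t)\<^sup>2) x \<noteq> 0"
    by (rule cosine_solution_nonzero[OF p], rule that)
  obtain t2 where t2: "t2 \<ge> 1" "\<And>t x. t \<ge> t2 \<Longrightarrow> x \<in> {0..pi} \<Longrightarrow> fundu p' 1 0 (- (complex_of_real t)\<^sup>2) x \<noteq> 0"
    by (rule cosine_solution_nonzero[OF p'], rule that)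
  define z where "z = - (complex_of_real (max t1 t2))\<^sup>2"
  define \<theta> \<phi> \<theta>' \<phi>' where "\<theta> = fundu p 1 0 z" "\<phi> = fundu p 0 1 z" "\<theta>' = fundu p' 1 0 z" "\<phi>' = fundu p' 0 1 z"
  note d = this
  have nz: "\<theta> x \<noteq> 0" "\<theta>' x \<noteq> 0" if "x \<in> {0..pi}" for x
    using t1(2)[OF _ that] t2(2)[OF _ that] by (auto simp: d z_def)
  have quot: "\<phi> x / \<theta> x = \<phi>' x / \<theta>' x" if "x \<in> {0..pi}" for x
    using fund_cross_vanishes[OF q q' m that, of z, folded p_def p'_def] nz[OF that] by (simp add: d field_simps)
  \<comment> \<open>By the quotient rule the numerator is a Wronskian, which is constantly
    1.\<close>
  have der: "((\<lambda>x. \<phi> x / \<theta> x) has_vector_derivative 1 / (\<theta> x)\<^sup>2) (at x within {0..pi})"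
    "((\<lambda>x. \<phi>' x / \<theta>' x) has_vector_derivative 1 / (\<theta>' x)\<^sup>2) (at x within {0..pi})" if x: "x \<in> {0..pi}" for x
    using quotient_has_vector_derivative[OF ivp_deriv[OF fund_ivp(1)[OF p, where z = z and c = 0 and d = 1] x] ivp_deriv[OF fund_ivp(1)[OF p, where z = z and c = 1 and d = 0] x]]
      quotient_has_vector_derivative[OF ivp_deriv[OF fund_ivp(1)[OF p', where z = z and c = 0 and d = 1] x] ivp_deriv[OF fund_ivp(1)[OF p', where z = z and c = 1 and d = 0] x]]
      fund_wronskian[OF p x, of z] fund_wronskian[OF p' x, of z] nz[OF x]
    by (simp_all add: d mult.commute)
  have sq: "(\<theta> x)\<^sup>2 = (\<theta>' x)\<^sup>2" if x: "x \<in> {0..pi}" for x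
  proof -
    have "((\<lambda>x. \<phi> x / \<theta> x) has_vector_derivative 1 / (\<theta>' x)\<^sup>2) (at x within {0..pi})"
      by (rule has_vector_derivative_transform[OF x _ der(2)[OF x]]) (use quot in auto)
    from d1_eq[OF this x] d1_eq[OF der(1)[OF x] x] have "1 / (\<theta> x)\<^sup>2 = 1 / (\<theta>' x)\<^sup>2" by simp
    then show ?thesis by simp
  qed
  have c: "continuous_on {0..pi} \<theta>" "continuous_on {0..pi} \<theta>'"
    unfolding d by (rule ivp_cont1[OF fund_ivp(1)[OF p]] ivp_cont1[OF fund_ivp(1)[OF p']])+
  \<comment> \<open>Equality of the squares leaves a sign. The quotient is continuous with values 1
    and -1 on a connected set, and both solutions equal 1 at 0.\<close>
  have "(\<lambda>x. \<theta> x / \<theta>' x) constant_on {0..pi}"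
  proof (rule continuous_finite_range_constant)
    show "continuous_on {0..pi} (\<lambda>x. \<theta> x / \<theta>' x)" using nz by (intro continuous_intros c) auto
    have "\<theta> x / \<theta>' x \<in> {1, -1}" if "x \<in> {0..pi}" for x
      using sq[OF that] nz[OF that] by (auto simp: power2_eq_iff)
    then have "(\<lambda>x. \<theta> x / \<theta>' x) ` {0..pi} \<subseteq> {1, -1}" by blast
    then show "finite ((\<lambda>x. \<theta> x / \<theta>' x) ` {0..pi})" by (rule finite_subset) simp
  qed auto
  then obtain k where k: "\<And>x. x \<in> {0..pi} \<Longrightarrow> \<theta> x / \<theta>' x = k" by (auto simp: constant_on_def)
  have "k = 1" using k[of 0] by (simp add: d fund_ivp[OF p] fund_ivp[OF p'])
  then have eq: "\<theta> x = \<theta>' x" if "x \<in> {0..pi}" for x using k[OF that] nz[OF that] by simp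
  define v v' where "v = fundv p 1 0 z" and "v' = fundv p' 1 0 z"
  have iv: "ivp (\<lambda>x. p x - z) (\<lambda>x. 0) \<theta> v" "ivp (\<lambda>x. p' x - z) (\<lambda>x. 0) \<theta>' v'"
    unfolding d v_def v'_def by (rule fund_ivp[OF p] fund_ivp[OF p'])+
  have veq: "v x = v' x" if x: "x \<in> {0..pi}" for x
  proof -
    have "(\<theta> has_vector_derivative v' x) (at x within {0..pi})"
      by (rule has_vector_derivative_transform[OF x _ ivp_deriv[OF iv(2) x]]) (use eq in auto)
    from d1_eq[OF this x] d1_eq[OF ivp_deriv[OF iv(1) x] x] show ?thesis by simp
  qed
  have i: "(\<lambda>t. (p t - z) * \<theta> t) absolutely_integrable_on {0..pi}" "(\<lambda>t. (p' t - z) * \<theta>' t) absolutely_integrable_on {0..pi}"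
    by (intro absolutely_integrable_mult_continuous shift_integrable p p' c)+
  \<comment> \<open>Now one and the same function solves both equations, so the difference of the
    right-hand sides, which is (p - p') \<theta> on the interval, has vanishing indefinite integral;
    \<theta> has no zeros.\<close>
  define f where "f = (\<lambda>t. (p t - z) * \<theta> t - (p' t - z) * \<theta>' t)"
  have f: "f absolutely_integrable_on {0..pi}" unfolding f_def using i by (rule set_integral_diff(1))
  have "integral {0..x} f = 0" if x: "x \<in> {0..pi}" for x
  proof -
    have "integral {0..x} f = integral {0..x} (\<lambda>t. (p t - z) * \<theta> t) - integral {0..x} (\<lambda>t. (p' t - z) * \<theta>' t)"
      unfolding f_def using absolutely_integrable_sub[OF i(1), of 0 x] absolutely_integrable_sub[OF i(2), of 0 x] x
      by (intro Henstock_Kurzweil_Integration.integral_diff) (auto simp: absolutely_integrable_on_def)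
    also have "\<dots> = (v x - v 0) - (v' x - v' 0)"
      using ivp_integral[OF iv(1) x] ivp_integral[OF iv(2) x] by (simp only: add_0_right) simp
    also have "\<dots> = 0" using veq[OF x] veq[of 0] by simp
    finally show ?thesis .
  qed
  from indefinite_integral_zero_imp_AE_zero[OF f this]
  have "AE x\<in>{0<..<pi} in lebesgue. f x = 0" .
  then show ?thesis
  proof eventually_elim
    case (elim x)
    show ?case
    proof
      assume x: "x \<in> {0<..<pi}"
      then have "(p x - p' x) * \<theta> x = 0" using elim eq[of x] by (simp add: f_def algebra_simps)
      then have "p x = p' x" using nz(1)[of x] x by simp
      then show "q' x = q x" by (simp add: p_def p'_def)
    qed
  qed
qed

section \<open>Entire functions and products over disjoint intervals\<close>

text \<open>The second difference of the sequence is the constant 2 c2, and once c2 = 0 the first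
  difference is constant too. Sampling at integers suffices, so decay needs to be known only along -
  n.\<close>

lemma constant_if_tendsto_quadratic:
  fixes c0 c1 c2 :: complex
  assumes "(\<lambda>n. c0 - c1 * of_nat n + c2 * (of_nat n)\<^sup>2) \<longlonglongrightarrow> 0"
  shows "c0 = 0" "c1 = 0" "c2 = 0"
proof -
  let ?g = "\<lambda>n::nat. c0 - c1 * of_nat n + c2 * (of_nat n)\<^sup>2"
  have s1: "(\<lambda>n. ?g (n + 1)) \<longlonglongrightarrow> 0" and s2: "(\<lambda>n. ?g (n + 2)) \<longlonglongrightarrow> 0"
    using assms by (rule LIMSEQ_ignore_initial_segment)+
  have "(\<lambda>n. ?g (n + 2) - 2 * ?g (n + 1) + ?g n) \<longlonglongrightarrow> 0 - 2 * 0 + 0"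
    by (intro tendsto_intros s1 s2 assms)
  moreover have "(\<lambda>n. ?g (n + 2) - 2 * ?g (n + 1) + ?g n) = (\<lambda>n. 2 * c2)"
    by (simp add: fun_eq_iff power2_eq_square algebra_simps)
  ultimately show c2: "c2 = 0" by (simp add: LIMSEQ_const_iff)
  have "(\<lambda>n. ?g n - ?g (n + 1)) \<longlonglongrightarrow> 0 - 0" by (intro tendsto_diff s1 assms)
  moreover have "(\<lambda>n. ?g n - ?g (n + 1)) = (\<lambda>n. c1)" by (simp add: c2 fun_eq_iff algebra_simps)
  ultimately show c1: "c1 = 0" by (simp add: LIMSEQ_const_iff)
  show "c0 = 0" using assms by (simp add: c1 c2 LIMSEQ_const_iff)
qed

text \<open>On \<open>\<bar>w\<bar> = \<rho>\<close> one has \<open>\<bar>w\<^sup>2 - \<rho>\<^sup>2\<bar> = 2 \<rho> \<bar>Im w\<bar>\<close>, so the factor \<open>(w\<^sup>2 - \<rho>\<^sup>2)\<^sup>3\<close>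
  compensates the singularity of the bound at the real axis.\<close>

lemma entire_off_axis_growth_zero:
  assumes hol: "G holomorphic_on UNIV"
    and bd: "\<And>z. Im z \<noteq> 0 \<Longrightarrow> norm (G z) * \<bar>Im z\<bar> ^ 3 \<le> C * (1 + norm z) ^ 5"
    and lim: "(\<lambda>n. G (- of_nat n)) \<longlonglongrightarrow> 0"
  shows "G z = 0"
proof -
  have C: "C \<ge> 0"
  proof -
    have "0 \<le> norm (G \<i>) * \<bar>Im \<i>\<bar> ^ 3" by simp
    also have "\<dots> \<le> C * (1 + norm \<i>) ^ 5" by (rule bd) simp
    finally show ?thesis by (simp add: zero_le_mult_iff)
  qed
  define B where "B = 3 ^ 5 * C * 64"
  have main: "norm (G z) \<le> B * norm z ^ 2" if z: "1 \<le> norm z" for z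
  proof -
    \<comment> \<open>Doubling the radius keeps |z^2 - \<rho>^2| >= 3 |z|^2 >= \<rho>^2 / 2 at the
      point z. The maximum principle then gives a bound of order \<rho>^3 \<rho>^5 / \<rho>^6, that
      is, quadratic growth.\<close>
    define \<rho> where "\<rho> = 2 * norm z"
    have \<rho>: "\<rho> \<ge> 2" using z by (simp add: \<rho>_def)
    define F where "F = (\<lambda>w. (w\<^sup>2 - (of_real \<rho>)\<^sup>2) ^ 3 * G w)"
    have holF: "F holomorphic_on UNIV" unfolding F_def by (intro holomorphic_intros hol)
    have circ: "norm (F w) \<le> 8 * \<rho> ^ 3 * (C * (1 + \<rho>) ^ 5)" if w: "norm w = \<rho>" for w
    proof (cases "Im w = 0")
      case False
      have "(complex_of_real \<rho>)\<^sup>2 = w * cnj w" using complex_norm_square[of w] w by simp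
      then have "w\<^sup>2 - (of_real \<rho>)\<^sup>2 = w * (2 * of_real (Im w) * \<i>)"
        by (simp add: power2_eq_square right_diff_distrib[symmetric] complex_diff_cnj)
      then have n: "norm (w\<^sup>2 - (of_real \<rho>)\<^sup>2) = \<rho> * (2 * \<bar>Im w\<bar>)" by (simp add: norm_mult w)
      have "norm (F w) = 8 * \<rho> ^ 3 * (norm (G w) * \<bar>Im w\<bar> ^ 3)"
        by (simp add: F_def norm_mult norm_power n power_mult_distrib)
      also have "\<dots> \<le> 8 * \<rho> ^ 3 * (C * (1 + \<rho>) ^ 5)"
        using bd[OF False] \<rho> w by (intro mult_left_mono) auto
      finally show ?thesis .
    next
      case True
      have w': "w = of_real (Re w)" using True by (simp add: complex_eq_iff)
      have "(norm w)\<^sup>2 = (Re w)\<^sup>2" using True by (simp add: cmod_power2)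
      then have "(Re w)\<^sup>2 = \<rho>\<^sup>2" using w by simp
      then have "w\<^sup>2 = (of_real \<rho>)\<^sup>2" by (subst w') (simp flip: of_real_power)
      then show ?thesis using C \<rho> by (simp add: F_def)
    qed
    have "norm (F z) \<le> 8 * \<rho> ^ 3 * (C * (1 + \<rho>) ^ 5)"
    proof (rule maximum_modulus_frontier[where S = "cball 0 \<rho>" and f = F and \<xi> = z])
      show "F holomorphic_on interior (cball 0 \<rho>)" using holF holomorphic_on_subset by blast
      show "continuous_on (closure (cball 0 \<rho>)) F"
        using holF holomorphic_on_imp_continuous_on continuous_on_subset by blast
      show "norm (F w) \<le> 8 * \<rho> ^ 3 * (C * (1 + \<rho>) ^ 5)" if "w \<in> frontier (cball 0 \<rho>)" for w
        using that \<rho> by (intro circ) (simp add: frontier_cball)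
      show "z \<in> cball 0 \<rho>" by (simp add: \<rho>_def)
    qed auto
    moreover have "\<rho>\<^sup>2 / 2 \<le> norm (z\<^sup>2 - (of_real \<rho>)\<^sup>2)"
    proof -
      have "norm (z\<^sup>2 - (of_real \<rho>)\<^sup>2) \<ge> \<rho>\<^sup>2 - (norm z)\<^sup>2"
        using norm_triangle_ineq2[of "(of_real \<rho>)\<^sup>2" "z\<^sup>2"] \<rho> by (simp add: norm_power norm_minus_commute)
      moreover have "\<rho>\<^sup>2 = 4 * (norm z)\<^sup>2" by (simp add: \<rho>_def power_mult_distrib)
      moreover have "0 \<le> (norm z)\<^sup>2" by simp
      ultimately show ?thesis by linarith
    qed
    then have "(\<rho>\<^sup>2 / 2) ^ 3 * norm (G z) \<le> norm (F z)"
      unfolding F_def norm_mult norm_power by (intro mult_right_mono power_mono) auto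
    ultimately have "(\<rho>\<^sup>2 / 2) ^ 3 * norm (G z) \<le> 8 * \<rho> ^ 3 * (C * (1 + \<rho>) ^ 5)" by linarith
    also have "\<dots> \<le> 8 * \<rho> ^ 3 * (C * ((3 / 2) * \<rho>) ^ 5)"
      using C \<rho> by (intro mult_left_mono power_mono) auto
    also have "\<dots> = (\<rho>\<^sup>2 / 2) ^ 3 * (64 * C * (3 / 2) ^ 5 * \<rho> ^ 2)"
      by (simp add: power_mult_distrib power_divide algebra_simps flip: power_mult power_add)
    finally have "norm (G z) \<le> 64 * C * (3 / 2) ^ 5 * \<rho> ^ 2"
      using \<rho> by (subst (asm) mult_le_cancel_left_pos) auto
    also have "\<dots> = (64 * C * (3 / 2) ^ 5 * 4) * norm z ^ 2" by (simp add: \<rho>_def power_mult_distrib)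
    also have "\<dots> \<le> B * norm z ^ 2" using C by (intro mult_right_mono) (simp_all add: B_def power_divide)
    finally show ?thesis .
  qed
  define c where "c = (\<lambda>k. (deriv^^k) G 0 / fact k)"
  have poly: "G w = c 0 + c 1 * w + c 2 * w\<^sup>2" for w
    using Liouville_polynomial[OF hol main, where \<xi> = w] by (simp add: c_def eval_nat_numeral)
  have "(\<lambda>n. c 0 - c 1 * of_nat n + c 2 * (of_nat n)\<^sup>2) \<longlonglongrightarrow> 0"
    using lim unfolding poly by simp
  from constant_if_tendsto_quadratic[OF this] show ?thesis by (simp add: poly)
qed

text \<open>The values leave every ball, so only finitely many lie near a given point. The index set
  is arbitrary because closedness is also needed for the set of poles with one pole removed.\<close>

lemma locally_finite_image_closed:
  fixes f :: "nat \<Rightarrow> 'a::real_normed_vector"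
  assumes "filterlim (\<lambda>n. norm (f n)) at_top sequentially"
  shows "closed (f ` X)"
proof -
  have fin: "finite {n. norm (f n) \<le> r}" for r
  proof -
    obtain N where "\<And>n. n \<ge> N \<Longrightarrow> norm (f n) > r"
      using filterlim_at_top_dense[THEN iffD1, OF assms, rule_format, of r] by (auto simp: eventually_sequentially)
    then have "{n. norm (f n) \<le> r} \<subseteq> {..<N}" by (force simp: not_less[symmetric])
    then show ?thesis using finite_subset by blast
  qed
  have "open (- (f ` X))"
  proof (rule openI)
    fix z assume z: "z \<in> - (f ` X)"
    let ?F = "f ` {n \<in> X. norm (f n) \<le> norm z + 1}"
    have "finite ?F" by (rule finite_imageI) (rule finite_subset[OF _ fin[of "norm z + 1"]], auto)
    then have "open (ball z 1 - ?F)" by (intro open_Diff finite_imp_closed) auto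
    moreover have "z \<in> ball z 1 - ?F" using z by auto
    ultimately obtain e where e: "e > 0" "ball z e \<subseteq> ball z 1 - ?F" using open_contains_ball by blast
    have "ball z e \<subseteq> - (f ` X)"
    proof
      fix w assume w: "w \<in> ball z e"
      then have "w \<in> ball z 1" "w \<notin> ?F" using e by auto
      moreover have "norm w \<le> norm z + 1"
        using \<open>w \<in> ball z 1\<close> norm_triangle_sub[of w z] by (simp add: dist_norm norm_minus_commute)
      ultimately show "w \<in> - (f ` X)" by auto
    qed
    then show "\<exists>e>0. ball z e \<subseteq> - (f ` X)" using e by blast
  qed
  then show ?thesis by (simp add: closed_def)
qed

text \<open>Closedness of \<open>T - {p}\<close> isolates \<open>p\<close>, where Riemann's
  criterion yields a local extension. It agrees with \<open>remove_sings H\<close>, which therefore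
  is one global extension.\<close>

lemma removable_discrete_extension:
  assumes H: "H holomorphic_on - T" and T: "closed T" "\<And>p. p \<in> T \<Longrightarrow> closed (T - {p})"
    and lim: "\<And>p. p \<in> T \<Longrightarrow> ((\<lambda>z. (z - p) * H z) \<longlongrightarrow> 0) (at p)"
  obtains G where "G holomorphic_on UNIV" "\<And>z. z \<notin> T \<Longrightarrow> G z = H z"
proof -
  let ?G = "remove_sings H"
  have eq: "?G z = H z" if "z \<notin> T" for z
    by (intro remove_sings_at_analytic) (use that T H in \<open>auto simp: analytic_at intro!: exI[of _ "- T"]\<close>)
  have "\<exists>s. open s \<and> z \<in> s \<and> ?G holomorphic_on s" for z
  proof (cases "z \<in> T")
    case False
    have "?G holomorphic_on - T" using H by (rule holomorphic_transform) (use eq in auto)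
    then show ?thesis using False T by (intro exI[of _ "- T"]) auto
  next
    case True
    let ?S = "- (T - {z})"
    have S: "open ?S" "z \<in> ?S" using T(2)[OF True] unfolding closed_def by auto
    have "H holomorphic_on ?S - {z}" using H by (rule holomorphic_on_subset) (use True in auto)
    from holomorphic_on_extend_lim[OF this] S lim[OF True]
    obtain g where g: "g holomorphic_on ?S" "\<And>w. w \<in> ?S - {z} \<Longrightarrow> g w = H w" by (auto simp: interior_open)
    have "isCont g z" using holomorphic_on_imp_continuous_on[OF g(1)] S continuous_on_eq_continuous_at by blast
    then have "(g \<longlongrightarrow> g z) (at z)" by (simp add: isCont_def)
    then have "(H \<longlongrightarrow> g z) (at z)"
      by (rule Lim_transform_within_open[OF _ S]) (use g(2) in auto)
    then have "?G z = g z" by (rule remove_sings_eqI)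
    then have "?G holomorphic_on ?S"
      using g by (intro holomorphic_transform[OF g(1)]) (metis Compl_iff Diff_iff eq singletonD)
    then show ?thesis using S by blast
  qed
  then have "?G holomorphic_on UNIV"
    by (metis UNIV_I analytic_at analytic_on_analytic_at analytic_imp_holomorphic)
  then show ?thesis using that eq by blast
qed

section \<open>Products of quotients over disjoint intervals\<close>

lemma prod_ratio_telescope:
  fixes X Y :: "nat \<Rightarrow> real"
  assumes "c > 0" "\<And>n. c \<le> X n" "\<And>n. X n \<le> Y n" "\<And>n. Y (Suc n) \<le> X n"
  shows "(\<Prod>n<k. Y n / X n) \<le> Y 0 / c"
proof (cases k)
  case 0
  then show ?thesis using assms(1) order_trans[OF assms(2)[of 0] assms(3)[of 0]] by simp
next
  case (Suc j)
  have pos: "X n > 0" "Y n > 0" for n using assms(1) assms(2)[of n] assms(3)[of n] by linarith+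
  have "(\<Prod>n<Suc j. Y n / X n) \<le> Y 0 / X j"
  proof (induction j)
    case (Suc j)
    have "(\<Prod>n<Suc (Suc j). Y n / X n) \<le> Y 0 / X j * (Y (Suc j) / X (Suc j))"
      by (subst prod.lessThan_Suc) (intro mult_right_mono Suc.IH divide_nonneg_nonneg less_imp_le pos)
    also have "\<dots> \<le> Y 0 / X j * (X j / X (Suc j))"
      using pos assms(4) by (intro mult_left_mono divide_right_mono) (auto intro: less_imp_le)
    also have "\<dots> = Y 0 / X (Suc j)" using pos[of j] by simp
    finally show ?case .
  qed simp
  also have "\<dots> \<le> Y 0 / c" using pos assms(1,2) by (intro divide_left_mono) (auto intro: less_imp_le)
  finally show ?thesis using Suc by simp
qed

text \<open>The square of |1 - z s| is a quadratic polynomial in the real variable s with vertex Re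
  z / |z|^2, so it increases with the distance from the vertex.\<close>

lemma norm_one_minus_mult_mono:
  fixes z :: complex and s t :: real
  assumes "z \<noteq> 0" "\<bar>s - Re z / (norm z)\<^sup>2\<bar> \<le> \<bar>t - Re z / (norm z)\<^sup>2\<bar>"
  shows "norm (1 - z * of_real s) \<le> norm (1 - z * of_real t)"
proof -
  define m where "m = Re z / (norm z)\<^sup>2"
  have nz: "(norm z)\<^sup>2 > 0" using assms by simp
  have eq: "(norm (1 - z * of_real r))\<^sup>2 = (norm z)\<^sup>2 * (r - m)\<^sup>2 + (1 - Re z * m)" for r
  proof -
    have m: "m * (norm z)\<^sup>2 = Re z" using nz by (simp add: m_def)
    have "(norm (1 - z * of_real r))\<^sup>2 = (1 - Re z * r)\<^sup>2 + (Im z * r)\<^sup>2"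
      by (simp add: cmod_power2)
    also have "\<dots> = 1 - 2 * Re z * r + ((Re z)\<^sup>2 + (Im z)\<^sup>2) * r\<^sup>2" by (simp add: power2_eq_square algebra_simps)
    also have "(Re z)\<^sup>2 + (Im z)\<^sup>2 = (norm z)\<^sup>2" by (simp add: cmod_power2)
    also have "1 - 2 * Re z * r + (norm z)\<^sup>2 * r\<^sup>2 = 1 - 2 * (m * (norm z)\<^sup>2) * r + (norm z)\<^sup>2 * r\<^sup>2" by (simp only: m)
    also have "\<dots> = (norm z)\<^sup>2 * (r - m)\<^sup>2 + (1 - (m * (norm z)\<^sup>2) * m)"
      by (simp add: power2_eq_square algebra_simps)
    finally show ?thesis by (simp add: m)
  qed
  have "(s - m)\<^sup>2 \<le> (t - m)\<^sup>2" using assms(2) by (simp add: m_def abs_le_square_iff)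
  then have "(norm (1 - z * of_real s))\<^sup>2 \<le> (norm (1 - z * of_real t))\<^sup>2"
    unfolding eq by (intro add_right_mono mult_left_mono) auto
  then show ?thesis by (rule power2_le_imp_le) simp
qed

text \<open>Multiplication by \<open>cnj z\<close> turns z s into the real number |z|^2 s, so the
  imaginary part of the product does not depend on s.\<close>

lemma norm_one_minus_mult_lower:
  fixes z :: complex and s :: real
  assumes "Im z \<noteq> 0"
  shows "\<bar>Im z\<bar> / norm z \<le> norm (1 - z * of_real s)"
proof -
  have nz: "norm z > 0" using assms by auto
  have "\<bar>Im z\<bar> = \<bar>Im ((1 - z * of_real s) * cnj z)\<bar>" by (simp add: algebra_simps)
  also have "\<dots> \<le> norm ((1 - z * of_real s) * cnj z)" by (rule abs_Im_le_cmod)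
  also have "\<dots> = norm (1 - z * of_real s) * norm z" by (simp add: norm_mult)
  finally show ?thesis using nz by (simp add: divide_le_eq)
qed

text \<open>The parameters \<open>\<alpha> n\<close>, \<open>\<beta> n\<close> stand for the
  reciprocals of a_n and b_n. Indices outside \<open>N\<close> contribute 1, so every product runs
  over all of nat and removing an index changes only \<open>N\<close>.\<close>

definition moebius_factor :: "(nat \<Rightarrow> real) \<Rightarrow> (nat \<Rightarrow> real) \<Rightarrow> nat set \<Rightarrow> nat \<Rightarrow> complex \<Rightarrow> complex" where
  "moebius_factor \<alpha> \<beta> N n z = (if n \<in> N then (1 - z * of_real (\<alpha> n)) / (1 - z * of_real (\<beta> n)) else 1)"

text \<open>Intervals between reciprocals of eigenvalues, which descend to 0. The endpoints enter
  through \<open>max\<close> and \<open>min\<close> because both interlacing orders occur.\<close>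

locale disjoint_intervals =
  fixes \<alpha> \<beta> :: "nat \<Rightarrow> real"
  assumes pos: "\<alpha> n > 0" "\<beta> n > 0"
    and desc: "max (\<alpha> (Suc n)) (\<beta> (Suc n)) \<le> min (\<alpha> n) (\<beta> n)"
    and lim: "\<beta> \<longlonglongrightarrow> 0"
begin

lemma summable_diff: "summable (\<lambda>n. \<bar>\<alpha> n - \<beta> n\<bar>)"
proof (rule summableI_nonneg_bounded)
  fix k
  have "(\<Sum>n<k. \<bar>\<alpha> n - \<beta> n\<bar>) + (if k = 0 then 0 else min (\<alpha> (k - 1)) (\<beta> (k - 1))) \<le> max (\<alpha> 0) (\<beta> 0)"
  proof (induction k)
    case (Suc k)
    note IH = this
    have *: "\<bar>\<alpha> k - \<beta> k\<bar> + min (\<alpha> k) (\<beta> k) = max (\<alpha> k) (\<beta> k)" by (auto simp: max_def min_def)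
    show ?case
    proof (cases k)
      case 0
      then show ?thesis using * by simp
    next
      case (Suc j)
      have d: "max (\<alpha> k) (\<beta> k) \<le> min (\<alpha> j) (\<beta> j)" unfolding Suc by (rule desc)
      have "(\<Sum>n<k. \<bar>\<alpha> n - \<beta> n\<bar>) + min (\<alpha> j) (\<beta> j) \<le> max (\<alpha> 0) (\<beta> 0)"
        using IH Suc by (simp del: sum.lessThan_Suc)
      moreover have "(\<Sum>n<Suc k. \<bar>\<alpha> n - \<beta> n\<bar>) = (\<Sum>n<k. \<bar>\<alpha> n - \<beta> n\<bar>) + \<bar>\<alpha> k - \<beta> k\<bar>" by simp
      ultimately have "(\<Sum>n<Suc k. \<bar>\<alpha> n - \<beta> n\<bar>) + min (\<alpha> k) (\<beta> k) \<le> max (\<alpha> 0) (\<beta> 0)" using d * by linarith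
      then show ?thesis by (simp del: sum.lessThan_Suc)
    qed
  qed (use pos[of 0] in simp)
  then show "(\<Sum>n<k. \<bar>\<alpha> n - \<beta> n\<bar>) \<le> max (\<alpha> 0) (\<beta> 0)"
    using pos[of "k - 1"] by (auto split: if_splits)
qed simp

definition P :: "nat set \<Rightarrow> complex \<Rightarrow> complex" where
  "P N z = prodinf (\<lambda>n. moebius_factor \<alpha> \<beta> N n z)"

definition pole_free :: "nat set \<Rightarrow> complex set" where
  "pole_free N = - ((\<lambda>n. of_real (1 / \<beta> n)) ` N)"

lemma pole_free_iff: "z \<in> pole_free N \<longleftrightarrow> (\<forall>n\<in>N. 1 - z * of_real (\<beta> n) \<noteq> 0)"
proof -
  have "1 - z * of_real (\<beta> n) = 0 \<longleftrightarrow> z = of_real (1 / \<beta> n)" for n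
    using pos(2)[of n] by (auto simp: field_simps)
  then show ?thesis by (auto simp: pole_free_def)
qed

lemma open_pole_free: "open (pole_free N)"
proof -
  have "filterlim (\<lambda>n. norm (complex_of_real (1 / \<beta> n))) at_top sequentially"
  proof -
    have "filterlim \<beta> (at_right 0) sequentially"
      using lim by (rule tendsto_imp_filterlim_at_right) (simp add: pos)
    from filterlim_compose[OF filterlim_inverse_at_top_right this] pos(2) show ?thesis
      by (simp add: norm_divide inverse_eq_divide less_imp_le abs_of_pos)
  qed
  then show ?thesis unfolding pole_free_def by (intro open_Compl locally_finite_image_closed)
qed

text \<open>A factor minus 1 equals z (\<beta> - \<alpha>) / (1 - z \<beta>), and \<beta> n -> 0
  eventually keeps the denominator at least 1/2 on the disc. Convergence of the product is thereby
  reduced to \<open>summable_diff\<close>.\<close>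

lemma moebius_factor_diff_bound:
  assumes r: "r \<ge> 0"
  shows "\<forall>\<^sub>F n in sequentially. \<forall>z\<in>cball 0 r. norm (moebius_factor \<alpha> \<beta> N n z - 1) \<le> 2 * r * \<bar>\<alpha> n - \<beta> n\<bar>"
proof -
  have "\<forall>\<^sub>F n in sequentially. \<beta> n < 1 / (2 * (r + 1))"
    by (rule order_tendstoD(2)[OF lim]) (use r in simp)
  then show ?thesis
  proof eventually_elim
    case (elim n)
    show ?case
    proof
      fix z :: complex assume z: "z \<in> cball 0 r"
      have "norm (z * of_real (\<beta> n)) \<le> r * (1 / (2 * (r + 1)))"
        unfolding norm_mult using z elim pos(2)[of n] r by (intro mult_mono) auto
      also have "\<dots> \<le> 1 / 2" using r by (simp add: field_simps)
      finally have l: "norm (1 - z * of_real (\<beta> n)) \<ge> 1 / 2"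
        using norm_triangle_ineq2[of 1 "z * of_real (\<beta> n)"] by simp
      show "norm (moebius_factor \<alpha> \<beta> N n z - 1) \<le> 2 * r * \<bar>\<alpha> n - \<beta> n\<bar>"
      proof (cases "n \<in> N")
        case True
        have "1 - z * of_real (\<beta> n) \<noteq> 0" using l by auto
        then have "moebius_factor \<alpha> \<beta> N n z - 1 = z * of_real (\<beta> n - \<alpha> n) / (1 - z * of_real (\<beta> n))"
          using True by (simp add: moebius_factor_def field_simps)
        also have "norm \<dots> = norm z * \<bar>\<alpha> n - \<beta> n\<bar> / norm (1 - z * of_real (\<beta> n))"
          by (simp only: norm_divide norm_mult norm_of_real abs_minus_commute)
        also have "\<dots> \<le> r * \<bar>\<alpha> n - \<beta> n\<bar> / (1 / 2)"
          using l z r by (intro frac_le mult_right_mono) auto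
        finally show ?thesis by simp
      qed (use r in \<open>simp add: moebius_factor_def\<close>)
    qed
  qed
qed

lemma convergent_prod_moebius_factor: "convergent_prod (\<lambda>n. moebius_factor \<alpha> \<beta> N n z)"
proof -
  have "summable (\<lambda>n. norm (moebius_factor \<alpha> \<beta> N n z - 1))"
  proof (rule summable_comparison_test_ev)
    show "\<forall>\<^sub>F n in sequentially. norm (norm (moebius_factor \<alpha> \<beta> N n z - 1)) \<le> 2 * norm z * \<bar>\<alpha> n - \<beta> n\<bar>"
      using moebius_factor_diff_bound[of "norm z" N] by (auto elim: eventually_mono)
    show "summable (\<lambda>n. 2 * norm z * \<bar>\<alpha> n - \<beta> n\<bar>)" using summable_diff by (rule summable_mult)
  qed
  then show ?thesis
    by (intro abs_convergent_prod_imp_convergent_prod summable_imp_abs_convergent_prod)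
qed

lemma P_LIMSEQ: "(\<lambda>k. \<Prod>n<k. moebius_factor \<alpha> \<beta> N n z) \<longlonglongrightarrow> P N z"
  using convergent_prod_LIMSEQ[OF convergent_prod_moebius_factor[of N z]]
  unfolding P_def lessThan_Suc_atMost[symmetric] by (subst (asm) filterlim_sequentially_Suc)

lemma P_nonzero:
  assumes "z \<in> pole_free N" "\<And>n. n \<in> N \<Longrightarrow> 1 - z * of_real (\<alpha> n) \<noteq> 0"
  shows "P N z \<noteq> 0"
  unfolding P_def using assms by (intro prodinf_nonzero convergent_prod_moebius_factor) (auto simp: moebius_factor_def pole_free_iff)

lemma P_holomorphic: "P N holomorphic_on pole_free N"
proof (rule holomorphic_uniform_sequence[OF open_pole_free])
  have hol: "moebius_factor \<alpha> \<beta> N n holomorphic_on pole_free N" for n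
  proof (cases "n \<in> N")
    case True
    then have "moebius_factor \<alpha> \<beta> N n = (\<lambda>z. (1 - z * of_real (\<alpha> n)) / (1 - z * of_real (\<beta> n)))"
      by (simp add: moebius_factor_def fun_eq_iff)
    then show ?thesis using True by (auto intro!: holomorphic_intros simp: pole_free_iff)
  next
    case False
    then have "moebius_factor \<alpha> \<beta> N n = (\<lambda>z. 1)" by (simp add: moebius_factor_def fun_eq_iff)
    then show ?thesis by simp
  qed
  then show "(\<lambda>z. \<Prod>n<k. moebius_factor \<alpha> \<beta> N n z) holomorphic_on pole_free N" for k by (intro holomorphic_intros)
  fix x assume "x \<in> pole_free N"
  then obtain d where d: "d > 0" "cball x d \<subseteq> pole_free N" using open_pole_free open_contains_cball by blast
  have sub: "cball x d \<subseteq> cball 0 (norm x + d)"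
  proof
    fix w assume "w \<in> cball x d"
    then show "w \<in> cball 0 (norm x + d)" using norm_triangle_sub[of w x] by (simp add: dist_norm norm_minus_commute)
  qed
  have "uniformly_convergent_on (cball x d) (\<lambda>k z. \<Prod>n<k. moebius_factor \<alpha> \<beta> N n z)"
  proof (rule uniformly_convergent_on_prod')
    show "continuous_on (cball x d) (moebius_factor \<alpha> \<beta> N n)" for n
      using hol holomorphic_on_imp_continuous_on continuous_on_subset d(2) by blast
    show "uniformly_convergent_on (cball x d) (\<lambda>k z. \<Sum>n<k. norm (moebius_factor \<alpha> \<beta> N n z - 1))"
    proof (rule Weierstrass_m_test'_ev)
      have "\<forall>\<^sub>F n in sequentially. \<forall>z\<in>cball 0 (norm x + d). norm (moebius_factor \<alpha> \<beta> N n z - 1) \<le> 2 * (norm x + d) * \<bar>\<alpha> n - \<beta> n\<bar>"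
        using moebius_factor_diff_bound[of "norm x + d" N] d(1) by simp
      then show "\<forall>\<^sub>F n in sequentially. \<forall>z\<in>cball x d. norm (norm (moebius_factor \<alpha> \<beta> N n z - 1)) \<le> 2 * (norm x + d) * \<bar>\<alpha> n - \<beta> n\<bar>"
        by eventually_elim (use sub in auto)
      show "summable (\<lambda>n. 2 * (norm x + d) * \<bar>\<alpha> n - \<beta> n\<bar>)" using summable_diff by (rule summable_mult)
    qed
  qed simp
  then obtain l where l: "uniform_limit (cball x d) (\<lambda>k z. \<Prod>n<k. moebius_factor \<alpha> \<beta> N n z) l sequentially"
    by (auto simp: uniformly_convergent_on_def)
  have "l z = P N z" if "z \<in> cball x d" for z
    using tendsto_uniform_limitI[OF l that] P_LIMSEQ LIMSEQ_unique by blast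
  then have "uniform_limit (cball x d) (\<lambda>k z. \<Prod>n<k. moebius_factor \<alpha> \<beta> N n z) (P N) sequentially"
    using l by (subst (asm) uniform_limit_cong') auto
  then show "\<exists>d>0. cball x d \<subseteq> pole_free N \<and> uniform_limit (cball x d) (\<lambda>k z. \<Prod>n<k. moebius_factor \<alpha> \<beta> N n z) (P N) sequentially"
    using d by blast
qed

text \<open>Isolating one factor exhibits the zero at \<open>1 / \<alpha> m\<close> and the pole at
  \<open>1 / \<beta> m\<close>, which is how both kinds of singular points are treated
  later.\<close>

lemma P_split:
  assumes "m \<in> N"
  shows "P N z = (1 - z * of_real (\<alpha> m)) / (1 - z * of_real (\<beta> m)) * P (N - {m}) z"
proof -
  have "(\<Prod>n<k. moebius_factor \<alpha> \<beta> N n z) = moebius_factor \<alpha> \<beta> N m z * (\<Prod>n<k. moebius_factor \<alpha> \<beta> (N - {m}) n z)" if "k > m" for k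
  proof -
    have "(\<Prod>n<k. moebius_factor \<alpha> \<beta> N n z) = moebius_factor \<alpha> \<beta> N m z * (\<Prod>n\<in>{..<k} - {m}. moebius_factor \<alpha> \<beta> N n z)"
      using that by (intro prod.remove) auto
    also have "(\<Prod>n\<in>{..<k} - {m}. moebius_factor \<alpha> \<beta> N n z) = (\<Prod>n\<in>{..<k} - {m}. moebius_factor \<alpha> \<beta> (N - {m}) n z)"
      by (intro prod.cong) (auto simp: moebius_factor_def)
    also have "\<dots> = moebius_factor \<alpha> \<beta> (N - {m}) m z * (\<Prod>n\<in>{..<k} - {m}. moebius_factor \<alpha> \<beta> (N - {m}) n z)" by (simp add: moebius_factor_def)
    also have "\<dots> = (\<Prod>n<k. moebius_factor \<alpha> \<beta> (N - {m}) n z)" using that by (intro prod.remove[symmetric]) auto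
    finally show ?thesis .
  qed
  then have "\<forall>\<^sub>F k in sequentially. (\<Prod>n<k. moebius_factor \<alpha> \<beta> N n z) = moebius_factor \<alpha> \<beta> N m z * (\<Prod>n<k. moebius_factor \<alpha> \<beta> (N - {m}) n z)"
    by (auto simp: eventually_sequentially intro!: exI[of _ "Suc m"])
  moreover have "(\<lambda>k. moebius_factor \<alpha> \<beta> N m z * (\<Prod>n<k. moebius_factor \<alpha> \<beta> (N - {m}) n z)) \<longlonglongrightarrow> moebius_factor \<alpha> \<beta> N m z * P (N - {m}) z"
    by (intro tendsto_intros P_LIMSEQ)
  ultimately have "(\<lambda>k. \<Prod>n<k. moebius_factor \<alpha> \<beta> N n z) \<longlonglongrightarrow> moebius_factor \<alpha> \<beta> N m z * P (N - {m}) z"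
    by (simp add: tendsto_cong)
  then have "P N z = moebius_factor \<alpha> \<beta> N m z * P (N - {m}) z" using P_LIMSEQ LIMSEQ_unique by blast
  then show ?thesis using assms by (simp add: moebius_factor_def)
qed

text \<open>The norm of a factor is \<open>g (\<alpha> n) / g (\<beta> n)\<close> for \<open>g s = \<bar>1 - z s\<bar>\<close>, which decreases up to
  \<open>s = Re z / \<bar>z\<bar>\<^sup>2\<close>, where its value is at least \<open>\<bar>Im z\<bar> / \<bar>z\<bar>\<close>, and increases afterwards. On either
  side the products over the disjoint intervals telescope.\<close>

lemma P_bound:
  assumes z: "Im z \<noteq> 0"
  shows "norm (P N z) \<le> (1 + norm z * max (\<alpha> 0) (\<beta> 0)) * (norm z / \<bar>Im z\<bar>)\<^sup>2"
proof -
  have z0: "z \<noteq> 0" using z by auto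
  define m where "m = Re z / (norm z)\<^sup>2"
  define g where "g = (\<lambda>s::real. norm (1 - z * of_real s))"
  have gm: "g s \<le> g t" if "\<bar>s - m\<bar> \<le> \<bar>t - m\<bar>" for s t
    unfolding g_def using norm_one_minus_mult_mono[OF z0] that by (simp add: m_def)
  define c where "c = \<bar>Im z\<bar> / norm z"
  have c: "c > 0" using z z0 by (simp add: c_def)
  have gc: "c \<le> g s" for s unfolding g_def c_def by (rule norm_one_minus_mult_lower[OF z])
  have gp: "g s > 0" for s using gc[of s] c by linarith
  \<comment> \<open>\<open>g\<close> is cut at its vertex \<open>m\<close>: \<open>D\<close> is
    constant to the right of the vertex and \<open>I\<close> to its left. Up to the constant
    \<open>g m\<close> their product is \<open>g\<close>, so ratios of \<open>g\<close> split into
    ratios of two monotone functions.\<close>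
  define D I where "D = (\<lambda>s. g (min s m))" and "I = (\<lambda>s. g (max s m))"
  have Dmono: "D t \<le> D s" and Imono: "I s \<le> I t" if "s \<le> t" for s t
    unfolding D_def I_def using that by (intro gm; auto simp: min_def max_def)+
  have DI: "D s * I s = g s * g m" for s by (simp add: D_def I_def min_def max_def)
  have Dp: "D s > 0" and Ip: "I s > 0" for s unfolding D_def I_def by (rule gp)+
  have D1: "D s \<le> 1" if "s \<ge> 0" for s
  proof -
    have "D s \<le> g 0" unfolding D_def using that by (intro gm) (auto simp: min_def)
    then show ?thesis by (simp add: g_def)
  qed
  define x y where "x = (\<lambda>n. min (\<alpha> n) (\<beta> n))" and "y = (\<lambda>n. max (\<alpha> n) (\<beta> n))"
  have xy: "x n \<le> y n" "y (Suc n) \<le> x n" "x n > 0" "y n > 0" for n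
    using desc[of n] pos[of n] by (auto simp: x_def y_def)
  \<comment> \<open>\<open>D\<close> decreases, so its reciprocal is the increasing function to
    which \<open>prod_ratio_telescope\<close> applies; its lower bound 1 is \<open>D1\<close>, valid
    at positive points.\<close>
  have "(\<Prod>n<k. (1 / D (y n)) / (1 / D (x n))) \<le> (1 / D (y 0)) / 1" for k
  proof (rule prod_ratio_telescope)
    show "1 \<le> 1 / D (x n)" for n using D1[of "x n"] Dp xy(3)[of n] by (simp add: less_imp_le)
    show "1 / D (x n) \<le> 1 / D (y n)" "1 / D (y (Suc n)) \<le> 1 / D (x n)" for n
      using Dmono[OF xy(1)[of n]] Dmono[OF xy(2)[of n]] Dp by (auto intro!: divide_left_mono)
  qed simp
  then have pD: "(\<Prod>n<k. D (x n) / D (y n)) \<le> 1 / c" for k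
    using gc[of "min (y 0) m"] c by (simp add: D_def) (meson frac_le order_trans zero_le_one order_refl)
  have "(\<Prod>n<k. I (y n) / I (x n)) \<le> I (y 0) / c" for k
    by (rule prod_ratio_telescope) (use c gc xy in \<open>auto simp: I_def intro!: Imono[unfolded I_def]\<close>)
  moreover have "I (y 0) \<le> 1 + norm z * y 0"
  proof -
    have "I (y 0) \<le> g (y 0)" unfolding I_def by (intro gm) (auto simp: max_def)
    also have "\<dots> \<le> 1 + norm z * y 0" unfolding g_def
      using norm_triangle_ineq4[of 1 "z * of_real (y 0)"] xy(4)[of 0] by (simp add: norm_mult)
    finally show ?thesis .
  qed
  ultimately have pI: "(\<Prod>n<k. I (y n) / I (x n)) \<le> (1 + norm z * y 0) / c" for k
    using c by (meson divide_right_mono less_imp_le order_trans)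
  \<comment> \<open>Whichever of \<open>\<alpha> n\<close>, \<open>\<beta> n\<close> is larger, the
    factor is at most the product of the two ratios that are at least 1. The same bound covers the
    factor 1 of an index outside \<open>N\<close>, so it does not depend on
    \<open>N\<close>.\<close>
  have r: "norm (moebius_factor \<alpha> \<beta> N n z) \<le> D (x n) / D (y n) * (I (y n) / I (x n))" for n
  proof -
    have dx: "1 \<le> D (x n) / D (y n)" "1 \<le> I (y n) / I (x n)" using Dmono[OF xy(1)] Imono[OF xy(1)] Dp Ip by auto
    have "g (x n) / g (y n) = (D (x n) * I (x n)) / (D (y n) * I (y n))" unfolding DI using gp[of m] by simp
    also have "\<dots> = D (x n) / D (y n) * (I (x n) / I (y n))" by simp
    also have "\<dots> \<le> D (x n) / D (y n) * (I (y n) / I (x n))"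
      using Imono[OF xy(1)[of n]] Ip[of "x n"] Ip[of "y n"] Dp[of "x n"] Dp[of "y n"]
      by (intro mult_left_mono frac_le) auto
    finally have 1: "g (x n) / g (y n) \<le> D (x n) / D (y n) * (I (y n) / I (x n))" .
    have "g (y n) / g (x n) = (D (y n) * I (y n)) / (D (x n) * I (x n))" unfolding DI using gp[of m] by simp
    also have "\<dots> = D (y n) / D (x n) * (I (y n) / I (x n))" by simp
    also have "\<dots> \<le> D (x n) / D (y n) * (I (y n) / I (x n))"
      using Dmono[OF xy(1)[of n]] Ip[of "x n"] Ip[of "y n"] Dp[of "x n"] Dp[of "y n"]
      by (intro mult_right_mono frac_le) auto
    finally have 2: "g (y n) / g (x n) \<le> D (x n) / D (y n) * (I (y n) / I (x n))" .
    have 3: "1 * 1 \<le> D (x n) / D (y n) * (I (y n) / I (x n))" using dx by (intro mult_mono) auto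
    have "norm (moebius_factor \<alpha> \<beta> N n z) = (if n \<in> N then g (\<alpha> n) / g (\<beta> n) else 1)" by (simp add: moebius_factor_def g_def norm_divide)
    then show ?thesis using 1 2 3 by (auto simp: x_def y_def min_def max_def split: if_splits)
  qed
  have "norm (\<Prod>n<k. moebius_factor \<alpha> \<beta> N n z) \<le> (1 + norm z * max (\<alpha> 0) (\<beta> 0)) * (norm z / \<bar>Im z\<bar>)\<^sup>2" for k
  proof -
    have "norm (\<Prod>n<k. moebius_factor \<alpha> \<beta> N n z) \<le> (\<Prod>n<k. D (x n) / D (y n) * (I (y n) / I (x n)))"
      unfolding prod_norm[symmetric] using r by (intro prod_mono) auto
    also have "\<dots> = (\<Prod>n<k. D (x n) / D (y n)) * (\<Prod>n<k. I (y n) / I (x n))" by (rule prod.distrib)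
    also have "\<dots> \<le> (1 / c) * ((1 + norm z * y 0) / c)"
      using pD pI Dp Ip c by (intro mult_mono prod_nonneg) (auto intro: less_imp_le)
    also have "\<dots> = (1 + norm z * y 0) * (1 / c)\<^sup>2" by (simp add: power2_eq_square)
    finally show ?thesis by (simp add: c_def y_def)
  qed
  then show ?thesis by (intro LIMSEQ_le_const2[OF tendsto_norm[OF P_LIMSEQ]]) auto
qed

text \<open>At - t the factors are (1 + t \<alpha>) / (1 + t \<beta>). In the order \<alpha> <=
  \<beta>, that is b_n <= a_n, each is at most 1; in general they telescope to linear growth. These
  two alternatives are the reason for the case distinction in the decay of M.\<close>

lemma P_negative_bound:
  fixes t :: real
  assumes t: "t \<ge> 0"
  shows "(\<And>n. \<alpha> n \<le> \<beta> n) \<Longrightarrow> norm (P N (- of_real t)) \<le> 1"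
    and "norm (P N (- of_real t)) \<le> 1 + t * max (\<alpha> 0) (\<beta> 0)"
proof -
  have n: "norm (moebius_factor \<alpha> \<beta> N n (- of_real t)) = (if n \<in> N then (1 + t * \<alpha> n) / (1 + t * \<beta> n) else 1)" for n
  proof -
    have "norm (1 + complex_of_real t * of_real s) = 1 + t * s" if "s > 0" for s
    proof -
      have "1 + complex_of_real t * of_real s = of_real (1 + t * s)" by simp
      then show ?thesis using t that by (simp only: norm_of_real) simp
    qed
    then show ?thesis using pos[of n] by (simp add: moebius_factor_def norm_divide)
  qed
  have p1: "1 + t * \<alpha> n > 0" "1 + t * \<beta> n > 0" for n using t pos[of n] by (auto intro!: add_pos_nonneg)
  show "norm (P N (- of_real t)) \<le> 1" if "\<And>n. \<alpha> n \<le> \<beta> n"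
  proof -
    have "norm (\<Prod>n<k. moebius_factor \<alpha> \<beta> N n (- of_real t)) \<le> 1" for k
    proof -
      have "(1 + t * \<alpha> n) / (1 + t * \<beta> n) \<le> 1" "0 \<le> (1 + t * \<alpha> n) / (1 + t * \<beta> n)" for n
        using mult_left_mono[OF that[of n] t] p1[of n] by simp_all
      then show ?thesis unfolding prod_norm[symmetric] n by (intro prod_le_1) auto
    qed
    then show ?thesis by (intro LIMSEQ_le_const2[OF tendsto_norm[OF P_LIMSEQ]]) auto
  qed
  define x y where "x = (\<lambda>n. min (\<alpha> n) (\<beta> n))" and "y = (\<lambda>n. max (\<alpha> n) (\<beta> n))"
  have xy: "x n \<le> y n" "y (Suc n) \<le> x n" "x n > 0" "y n > 0" for n
    using desc[of n] pos[of n] by (auto simp: x_def y_def)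
  have "norm (\<Prod>n<k. moebius_factor \<alpha> \<beta> N n (- of_real t)) \<le> 1 + t * max (\<alpha> 0) (\<beta> 0)" for k
  proof -
    have "norm (\<Prod>n<k. moebius_factor \<alpha> \<beta> N n (- of_real t)) \<le> (\<Prod>n<k. (1 + t * y n) / (1 + t * x n))"
      unfolding prod_norm[symmetric] n
    proof (intro prod_mono conjI)
      fix n
      have "1 + t * x n > 0" "1 + t * y n > 0" "x n \<le> \<beta> n" "\<alpha> n \<le> y n" "x n \<le> y n" using p1[of n] by (auto simp: x_def y_def min_def max_def)
      then show "(if n \<in> N then (1 + t * \<alpha> n) / (1 + t * \<beta> n) else 1) \<le> (1 + t * y n) / (1 + t * x n)"
        using t p1[of n] by (auto intro!: frac_le mult_left_mono)
      show "0 \<le> (if n \<in> N then (1 + t * \<alpha> n) / (1 + t * \<beta> n) else 1)" using p1[of n] by auto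
    qed
    also have "\<dots> \<le> (1 + t * y 0) / 1"
      by (rule prod_ratio_telescope) (use xy t in \<open>auto intro!: mult_left_mono mult_nonneg_nonneg simp: less_imp_le\<close>)
    finally show ?thesis by (simp add: y_def)
  qed
  then show "norm (P N (- of_real t)) \<le> 1 + t * max (\<alpha> 0) (\<beta> 0)"
    by (intro LIMSEQ_le_const2[OF tendsto_norm[OF P_LIMSEQ]]) auto
qed

end

section \<open>Interpolation with mixed data; discrete Herglotz functions\<close>

text \<open>\<open>N\<close> indexes the known zeros, its complement the known residues. The two
  cases of \<open>decay\<close> pair exactly with the two bounds of \<open>P_negative_bound\<close>.
  Positivity of all \<open>a n\<close> and \<open>b n\<close> allows passing to reciprocals and
  keeps the negative axis free of singular points; it is arranged by a translation.\<close>

lemma mixed_data_zero: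
  fixes a b :: "nat \<Rightarrow> real" and N :: "nat set" and M :: "complex \<Rightarrow> complex"
  assumes pos: "\<And>n. 0 < a n" "\<And>n. 0 < b n"
    and asc: "\<And>n. max (a n) (b n) < min (a (Suc n)) (b (Suc n))"
    and ne: "\<And>i j. a i \<noteq> b j"
    and lima: "filterlim a at_top sequentially" and limb: "filterlim b at_top sequentially"
    and hol: "M holomorphic_on - range (\<lambda>n. complex_of_real (a n))"
    and bd: "\<And>z. Im z \<noteq> 0 \<Longrightarrow> norm (M z) * \<bar>Im z\<bar> \<le> C * (1 + norm z)\<^sup>2"
    and res: "\<And>n. \<exists>L. ((\<lambda>z. (z - of_real (a n)) * M z) \<longlongrightarrow> L) (at (of_real (a n))) \<and> (n \<notin> N \<longrightarrow> L = 0)"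
    and zer: "\<And>n. n \<in> N \<Longrightarrow> M (of_real (b n)) = 0"
    and decay: "(\<forall>n. b n \<le> a n) \<and> (\<lambda>k. M (- of_nat k)) \<longlonglongrightarrow> 0 \<or> (\<lambda>k. of_nat k * M (- of_nat k)) \<longlonglongrightarrow> 0"
    and z: "z \<notin> range (\<lambda>n. complex_of_real (a n))"
  shows "M z = 0"
proof -
  interpret D: disjoint_intervals "\<lambda>n. 1 / a n" "\<lambda>n. 1 / b n"
  proof
    show "max (1 / a (Suc n)) (1 / b (Suc n)) \<le> min (1 / a n) (1 / b n)" for n
      using asc[of n] pos[of n] pos[of "Suc n"] by (auto intro!: divide_left_mono)
    show "(\<lambda>n. 1 / b n) \<longlonglongrightarrow> 0"
      using tendsto_divide_0[OF tendsto_const filterlim_at_top_imp_at_infinity[OF limb]] .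
  qed (use pos in auto)
  let ?A = "\<lambda>n. complex_of_real (a n)" and ?B = "\<lambda>n. complex_of_real (b n)"
  define T where "T = range ?A \<union> ?B ` N"
  have bmono: "b n < b (Suc n)" for n using asc[of n] by simp
  have binj: "b i = b j \<longleftrightarrow> i = j" for i j
  proof -
    have "strict_mono b" by (simp add: strict_mono_Suc_iff bmono)
    then show ?thesis by (rule strict_mono_eq)
  qed
  have pf: "D.pole_free X = - (?B ` X)" for X by (simp add: D.pole_free_def)
  have ninf: "filterlim (\<lambda>n. norm (?A n)) at_top sequentially" "filterlim (\<lambda>n. norm (?B n)) at_top sequentially"
    using lima limb pos by (simp_all add: abs_of_pos)
  have cl: "closed (?A ` X \<union> ?B ` Y)" for X Y
    by (intro closed_Un locally_finite_image_closed ninf)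
  have T: "closed T" unfolding T_def by (rule cl)
  have T': "closed (T - {p})" for p
  proof -
    have "T - {p} = ?A ` {n. ?A n \<noteq> p} \<union> ?B ` {n \<in> N. ?B n \<noteq> p}" by (auto simp: T_def)
    then show ?thesis by (simp only: cl)
  qed
  define H where "H = (\<lambda>z. M z * D.P N z)"
  have holH: "H holomorphic_on - T"
    unfolding H_def by (intro holomorphic_intros holomorphic_on_subset[OF hol] holomorphic_on_subset[OF D.P_holomorphic])
      (auto simp: T_def pf)
  have contP: "isCont (D.P X) w" if "w \<in> D.pole_free X" for X w
    using holomorphic_on_imp_continuous_on[OF D.P_holomorphic] D.open_pole_free that continuous_on_eq_continuous_at by blast
  \<comment> \<open>At a pole \<open>a m\<close> of \<open>M\<close> either m is in \<open>N\<close>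
    and \<open>P\<close> vanishes, or m is outside \<open>N\<close> and the residue of
    \<open>M\<close> vanishes.\<close>
  have lim: "((\<lambda>z. (z - p) * H z) \<longlongrightarrow> 0) (at p)" if "p \<in> T" for p
  proof (cases "p \<in> range ?A")
    case True
    then obtain m where p: "p = ?A m" by auto
    obtain L where L: "((\<lambda>z. (z - p) * M z) \<longlongrightarrow> L) (at p)" "m \<notin> N \<Longrightarrow> L = 0" using res[of m] p by auto
    have "p \<in> D.pole_free N" using ne by (auto simp: pf p)
    then have "(D.P N \<longlongrightarrow> D.P N p) (at p)" using contP by (simp add: isCont_def)
    then have "((\<lambda>z. (z - p) * M z * D.P N z) \<longlongrightarrow> L * D.P N p) (at p)" by (intro tendsto_mult L(1))
    moreover have "L * D.P N p = 0"
    proof (cases "m \<in> N")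
      case True
      then have "D.P N p = 0" using pos(1)[of m] by (simp add: D.P_split[OF True] p)
      then show ?thesis by simp
    qed (use L in simp)
    ultimately show ?thesis by (simp add: H_def mult.assoc)
  next
    case False
    \<comment> \<open>Once the factor with index m is split off, (z - p) / (1 - z / b_m) is the
      constant - b_m. Hence (z - p) H is \<open>M\<close> times a function continuous at p, and
      \<open>M\<close> vanishes there.\<close>
    then obtain m where p: "p = ?B m" and m: "m \<in> N" using \<open>p \<in> T\<close> by (auto simp: T_def)
    have "p \<in> D.pole_free (N - {m})" by (auto simp: pf p binj)
    then have c: "isCont (D.P (N - {m})) p" by (rule contP)
    have "open (- range ?A)" using cl[of UNIV "{}"] by auto
    then have cM: "isCont M p"
      using holomorphic_on_imp_continuous_on[OF hol] False continuous_on_eq_continuous_at by blast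
    have "isCont (\<lambda>z. M z * (- of_real (b m) * (1 - z * of_real (1 / a m)) * D.P (N - {m}) z)) p"
      by (intro continuous_intros c cM)
    then have "((\<lambda>z. M z * (- of_real (b m) * (1 - z * of_real (1 / a m)) * D.P (N - {m}) z)) \<longlongrightarrow> 0) (at p)"
      using zer[OF m] by (simp add: isCont_def p)
    then show ?thesis
    proof (rule Lim_transform_eventually)
      have "(z - p) * H z = M z * (- of_real (b m) * (1 - z * of_real (1 / a m)) * D.P (N - {m}) z)" if "z \<noteq> p" for z
      proof -
        have "b m \<noteq> 0" using pos(2)[of m] by simp
        then have "1 - z * of_real (1 / b m) = (p - z) / of_real (b m)" by (simp add: p field_simps)
        then have "(z - p) / (1 - z * of_real (1 / b m)) = - of_real (b m)"
          using that \<open>b m \<noteq> 0\<close> by (auto simp: p field_simps)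
        moreover have "(z - p) * H z = M z * ((z - p) / (1 - z * of_real (1 / b m)) * (1 - z * of_real (1 / a m)) * D.P (N - {m}) z)"
          unfolding H_def D.P_split[OF m, of z] by simp
        ultimately show ?thesis by simp
      qed
      then show "\<forall>\<^sub>F z in at p. M z * (- of_real (b m) * (1 - z * of_real (1 / a m)) * D.P (N - {m}) z) = (z - p) * H z"
        by (auto simp: eventually_at_filter)
    qed
  qed
  obtain G where G: "G holomorphic_on UNIV" "\<And>z. z \<notin> T \<Longrightarrow> G z = H z"
    using removable_discrete_extension[OF holH T T' lim] by blast
  define s where "s = max (1 / a 0) (1 / b 0)"
  have s: "s > 0" using pos[of 0] by (simp add: s_def less_max_iff_disj)
  have real_T: "w \<in> T \<Longrightarrow> Im w = 0 \<and> Re w > 0" for w using pos by (auto simp: T_def)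
  \<comment> \<open>One power of |Im w| belongs to \<open>M\<close>, two to \<open>P\<close>; the
    growth exponents are 2 and 3. This is the source of the numbers 3 and 5 in
    \<open>entire_off_axis_growth_zero\<close>.\<close>
  have "norm (G w) * \<bar>Im w\<bar> ^ 3 \<le> (C * (1 + s)) * (1 + norm w) ^ 5" if w: "Im w \<noteq> 0" for w
  proof -
    have "G w = M w * D.P N w" using G(2)[of w] real_T[of w] w by (auto simp: H_def)
    then have "norm (G w) * \<bar>Im w\<bar> ^ 3 = (norm (M w) * \<bar>Im w\<bar>) * (norm (D.P N w) * \<bar>Im w\<bar>\<^sup>2)"
      by (simp add: norm_mult power3_eq_cube power2_eq_square)
    also have "\<dots> \<le> (C * (1 + norm w)\<^sup>2) * ((1 + norm w * s) * (norm w)\<^sup>2)"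
    proof (rule mult_mono)
      show "norm (M w) * \<bar>Im w\<bar> \<le> C * (1 + norm w)\<^sup>2" by (rule bd[OF w])
      have "norm (D.P N w) * \<bar>Im w\<bar>\<^sup>2 \<le> ((1 + norm w * s) * (norm w / \<bar>Im w\<bar>)\<^sup>2) * \<bar>Im w\<bar>\<^sup>2"
        unfolding s_def by (intro mult_right_mono D.P_bound w) auto
      then show "norm (D.P N w) * \<bar>Im w\<bar>\<^sup>2 \<le> (1 + norm w * s) * (norm w)\<^sup>2"
        using w by (simp add: power_divide)
      show "0 \<le> C * (1 + norm w)\<^sup>2" using order_trans[OF _ bd[OF w]] by simp
    qed auto
    also have "\<dots> \<le> (C * (1 + norm w)\<^sup>2) * (((1 + s) * (1 + norm w)) * (1 + norm w)\<^sup>2)"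
    proof (rule mult_left_mono)
      show "(1 + norm w * s) * (norm w)\<^sup>2 \<le> ((1 + s) * (1 + norm w)) * (1 + norm w)\<^sup>2"
        using s by (intro mult_mono power_mono) (auto simp: algebra_simps)
      show "0 \<le> C * (1 + norm w)\<^sup>2" using order_trans[OF _ bd[OF w]] by simp
    qed
    also have "\<dots> = (C * (1 + s)) * (1 + norm w) ^ 5" by (simp add: eval_nat_numeral)
    finally show ?thesis .
  qed
  moreover have "(\<lambda>n. G (- of_nat n)) \<longlonglongrightarrow> 0"
  proof -
    have Gn: "norm (G (- of_nat n)) = norm (M (- of_nat n)) * norm (D.P N (- of_real (real n)))" for n
    proof -
      have "- of_nat n \<notin> T" using real_T[of "- of_nat n"] by auto
      then show ?thesis using G(2) by (simp add: H_def norm_mult)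
    qed
    from decay show ?thesis
    proof
      assume A: "(\<forall>n. b n \<le> a n) \<and> (\<lambda>k. M (- of_nat k)) \<longlonglongrightarrow> 0"
      have "norm (D.P N (- of_real (real n))) \<le> 1" for n
        by (rule D.P_negative_bound(1)) (use A pos in \<open>auto intro!: divide_left_mono\<close>)
      then have "norm (G (- of_nat n)) \<le> norm (M (- of_nat n))" for n unfolding Gn by (simp add: mult_left_le)
      then have "\<forall>\<^sub>F n in sequentially. norm (G (- of_nat n)) \<le> norm (M (- of_nat n))" by simp
      moreover have "(\<lambda>n. norm (M (- of_nat n))) \<longlonglongrightarrow> 0" by (rule tendsto_norm_zero[OF conjunct2[OF A]])
      ultimately show ?thesis by (rule Lim_null_comparison)
    next
      assume A: "(\<lambda>k. of_nat k * M (- of_nat k)) \<longlonglongrightarrow> 0"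
      then have A': "(\<lambda>n. real n * norm (M (- of_nat n))) \<longlonglongrightarrow> 0" using tendsto_norm_zero[OF A] by (simp add: norm_mult)
      have "norm (G (- of_nat n)) \<le> (1 + s) * (real n * norm (M (- of_nat n)))" if "n \<ge> 1" for n
      proof -
        have "norm (G (- of_nat n)) \<le> norm (M (- of_nat n)) * (1 + real n * s)"
          unfolding Gn s_def by (intro mult_left_mono D.P_negative_bound(2)) auto
        also have "\<dots> \<le> norm (M (- of_nat n)) * ((1 + s) * real n)"
          using that s by (intro mult_left_mono) (auto simp: algebra_simps)
        finally show ?thesis by (simp add: mult_ac)
      qed
      then have "\<forall>\<^sub>F n in sequentially. norm (G (- of_nat n)) \<le> (1 + s) * (real n * norm (M (- of_nat n)))"
        by (auto simp: eventually_sequentially)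
      moreover have "(\<lambda>n. (1 + s) * (real n * norm (M (- of_nat n)))) \<longlonglongrightarrow> 0" using tendsto_mult_right_zero[OF A'] .
      ultimately show ?thesis by (rule Lim_null_comparison)
    qed
  qed
  ultimately have G0: "G w = 0" for w by (rule entire_off_axis_growth_zero[OF G(1)])
  \<comment> \<open>Away from the points b_n with n in \<open>N\<close> the product is nonzero and
    can be divided out; at these points the claim is the hypothesis \<open>zer\<close>.\<close>
  show ?thesis
  proof (cases "z \<in> ?B ` N")
    case False
    then have "z \<notin> T" using z by (auto simp: T_def)
    then have "M z * D.P N z = 0" using G(2) G0 by (simp add: H_def)
    moreover have "D.P N z \<noteq> 0"
    proof (rule D.P_nonzero)
      show "z \<in> D.pole_free N" using False by (simp add: pf)
      fix n show "1 - z * of_real (1 / a n) \<noteq> 0"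
      proof
        assume "1 - z * of_real (1 / a n) = 0"
        then have "z = ?A n" using pos(1)[of n] by (simp add: field_simps)
        then show False using z by auto
      qed
    qed
    ultimately show ?thesis by simp
  qed (use zer in auto)
qed

section \<open>Herglotz functions of a discrete measure\<close>

definition hkernel :: "real \<Rightarrow> complex \<Rightarrow> complex" where
  "hkernel t z = 1 / (of_real t - z) - of_real (t / (1 + t\<^sup>2))"

text \<open>The kernel equals ((1 + z^2) / (t - z) + z) / (1 + t^2): the dependence on t is the
  integrable weight times a term controlled by the distance from t to z.\<close>

lemma hkernel_bound:
  assumes "\<delta> > 0" "\<delta> \<le> norm (of_real t - z)"
  shows "norm (hkernel t z) \<le> ((1 + (norm z)\<^sup>2) / \<delta> + norm z) * (1 / (1 + t\<^sup>2))"
proof -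
  have nz: "of_real t - z \<noteq> 0" using assms by auto
  have t: "(1::real) + t\<^sup>2 > 0" by (simp add: add_pos_nonneg)
  then have t': "(1::complex) + (of_real t)\<^sup>2 \<noteq> 0"
    by (metis less_irrefl of_real_0 of_real_1 of_real_add of_real_eq_iff of_real_power)
  have "hkernel t z = ((1 + z\<^sup>2) / (of_real t - z) + z) * of_real (1 / (1 + t\<^sup>2))"
    using nz t' unfolding hkernel_def by (simp add: field_simps) (simp add: power2_eq_square algebra_simps)
  then have "norm (hkernel t z) = norm ((1 + z\<^sup>2) / (of_real t - z) + z) * (1 / (1 + t\<^sup>2))"
    using t by (simp only: norm_mult norm_of_real) simp
  also have "\<dots> \<le> ((1 + (norm z)\<^sup>2) / \<delta> + norm z) * (1 / (1 + t\<^sup>2))"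
  proof (rule mult_right_mono)
    have "norm ((1 + z\<^sup>2) / (of_real t - z) + z) \<le> norm (1 + z\<^sup>2) / norm (of_real t - z) + norm z"
      by (metis norm_divide norm_triangle_ineq)
    also have "\<dots> \<le> (1 + (norm z)\<^sup>2) / \<delta> + norm z"
      using assms norm_triangle_ineq[of 1 "z\<^sup>2"] by (intro add_right_mono frac_le) (auto simp: norm_power)
    finally show "norm ((1 + z\<^sup>2) / (of_real t - z) + z) \<le> (1 + (norm z)\<^sup>2) / \<delta> + norm z" .
  qed (use t in simp)
  finally show ?thesis .
qed

locale discrete_herglotz =
  fixes \<mu> :: "real measure" and a :: "nat \<Rightarrow> real" and c1 c0 :: real and m :: "complex \<Rightarrow> complex"
  assumes sets: "sets \<mu> = sets borel"
    and supp: "AE t in \<mu>. t \<in> range a"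
    and int: "integrable \<mu> (\<lambda>t. 1 / (1 + t\<^sup>2))"
    and mono: "strict_mono a" and lim: "filterlim a at_top sequentially"
    and rep: "\<And>z. z \<notin> range (\<lambda>n. complex_of_real (a n)) \<Longrightarrow> m z = of_real c1 * z + of_real c0 + (LINT t|\<mu>. hkernel t z)"
begin

definition W :: real where "W = (LINT t|\<mu>. 1 / (1 + t\<^sup>2))"

lemma W_nonneg: "W \<ge> 0"
  unfolding W_def by (intro integral_nonneg_AE) (auto simp: add_nonneg_nonneg)

lemma hkernel_measurable: "(\<lambda>t. hkernel t z) \<in> borel_measurable \<mu>"
  unfolding measurable_cong_sets[OF sets refl] hkernel_def by measurable

lemma integrable_dominated:
  fixes f :: "real \<Rightarrow> complex"
  assumes "f \<in> borel_measurable \<mu>" "AE t in \<mu>. norm (f t) \<le> K * (1 / (1 + t\<^sup>2))"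
  shows "integrable \<mu> f" "norm (LINT t|\<mu>. f t) \<le> K * W"
proof -
  have i: "integrable \<mu> (\<lambda>t. K * (1 / (1 + t\<^sup>2)))" using int by (rule integrable_mult_right)
  show f: "integrable \<mu> f"
  proof (rule Bochner_Integration.integrable_bound[OF i assms(1)])
    show "AE t in \<mu>. norm (f t) \<le> norm (K * (1 / (1 + t\<^sup>2)))"
      using assms(2)
    proof eventually_elim
      case (elim t)
      then show ?case unfolding real_norm_def by (rule order_trans) (rule abs_ge_self)
    qed
  qed
  have "norm (LINT t|\<mu>. f t) \<le> (LINT t|\<mu>. norm (f t))" by (rule integral_norm_bound)
  also have "\<dots> \<le> (LINT t|\<mu>. K * (1 / (1 + t\<^sup>2)))"
    using f i assms(2) by (intro integral_mono_AE) auto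
  also have "\<dots> = K * W" by (simp add: W_def del: times_divide_eq_right)
  finally show "norm (LINT t|\<mu>. f t) \<le> K * W" .
qed

text \<open>For real t the distance from t to z is at least |Im z|, which serves as
  \<open>\<delta>\<close> in \<open>hkernel_bound\<close>; multiplying by |Im z| clears the
  denominator. The form is the one required by \<open>mixed_data_zero\<close>.\<close>

lemma off_axis_bound:
  assumes z: "Im z \<noteq> 0"
  shows "norm (m z) * \<bar>Im z\<bar> \<le> (\<bar>c1\<bar> + \<bar>c0\<bar> + 2 * W) * (1 + norm z)\<^sup>2"
proof -
  let ?K = "(1 + (norm z)\<^sup>2) / \<bar>Im z\<bar> + norm z"
  have "norm (hkernel t z) \<le> ?K * (1 / (1 + t\<^sup>2))" for t
    using z abs_Im_le_cmod[of "of_real t - z"] by (intro hkernel_bound) auto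
  then have "norm (LINT t|\<mu>. hkernel t z) \<le> ?K * W"
    by (intro integrable_dominated hkernel_measurable) auto
  moreover have "m z = of_real c1 * z + of_real c0 + (LINT t|\<mu>. hkernel t z)" using z by (intro rep) auto
  then have "norm (m z) \<le> norm (of_real c1 * z) + norm (complex_of_real c0) + norm (LINT t|\<mu>. hkernel t z)"
    by (simp only: norm_triangle_le norm_triangle_ineq add_mono order_refl)
  ultimately have "norm (m z) \<le> \<bar>c1\<bar> * norm z + \<bar>c0\<bar> + ?K * W" by (simp add: norm_mult)
  then have "norm (m z) * \<bar>Im z\<bar> \<le> (\<bar>c1\<bar> * norm z + \<bar>c0\<bar> + ?K * W) * \<bar>Im z\<bar>" by (intro mult_right_mono) auto
  also have "\<dots> = \<bar>c1\<bar> * (norm z * \<bar>Im z\<bar>) + \<bar>c0\<bar> * \<bar>Im z\<bar> + W * (1 + (norm z)\<^sup>2 + norm z * \<bar>Im z\<bar>)"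
    using z by (simp add: field_simps)
  also have "\<dots> \<le> \<bar>c1\<bar> * (1 + norm z)\<^sup>2 + \<bar>c0\<bar> * (1 + norm z)\<^sup>2 + W * (2 * (1 + norm z)\<^sup>2)"
  proof -
    have i: "\<bar>Im z\<bar> \<le> norm z" by (rule abs_Im_le_cmod)
    have "norm z * \<bar>Im z\<bar> \<le> norm z * norm z" using i by (intro mult_left_mono) auto
    then have "norm z * \<bar>Im z\<bar> \<le> (1 + norm z)\<^sup>2" "\<bar>Im z\<bar> \<le> (1 + norm z)\<^sup>2"
      "1 + (norm z)\<^sup>2 + norm z * \<bar>Im z\<bar> \<le> 2 * (1 + norm z)\<^sup>2"
      using i norm_ge_zero[of z] zero_le_power2[of "norm z"]
      by (auto simp: power2_eq_square algebra_simps intro: order_trans)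
    then show ?thesis using W_nonneg by (intro add_mono mult_left_mono) auto
  qed
  also have "\<dots> = (\<bar>c1\<bar> + \<bar>c0\<bar> + 2 * W) * (1 + norm z)\<^sup>2" by (simp add: algebra_simps)
  finally show ?thesis .
qed

text \<open>Only indices with \<open>a j = x\<close> are excluded, so the same statement isolates a
  pole and separates a regular point from the support.\<close>

lemma isolated: "\<exists>r>0. \<forall>j. a j \<noteq> x \<longrightarrow> r \<le> \<bar>a j - x\<bar>"
proof -
  have "closed (a ` {j. a j \<noteq> x})"
    by (intro locally_finite_image_closed filterlim_compose[OF _ lim]) (simp add: filterlim_abs_real)
  moreover have "x \<notin> a ` {j. a j \<noteq> x}" by auto
  ultimately obtain r where r: "r > 0" "ball x r \<subseteq> - (a ` {j. a j \<noteq> x})"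
    by (metis ComplI closed_def openE)
  have "r \<le> \<bar>a j - x\<bar>" if "a j \<noteq> x" for j
  proof (rule ccontr)
    assume "\<not> r \<le> \<bar>a j - x\<bar>"
    then have "a j \<in> ball x r" by (simp add: dist_real_def abs_minus_commute)
    then show False using r that by blast
  qed
  then show ?thesis using r by blast
qed

lemma integrable_point: "integrable \<mu> (indicator {x} :: real \<Rightarrow> real)"
proof (rule Bochner_Integration.integrable_bound)
  show "integrable \<mu> (\<lambda>t. (1 + x\<^sup>2) * (1 / (1 + t\<^sup>2)))" using int by (rule integrable_mult_right)
  show "(indicator {x} :: real \<Rightarrow> real) \<in> borel_measurable \<mu>"
    unfolding measurable_cong_sets[OF sets refl] by measurable
  show "AE t in \<mu>. norm (indicator {x} t :: real) \<le> norm ((1 + x\<^sup>2) * (1 / (1 + t\<^sup>2)))"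
  proof (intro AE_I2)
    fix t
    have "1 + x\<^sup>2 > 0" by (simp add: add_pos_nonneg)
    then show "norm (indicator {x} t :: real) \<le> norm ((1 + x\<^sup>2) * (1 / (1 + t\<^sup>2)))"
      by (auto simp: indicator_def)
  qed
qed

lemma integral_point: "(LINT t|\<mu>. indicator {x} t) = measure \<mu> {x}"
proof -
  have "space \<mu> = UNIV" using sets_eq_imp_space_eq[OF sets] by simp
  then show ?thesis by simp
qed

text \<open>The atom at \<open>a n\<close> is split off from the integral. On the rest of the
  support the points stay at distance r/2 from z, so the remaining integral \<open>R\<close> is
  bounded near \<open>a n\<close> and disappears after multiplication by z - a_n.\<close>

lemma residue_limit: "((\<lambda>z. (z - of_real (a n)) * m z) \<longlongrightarrow> - of_real (measure \<mu> {a n})) (at (of_real (a n)))"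
proof -
  define x where "x = a n"
  obtain r where r: "r > 0" "\<And>j. a j \<noteq> x \<Longrightarrow> r \<le> \<bar>a j - x\<bar>" using isolated by blast
  define B where "B = (1 + (\<bar>x\<bar> + r)\<^sup>2) / (r / 2) + (\<bar>x\<bar> + r)"
  define R where "R = (\<lambda>z. LINT t|\<mu>. (if t = x then 0 else hkernel t z))"
  have near: "norm (R z) \<le> B * W \<and> m z = of_real c1 * z + of_real c0 + (R z + of_real (measure \<mu> {x}) * hkernel x z)"
    if z: "norm (z - of_real x) < r / 2" "z \<noteq> of_real x" for z
  proof -
    have nz: "norm z \<le> \<bar>x\<bar> + r" using norm_triangle_sub[of z "of_real x"] z r by simp
    have far: "r / 2 \<le> norm (of_real t - z)" if "t \<in> range a" "t \<noteq> x" for t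
    proof -
      have "r \<le> norm (of_real t - complex_of_real x)" using that r(2) by (auto simp flip: of_real_diff)
      also have "\<dots> \<le> norm (of_real t - z) + norm (z - of_real x)"
        using norm_triangle_ineq[of "of_real t - z" "z - of_real x"] by simp
      finally show ?thesis using z by linarith
    qed
    have kb: "norm (hkernel t z) \<le> B * (1 / (1 + t\<^sup>2))" if "t \<in> range a" "t \<noteq> x" for t
    proof -
      have "norm (hkernel t z) \<le> ((1 + (norm z)\<^sup>2) / (r / 2) + norm z) * (1 / (1 + t\<^sup>2))"
        using r far[OF that] by (intro hkernel_bound) auto
      also have "\<dots> \<le> B * (1 / (1 + t\<^sup>2))"
        unfolding B_def using r nz by (intro mult_right_mono add_mono divide_right_mono power_mono) (auto simp: add_pos_nonneg less_imp_le)
      finally show ?thesis .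
    qed
    have B0: "B \<ge> 0" using r by (simp add: B_def add_nonneg_nonneg)
    have AE1: "AE t in \<mu>. norm (if t = x then 0 else hkernel t z) \<le> B * (1 / (1 + t\<^sup>2))"
      using supp by eventually_elim (use kb B0 in \<open>auto simp: add_nonneg_nonneg\<close>)
    have "{x} \<in> sets \<mu>" by (simp add: sets)
    then have me: "(\<lambda>t. if t = x then 0 else hkernel t z) \<in> borel_measurable \<mu>"
      using hkernel_measurable by (intro measurable_If) (auto simp: sets sets_eq_imp_space_eq[OF sets])
    note iR = integrable_dominated[OF me AE1]
    have "z \<notin> range (\<lambda>n. complex_of_real (a n))"
    proof
      assume "z \<in> range (\<lambda>n. complex_of_real (a n))"
      then obtain j where j: "z = of_real (a j)" by auto
      then have "a j \<noteq> x" using z by auto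
      then show False using far[of "a j"] j r by auto
    qed
    from rep[OF this] have "m z = of_real c1 * z + of_real c0 + (LINT t|\<mu>. hkernel t z)" .
    also have "(\<lambda>t. hkernel t z) = (\<lambda>t. (if t = x then 0 else hkernel t z) + of_real (indicator {x} t) * hkernel x z)"
      by (auto simp: fun_eq_iff indicator_def)
    also have "(LINT t|\<mu>. (if t = x then 0 else hkernel t z) + of_real (indicator {x} t) * hkernel x z) =
        R z + (LINT t|\<mu>. of_real (indicator {x} t) * hkernel x z)"
      unfolding R_def using iR(1) integrable_point
      by (intro Bochner_Integration.integral_add integrable_mult_left) auto
    also have "(LINT t|\<mu>. of_real (indicator {x} t) * hkernel x z) = of_real (measure \<mu> {x}) * hkernel x z"
      by (simp only: integral_mult_left_zero integral_complex_of_real integral_point)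
    finally show ?thesis using iR(2) by (simp add: R_def)
  qed
  have ev: "\<forall>\<^sub>F z in at (complex_of_real x). norm (z - of_real x) < r / 2 \<and> z \<noteq> of_real x"
    using r by (auto simp: eventually_at dist_norm intro!: exI[of _ "r / 2"])
  have "((\<lambda>z. (z - of_real x) * (of_real c1 * z + of_real c0) + (z - of_real x) * R z
      + of_real (measure \<mu> {x}) * (- 1 - (z - of_real x) * of_real (x / (1 + x\<^sup>2)))) \<longlongrightarrow>
      (of_real x - of_real x) * (of_real c1 * of_real x + of_real c0) + 0
      + of_real (measure \<mu> {x}) * (- 1 - (of_real x - of_real x) * of_real (x / (1 + x\<^sup>2)))) (at (of_real x))"
  proof (intro tendsto_intros)
    show "((\<lambda>z. (z - of_real x) * R z) \<longlongrightarrow> 0) (at (of_real x))"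
    proof (rule Lim_null_comparison)
      show "\<forall>\<^sub>F z in at (of_real x). norm ((z - of_real x) * R z) \<le> norm (z - of_real x) * (B * W)"
        using ev by eventually_elim (use near in \<open>auto simp: norm_mult intro!: mult_left_mono\<close>)
      show "((\<lambda>z. norm (z - of_real x) * (B * W)) \<longlongrightarrow> 0) (at (of_real x))"
        by (auto intro!: tendsto_eq_intros)
    qed
  qed
  then have "((\<lambda>z. (z - of_real x) * (of_real c1 * z + of_real c0) + (z - of_real x) * R z
      + of_real (measure \<mu> {x}) * (- 1 - (z - of_real x) * of_real (x / (1 + x\<^sup>2)))) \<longlongrightarrow> - of_real (measure \<mu> {x})) (at (of_real x))"
    by simp
  then show ?thesis unfolding x_def[symmetric]
  proof (rule Lim_transform_eventually)
    show "\<forall>\<^sub>F z in at (of_real x). (z - of_real x) * (of_real c1 * z + of_real c0) + (z - of_real x) * R z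
      + of_real (measure \<mu> {x}) * (- 1 - (z - of_real x) * of_real (x / (1 + x\<^sup>2))) = (z - of_real x) * m z"
      using ev
    proof eventually_elim
      case (elim z)
      have "(z - of_real x) * hkernel x z = (z - of_real x) / (of_real x - z) - (z - of_real x) * of_real (x / (1 + x\<^sup>2))"
        by (simp add: hkernel_def right_diff_distrib)
      also have "(z - of_real x) / (of_real x - z) = - 1" using elim by (auto simp: divide_eq_minus_1_iff)
      finally have h: "(z - of_real x) * hkernel x z = - 1 - (z - of_real x) * of_real (x / (1 + x\<^sup>2))" .
      have "(z - of_real x) * m z = (z - of_real x) * (of_real c1 * z + of_real c0) + (z - of_real x) * R z
          + of_real (measure \<mu> {x}) * ((z - of_real x) * hkernel x z)"
        using near[of z] elim by (simp add: algebra_simps)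
      then show ?case unfolding h by simp
    qed
  qed
qed

definition real_kernel :: "real \<Rightarrow> real \<Rightarrow> real" where "real_kernel t x = 1 / (t - x) - t / (1 + t\<^sup>2)"

lemma hkernel_of_real: "hkernel t (of_real x) = of_real (real_kernel t x)"
  by (simp add: hkernel_def real_kernel_def)

lemma real_kernel_integrable:
  assumes "x \<notin> range a"
  shows "integrable \<mu> (\<lambda>t. real_kernel t x)"
proof -
  obtain r where r: "r > 0" "\<And>j. a j \<noteq> x \<Longrightarrow> r \<le> \<bar>a j - x\<bar>" using isolated by blast
  have "integrable \<mu> (\<lambda>t. hkernel t (of_real x))"
  proof (rule integrable_dominated(1)[OF hkernel_measurable])
    show "AE t in \<mu>. norm (hkernel t (of_real x)) \<le> ((1 + (norm (complex_of_real x))\<^sup>2) / r + norm (complex_of_real x)) * (1 / (1 + t\<^sup>2))"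
      using supp
    proof eventually_elim
      case (elim t)
      then obtain j where "t = a j" by auto
      then have "r \<le> \<bar>t - x\<bar>" using r(2)[of j] assms by auto
      then have "r \<le> norm (complex_of_real t - of_real x)" by (simp flip: of_real_diff)
      then show ?case using r(1) by (intro hkernel_bound)
    qed
  qed
  then show ?thesis unfolding hkernel_of_real by (simp add: complex_of_real_integrable_eq)
qed

lemma real_rep:
  assumes "x \<notin> range a"
  shows "m (of_real x) = of_real (c1 * x + c0 + (LINT t|\<mu>. real_kernel t x))"
proof -
  have "m (of_real x) = of_real c1 * of_real x + of_real c0 + (LINT t|\<mu>. hkernel t (of_real x))"
    using assms by (intro rep) auto
  then show ?thesis by (simp add: hkernel_of_real)
qed

text \<open>The difference of the kernels at y and x is (y - x) / ((t - y) (t - x)), positive for t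
  outside the interval; the atom at \<open>a 0\<close> makes the integral strictly positive.\<close>

lemma strictly_increasing:
  assumes xy: "x < y" and free: "\<And>j. a j \<notin> {x..y}" and c1: "c1 \<ge> 0" and g: "measure \<mu> {a 0} > 0"
  shows "Re (m (of_real x)) < Re (m (of_real y))"
proof -
  have nx: "x \<notin> range a" "y \<notin> range a" using free xy by (auto simp: image_iff)
      (metis atLeastAtMost_iff less_imp_le order_refl)+
  define e where "e = (\<lambda>t. real_kernel t y - real_kernel t x)"
  have ie: "integrable \<mu> e" unfolding e_def by (intro Bochner_Integration.integrable_diff real_kernel_integrable nx)
  have epos: "e t > 0" if t: "t \<in> range a" for t
  proof -
    obtain j where "t = a j" using t by auto
    then have "t < x \<or> y < t" using free[of j] by auto
    then have p: "(t - y) * (t - x) > 0" and "t \<noteq> x" "t \<noteq> y" using xy by (auto simp: zero_less_mult_iff)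
    then have "e t = (y - x) / ((t - y) * (t - x))" by (auto simp: e_def real_kernel_def field_simps)
    then show ?thesis using p xy by simp
  qed
  have "0 < e (a 0) * measure \<mu> {a 0}" using epos g by auto
  also have "\<dots> = (LINT t|\<mu>. e (a 0) * indicator {a 0} t)" by (simp only: integral_mult_right_zero integral_point)
  also have "\<dots> \<le> (LINT t|\<mu>. e t)"
  proof (rule integral_mono_AE[OF _ ie])
    show "integrable \<mu> (\<lambda>t. e (a 0) * indicator {a 0} t)" using integrable_point by (rule integrable_mult_right)
    show "AE t in \<mu>. e (a 0) * indicator {a 0} t \<le> e t"
      using supp by eventually_elim (use epos in \<open>auto simp: indicator_def intro: less_imp_le\<close>)
  qed
  also have "\<dots> = (LINT t|\<mu>. real_kernel t y) - (LINT t|\<mu>. real_kernel t x)"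
    unfolding e_def by (intro Bochner_Integration.integral_diff real_kernel_integrable nx)
  finally have "(LINT t|\<mu>. real_kernel t x) < (LINT t|\<mu>. real_kernel t y)" by simp
  moreover have "c1 * x \<le> c1 * y" using c1 xy by (intro mult_left_mono) auto
  ultimately show ?thesis unfolding real_rep[OF nx(1)] real_rep[OF nx(2)] by simp
qed

text \<open>Divided by n, the kernel at - n tends to 0 pointwise and is dominated by 3 / (1 + t^2),
  so only the linear term survives. This identifies \<open>c1\<close> from the growth of
  \<open>m\<close> along the negative axis.\<close>

lemma slope_limit: "(\<lambda>n. Re (m (- of_nat n)) / real n) \<longlonglongrightarrow> - c1"
proof -
  \<comment> \<open>For s >= 2 |a 0| + 1 every support point t satisfies t >= - s/2, so t + s >= s/2
    when t is negative and - s is no pole. The majorant rests on this bound.\<close>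
  obtain n0 :: nat where n0: "real n0 \<ge> 2 * \<bar>a 0\<bar> + 1" using real_arch_simple by blast
  have notin: "- real n \<notin> range a" if "n \<ge> n0" for n
  proof
    assume "- real n \<in> range a"
    then obtain j where "a j = - real n" by auto
    moreover have "a 0 \<le> a j" using mono by (simp add: strict_mono_less_eq)
    ultimately show False using that n0 by linarith
  qed
  have "(\<lambda>n. LINT t|\<mu>. real_kernel t (- real (n + n0)) / real (n + n0)) \<longlonglongrightarrow> (LINT t|\<mu>. 0)"
  proof (rule integral_dominated_convergence[where w = "\<lambda>t. 3 * (1 / (1 + t\<^sup>2))"])
    show "(\<lambda>t. real_kernel t (- real (n + n0)) / real (n + n0)) \<in> borel_measurable \<mu>" for n
      unfolding measurable_cong_sets[OF sets refl] real_kernel_def by measurable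
    show "integrable \<mu> (\<lambda>t. 3 * (1 / (1 + t\<^sup>2)))" using int by (rule integrable_mult_right)
    have "(\<lambda>n. real_kernel t (- real (n + n0)) / real (n + n0)) \<longlonglongrightarrow> 0" for t
    proof -
      have "(\<lambda>n. (1 / (t + real n) - t / (1 + t\<^sup>2)) / real n) \<longlonglongrightarrow> 0"
        by real_asymp
      from LIMSEQ_ignore_initial_segment[OF this, of n0] show ?thesis unfolding real_kernel_def diff_minus_eq_add .
    qed
    then show "AE t in \<mu>. (\<lambda>n. real_kernel t (- real (n + n0)) / real (n + n0)) \<longlonglongrightarrow> 0" by simp
    show "AE t in \<mu>. norm (real_kernel t (- real (n + n0)) / real (n + n0)) \<le> 3 * (1 / (1 + t\<^sup>2))" for n
      using supp
    proof eventually_elim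
      case (elim t)
      define s where "s = real (n + n0)"
      have s: "s \<ge> 2 * \<bar>a 0\<bar> + 1" using n0 by (simp add: s_def)
      have ta: "t \<ge> a 0" using elim mono by (auto simp: strict_mono_less_eq)
      have s1: "s \<ge> 1" "s > 0" and ts: "t + s > 0" using s ta by linarith+
      have q: "(1::real) + t\<^sup>2 > 0" by (simp add: add_pos_nonneg)
      have "real_kernel t (- s) = (1 - t * s) / ((t + s) * (1 + t\<^sup>2))"
        using ts q by (simp add: real_kernel_def field_simps) (simp add: power2_eq_square algebra_simps)
      then have A: "\<bar>real_kernel t (- s)\<bar> = \<bar>1 - t * s\<bar> / ((t + s) * (1 + t\<^sup>2))" using ts q by (simp add: abs_mult)
      have B: "\<bar>1 - t * s\<bar> \<le> 3 * (s * (t + s))"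
      proof (cases "t \<ge> 0")
        case True
        have "\<bar>1 - t * s\<bar> \<le> 1 + t * s" using True s1 by (simp add: abs_le_iff)
        also have "\<dots> \<le> s * s + t * s" using s1 mult_mono[of 1 s 1 s] by simp
        also have "\<dots> \<le> 3 * (s * (t + s))" using True s1 by (simp add: algebra_simps)
        finally show ?thesis .
      next
        case False
        have h: "- t \<le> s / 2" "t + s \<ge> s / 2" using ta s False by linarith+
        have "\<bar>1 - t * s\<bar> = 1 + (- t) * s" using mult_nonpos_nonneg[of t s] False s1 by simp
        also have "\<dots> \<le> s * s + (s / 2) * s" using s1 h mult_mono[of 1 s 1 s] by (intro add_mono mult_right_mono) auto
        also have "\<dots> = 3 * (s * (s / 2))" by simp
        also have "\<dots> \<le> 3 * (s * (t + s))" using h s1 by (intro mult_left_mono) auto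
        finally show ?thesis .
      qed
      have "\<bar>real_kernel t (- s)\<bar> \<le> 3 * (s * (t + s)) / ((t + s) * (1 + t\<^sup>2))"
        unfolding A by (rule divide_right_mono[OF B]) (use ts q in simp)
      also have "\<dots> = (3 * s) * (t + s) / ((1 + t\<^sup>2) * (t + s))" by (simp add: mult_ac)
      also have "\<dots> = 3 * s / (1 + t\<^sup>2)" using ts by (intro mult_divide_mult_cancel_right) auto
      also have "\<dots> = 3 * (1 / (1 + t\<^sup>2)) * s" by simp
      finally show ?case using s1 unfolding s_def[symmetric] by (simp add: abs_of_pos divide_le_eq del: times_divide_eq_right)
    qed
  qed (simp add: sets)
  then have "(\<lambda>n. LINT t|\<mu>. real_kernel t (- real (n + n0)) / real (n + n0)) \<longlonglongrightarrow> 0" by simp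
  moreover have "(\<lambda>n. - c1 + c0 / real (n + n0)) \<longlonglongrightarrow> - c1 + 0"
  proof (intro tendsto_intros)
    have "(\<lambda>n. c0 / real n) \<longlonglongrightarrow> 0" by (rule lim_const_over_n)
    from LIMSEQ_ignore_initial_segment[OF this, of n0] show "(\<lambda>n. c0 / real (n + n0)) \<longlonglongrightarrow> 0" .
  qed
  ultimately have "(\<lambda>n. (- c1 + c0 / real (n + n0)) + (LINT t|\<mu>. real_kernel t (- real (n + n0)) / real (n + n0))) \<longlonglongrightarrow> (- c1 + 0) + 0"
    by (rule tendsto_add[rotated])
  moreover have "Re (m (- of_nat (n + n0))) / real (n + n0) = (- c1 + c0 / real (n + n0)) + (LINT t|\<mu>. real_kernel t (- real (n + n0)) / real (n + n0))" for n
  proof -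
    have "m (- of_nat (n + n0)) = m (of_real (- real (n + n0)))" by simp
    also have "\<dots> = of_real (c1 * (- real (n + n0)) + c0 + (LINT t|\<mu>. real_kernel t (- real (n + n0))))"
      by (rule real_rep[OF notin]) simp
    finally have r: "Re (m (- of_nat (n + n0))) = c1 * (- real (n + n0)) + c0 + (LINT t|\<mu>. real_kernel t (- real (n + n0)))"
      by (simp only: Re_complex_of_real)
    have "real (n + n0) \<noteq> 0" using n0 by linarith
    then show ?thesis unfolding r integral_divide_zero add_divide_distrib mult_minus_right minus_divide_left[symmetric]
      by simp
  qed
  ultimately have "(\<lambda>n. Re (m (- of_nat (n + n0))) / real (n + n0)) \<longlonglongrightarrow> - c1" by simp
  then show ?thesis by (rule LIMSEQ_offset)
qed

end

section \<open>Interlacing of the two spectra\<close>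

lemma strict_mono_range_unique:
  fixes f g :: "nat \<Rightarrow> real"
  assumes f: "strict_mono f" and g: "strict_mono g" and r: "range f = range g"
  shows "f n = g n"
proof (induction n rule: less_induct)
  case (less n)
  obtain j where j: "f n = g j" using r by (metis rangeE rangeI)
  obtain i where i: "g n = f i" using r by (metis rangeE rangeI)
  have "\<not> j < n" using less[of j] j strict_mono_eq[OF f, of n j] by auto
  moreover have "\<not> n < j"
  proof
    assume "n < j"
    then have "f i < f n" using strict_monoD[OF g, of n j] i j by simp
    then have "i < n" using strict_mono_less[OF f] by simp
    then show False using less[of i] i strict_mono_eq[OF g, of n i] by auto
  qed
  ultimately show ?case using j by (metis linorder_neqE_nat)
qed

text \<open>Because (x - a_n) h tends to a negative number, h is positive just left and negative
  just right of each pole. The intermediate value theorem gives a zero in each gap, monotonicity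
  makes it unique, and the only open question is a zero below \<open>a 0\<close>.\<close>

lemma zeros_interlace:
  fixes a b :: "nat \<Rightarrow> real" and h :: "real \<Rightarrow> real"
  assumes a: "strict_mono a" and b: "strict_mono b" and lim: "filterlim a at_top sequentially"
    and cont: "continuous_on (- range a) h"
    and inc: "\<And>x y. x < y \<Longrightarrow> (\<And>j. a j \<notin> {x..y}) \<Longrightarrow> h x < h y"
    and res: "\<And>n. ((\<lambda>x. (x - a n) * h x) \<longlongrightarrow> - g n) (at (a n))" and g: "\<And>n. g n > 0"
    and zeros: "\<And>x. x \<notin> range a \<Longrightarrow> h x = 0 \<longleftrightarrow> x \<in> range b"
    and disj: "range a \<inter> range b = {}"
  shows "(\<forall>n. b n < a n \<and> a n < b (Suc n)) \<or>
    (\<forall>n. a n < b n \<and> b n < a (Suc n)) \<and> (\<forall>x<a 0. h x > 0)"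
proof -
  have near: "\<exists>d>0. \<forall>x. x \<noteq> a n \<and> \<bar>x - a n\<bar> < d \<longrightarrow> (x - a n) * h x < 0" for n
  proof -
    have "\<forall>\<^sub>F x in at (a n). (x - a n) * h x < 0"
      using g[of n] by (intro order_tendstoD(2)[OF res]) simp
    then show ?thesis by (auto simp: eventually_at dist_real_def)
  qed
  have left: "\<exists>x. c < x \<and> x < a n \<and> h x > 0" if "c < a n" for c n
  proof -
    obtain d where d: "d > 0" "\<And>x. x \<noteq> a n \<Longrightarrow> \<bar>x - a n\<bar> < d \<Longrightarrow> (x - a n) * h x < 0" using near by blast
    define x where "x = max (a n - d / 2) ((c + a n) / 2)"
    have x: "c < x" "x < a n" "\<bar>x - a n\<bar> < d" using that d(1) by (auto simp: x_def max_def field_simps)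
    then show ?thesis using d(2)[of x] by (auto simp: mult_less_0_iff)
  qed
  have right: "\<exists>x. a n < x \<and> x < c \<and> h x < 0" if "a n < c" for c n
  proof -
    obtain d where d: "d > 0" "\<And>x. x \<noteq> a n \<Longrightarrow> \<bar>x - a n\<bar> < d \<Longrightarrow> (x - a n) * h x < 0" using near by blast
    define x where "x = min (a n + d / 2) ((c + a n) / 2)"
    have x: "x < c" "a n < x" "\<bar>x - a n\<bar> < d" using that d(1) by (auto simp: x_def min_def field_simps)
    then show ?thesis using d(2)[of x] by (auto simp: mult_less_0_iff)
  qed
  have ivt: "\<exists>z. x \<le> z \<and> z \<le> y \<and> h z = 0" if "x \<le> y" "h x \<le> 0" "0 \<le> h y" "\<And>j. a j \<notin> {x..y}" for x y
  proof (rule IVT'[of h x 0 y])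
    show "continuous_on {x..y} h" using that(4) by (intro continuous_on_subset[OF cont]) auto
  qed (use that in auto)
  have uniq: "x = y" if "h x = 0" "h y = 0" "\<And>j. a j \<notin> {min x y..max x y}" for x y
  proof (rule ccontr)
    assume "x \<noteq> y"
    then consider "x < y" | "y < x" by linarith
    then show False using inc[of x y] inc[of y x] that by cases (auto simp: min_def max_def)
  qed
  have gap: "a j \<le> a n \<or> a (Suc n) \<le> a j" for j n
    using strict_mono_less_eq[OF a] by (cases "j \<le> n") auto
  have low: "a 0 \<le> a j" for j using strict_mono_less_eq[OF a] by simp
  have "\<exists>z. a n < z \<and> z < a (Suc n) \<and> h z = 0" for n
  proof -
    obtain x where x: "a n < x" "x < a (Suc n)" "h x < 0" using right[of n "a (Suc n)"] strict_monoD[OF a, of n "Suc n"] by auto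
    obtain y where y: "x < y" "y < a (Suc n)" "h y > 0" using left[of x "Suc n"] x by auto
    have "a j \<notin> {x..y}" for j using gap[of j n] x y by auto
    then obtain z where "x \<le> z" "z \<le> y" "h z = 0" using ivt[of x y] x y by (auto simp: less_imp_le)
    then show ?thesis using x y by (intro exI[of _ z]) auto
  qed
  then obtain c where c: "\<And>n. a n < c n" "\<And>n. c n < a (Suc n)" "\<And>n. h (c n) = 0" by metis
  have cmono: "strict_mono c"
    by (rule strict_monoI_Suc) (meson c less_trans)
  have cout: "c n \<notin> range a" for n
  proof
    assume "c n \<in> range a"
    then obtain j where "c n = a j" by auto
    then show False using gap[of j n] c(1)[of n] c(2)[of n] by auto
  qed
  have above: "x \<in> range c" if x: "x > a 0" "h x = 0" "x \<notin> range a" for x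
  proof -
    obtain k where "x < a k" using filterlim_at_top_dense[THEN iffD1, OF lim, rule_format, of x]
      by (auto simp: eventually_sequentially)
    define k where "k = (LEAST k. x < a k)"
    have k: "x < a k" unfolding k_def by (rule LeastI) fact
    have "k \<noteq> 0" using k x by (auto intro: notI)
    then obtain n where n: "k = Suc n" by (cases k) auto
    then have "\<not> x < a n" unfolding k_def by (metis not_less_Least lessI)
    then have xn: "a n < x" "x < a (Suc n)" using x k n by (auto simp: not_less order_le_less)
    have "x = c n"
    proof (rule uniq)
      show "a j \<notin> {min x (c n)..max x (c n)}" for j using gap[of j n] xn c(1,2)[of n] by auto
    qed (use x c in auto)
    then show ?thesis by simp
  qed
  \<comment> \<open>A nonpositive value below \<open>a 0\<close> forces a zero \<open>z\<close>
    there, as h is positive just left of \<open>a 0\<close>. The zeros are then \<open>z\<close>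
    followed by the gap zeros \<open>c\<close>, an index shift by one (\<open>c'\<close>); otherwise
    they are \<open>c\<close> itself.\<close>
  show ?thesis
  proof (cases "\<exists>x<a 0. h x \<le> 0")
    case False
    have "range b = range c"
    proof (intro equalityI subsetI)
      fix x assume "x \<in> range b"
      then have x: "x \<notin> range a" "h x = 0" using disj zeros by blast+
      have "x > a 0" using False x by (metis linorder_neqE_linordered_idom order_refl rangeI)
      then show "x \<in> range c" using above x by blast
    next
      fix x assume "x \<in> range c"
      then show "x \<in> range b" using zeros cout c(3) by blast
    qed
    then have "b n = c n" for n by (rule strict_mono_range_unique[OF b cmono])
    then show ?thesis using c False by (auto simp: not_le)
  next
    case True
    then obtain x where x: "x < a 0" "h x \<le> 0" by blast
    obtain y where y: "x < y" "y < a 0" "h y > 0" using left[OF x(1)] by blast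
    have "a j \<notin> {x..y}" for j using low[of j] y by auto
    then have "\<exists>z. x \<le> z \<and> z \<le> y \<and> h z = 0" using x y by (intro ivt) auto
    then obtain z where "z \<le> y" "h z = 0" by blast
    then have z: "z < a 0" "h z = 0" using y by auto
    define c' where "c' = (\<lambda>n. case n of 0 \<Rightarrow> z | Suc k \<Rightarrow> c k)"
    have c'mono: "strict_mono c'"
    proof (rule strict_monoI_Suc)
      show "c' n < c' (Suc n)" for n
        using z(1) c(1)[of 0] strict_monoD[OF cmono] by (cases n) (auto simp: c'_def)
    qed
    have "range b = range c'"
    proof (intro equalityI subsetI)
      fix w assume "w \<in> range b"
      then have w: "w \<notin> range a" "h w = 0" using disj zeros by blast+
      show "w \<in> range c'"
      proof (cases "w > a 0")
        case True
        then obtain n where "w = c n" using above w by blast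
        then have "w = c' (Suc n)" by (simp add: c'_def)
        then show ?thesis by blast
      next
        case False
        then have "w < a 0" using w by (metis linorder_neqE_linordered_idom rangeI)
        have "w = z"
        proof (rule uniq)
          show "a j \<notin> {min w z..max w z}" for j using low[of j] \<open>w < a 0\<close> z(1) by auto
        qed (use w z in auto)
        then have "w = c' 0" by (simp add: c'_def)
        then show ?thesis by blast
      qed
    next
      fix w assume "w \<in> range c'"
      then obtain n where n: "w = c' n" by auto
      have zout: "z \<notin> range a" using z(1) low by (auto simp: not_le[symmetric])
      show "w \<in> range b"
        using zeros[OF zout] z(2) zeros[OF cout] c(3) by (cases n) (auto simp: n c'_def)
    qed
    then have "b n = c' n" for n by (rule strict_mono_range_unique[OF b c'mono])
    then have "b n < a n \<and> a n < b (Suc n)" for n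
      using z(1) c by (cases n) (auto simp: c'_def)
    then show ?thesis by blast
  qed
qed

section \<open>The two spectra and the spectral measure of one potential\<close>

text \<open>Eigenvalues are indexed from \<open>0\<close> here, so \<open>a\<close> and \<open>b\<close> stand for the shifted sequences of the
  final theorem.\<close>

locale spectral_data =
  fixes q :: "real \<Rightarrow> real" and \<alpha>1 \<alpha>2 \<beta> :: real and a b :: "nat \<Rightarrow> real" and \<mu> :: "real measure" and c1 c0 :: real
  assumes q: "q absolutely_integrable_on {0<..<pi}"
    and \<alpha>: "\<alpha>1 \<in> {0..<pi}" "\<alpha>2 \<in> {0..<pi}"
    and s_nz: "sin (\<alpha>2 - \<alpha>1) \<noteq> 0"
    and mono_a: "strict_mono a" and spec_a: "spectrum q \<alpha>2 \<beta> = range (\<lambda>n. complex_of_real (a n))"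
    and mono_b: "strict_mono b" and spec_b: "spectrum q \<alpha>1 \<beta> = range (\<lambda>n. complex_of_real (b n))"
    and sets_mu: "sets \<mu> = sets borel"
    and supp_mu: "AE t in \<mu>. complex_of_real t \<in> spectrum q \<alpha>2 \<beta>"
    and int_mu: "integrable \<mu> (\<lambda>t. 1 / (1 + t\<^sup>2))"
    and rep_mu: "\<And>z. z \<notin> spectrum q \<alpha>2 \<beta> \<Longrightarrow>
        m_fun q \<alpha>1 \<alpha>2 \<beta> z = of_real c1 * z + of_real c0 +
          (LINT t|\<mu>. 1 / (of_real t - z) - of_real (t / (1 + t\<^sup>2)))"
begin

definition u :: "complex \<Rightarrow> complex" where "u z = sol q \<beta> z 0"
definition v :: "complex \<Rightarrow> complex" where "v z = d1 (sol q \<beta> z) 0"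
definition m :: "complex \<Rightarrow> complex" where "m = m_fun q \<alpha>1 \<alpha>2 \<beta>"
definition ch1 :: "complex \<Rightarrow> complex" where "ch1 z = of_real (cos \<alpha>1) * u z - of_real (sin \<alpha>1) * v z"
definition ch2 :: "complex \<Rightarrow> complex" where "ch2 z = of_real (cos \<alpha>2) * u z - of_real (sin \<alpha>2) * v z"

lemma ch_eq: "ch1 = char_fun q \<alpha>1 \<beta>" "ch2 = char_fun q \<alpha>2 \<beta>"
  by (simp_all add: fun_eq_iff ch1_def ch2_def char_fun_def[OF q] u_def v_def)

lemma ch_holomorphic: "ch1 holomorphic_on X" "ch2 holomorphic_on X"
  unfolding ch_eq using char_fun_holomorphic[OF q] holomorphic_on_subset by blast+

lemma ch1_zero_iff: "ch1 z = 0 \<longleftrightarrow> z \<in> range (\<lambda>n. complex_of_real (b n))"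
  unfolding ch_eq spec_b[symmetric] using spectrum_iff_char_fun[OF q] by blast

lemma ch2_zero_iff: "ch2 z = 0 \<longleftrightarrow> z \<in> range (\<lambda>n. complex_of_real (a n))"
  unfolding ch_eq spec_a[symmetric] using spectrum_iff_char_fun[OF q] by blast

lemma m_eq: "m z = 1 / of_real (sin (\<alpha>2 - \<alpha>1)) * (ch1 z / ch2 z)"
  by (simp add: m_def m_fun_def ch1_def ch2_def u_def v_def)

text \<open>The two boundary forms are linear in the values at 0 with determinant sin (\<alpha>2 -
  \<alpha>1) up to sign. Common vanishing would give zero data at 0 and hence the zero solution,
  against the data at pi.\<close>

lemma ch_not_both_zero: "ch1 z \<noteq> 0 \<or> ch2 z \<noteq> 0"
proof (rule ccontr)
  assume "\<not> ?thesis"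
  then have 0: "ch1 z = 0" "ch2 z = 0" by auto
  have s: "complex_of_real (sin (\<alpha>2 - \<alpha>1)) = of_real (sin \<alpha>2) * of_real (cos \<alpha>1) - of_real (cos \<alpha>2) * of_real (sin \<alpha>1)"
    by (simp add: sin_diff)
  have "of_real (sin (\<alpha>2 - \<alpha>1)) * u z = of_real (sin \<alpha>2) * ch1 z - of_real (sin \<alpha>1) * ch2 z"
    "of_real (sin (\<alpha>2 - \<alpha>1)) * v z = of_real (cos \<alpha>2) * ch1 z - of_real (cos \<alpha>1) * ch2 z"
    unfolding s ch1_def ch2_def by (simp_all add: algebra_simps)
  then have uv: "u z = 0" "v z = 0" using 0 s_nz by auto
  let ?p = "\<lambda>x. complex_of_real (q x)"
  have zz: "ivp (\<lambda>x. ?p x - z) (\<lambda>x. 0) (\<lambda>x. 0) (\<lambda>x. 0)" unfolding ivp_def by simp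
  have "sol q \<beta> z pi = 0" "d1 (sol q \<beta> z) pi = 0"
    using ivp_unique[OF shift_integrable[OF qc_integrable[OF q]] _ sol_ivp[OF q] zz, of \<beta> pi] uv
    by (simp_all add: u_def v_def)
  then show False using sol_spec[OF q, of \<beta> z] sin_cos_squared_add[of \<beta>] by simp
qed

lemma ab_disjoint: "range a \<inter> range b = {}"
proof -
  have "x \<notin> range b" if "x \<in> range a" for x
  proof -
    have "ch2 (of_real x) = 0" using that by (auto simp: ch2_zero_iff)
    then have "ch1 (of_real x) \<noteq> 0" using ch_not_both_zero by blast
    then show ?thesis by (auto simp: ch1_zero_iff)
  qed
  then show ?thesis by blast
qed

text \<open>If the eigenvalues were bounded, their limit would be a zero of \<open>ch2\<close> by
  continuity, hence equal to some \<open>a j\<close>, which \<open>a (Suc j)\<close>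
  exceeds.\<close>

lemma a_at_top: "filterlim a at_top sequentially"
proof (rule ccontr)
  assume not: "\<not> ?thesis"
  have "\<exists>B. \<forall>n. a n \<le> B"
  proof (rule ccontr)
    assume "\<not> (\<exists>B. \<forall>n. a n \<le> B)"
    then have unb: "\<exists>n. a n > B" for B by (auto simp: not_le)
    have "\<forall>\<^sub>F n in sequentially. B \<le> a n" for B
    proof -
      obtain n where "a n > B" using unb by blast
      then have "B \<le> a k" if "k \<ge> n" for k using strict_mono_less_eq[OF mono_a, of n k] that by linarith
      then show ?thesis by (auto simp: eventually_sequentially)
    qed
    then show False using not by (simp add: filterlim_at_top)
  qed
  then obtain B where B: "\<And>n. a n \<le> B" by blast
  obtain L where L: "a \<longlonglongrightarrow> L" "\<And>i. a i \<le> L"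
    using incseq_convergent[OF strict_mono_mono[OF mono_a], of B] B by blast
  have "isCont ch2 (of_real L)"
    using holomorphic_on_imp_continuous_on[OF ch_holomorphic(2)[of UNIV]] continuous_on_eq_continuous_at by blast
  then have "(\<lambda>n. ch2 (of_real (a n))) \<longlonglongrightarrow> ch2 (of_real L)"
    by (rule isCont_tendsto_compose) (intro tendsto_intros L)
  moreover have "ch2 (of_real (a n)) = 0" for n by (simp add: ch2_zero_iff)
  ultimately have "ch2 (of_real L) = 0" by (simp add: LIMSEQ_const_iff)
  then obtain j where "L = a j" by (auto simp: ch2_zero_iff)
  then show False using L(2)[of "Suc j"] strict_monoD[OF mono_a, of j "Suc j"] by simp
qed

sublocale discrete_herglotz \<mu> a c1 c0 m
proof
  show "AE t in \<mu>. t \<in> range a" using supp_mu unfolding spec_a by eventually_elim auto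
  show "m z = of_real c1 * z + of_real c0 + (LINT t|\<mu>. hkernel t z)" if "z \<notin> range (\<lambda>n. complex_of_real (a n))" for z
    using rep_mu[of z] that unfolding spec_a m_def hkernel_def by blast
qed (use sets_mu int_mu mono_a a_at_top in auto)

lemma m_holomorphic: "m holomorphic_on - range (\<lambda>n. complex_of_real (a n))"
proof -
  have "m = (\<lambda>z. 1 / of_real (sin (\<alpha>2 - \<alpha>1)) * (ch1 z / ch2 z))" by (simp add: fun_eq_iff m_eq)
  then show ?thesis by (auto intro!: holomorphic_intros ch_holomorphic simp: ch2_zero_iff)
qed

lemma m_zero_iff: "z \<notin> range (\<lambda>n. complex_of_real (a n)) \<Longrightarrow> m z = 0 \<longleftrightarrow> z \<in> range (\<lambda>n. complex_of_real (b n))"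
  using s_nz by (simp add: m_eq ch2_zero_iff[symmetric] ch1_zero_iff[symmetric])

text \<open>Multiplying the residue limit by the difference quotient of \<open>ch2\<close> gives
  mass times derivative on one side and, up to sign,
  \<open>ch1 / sin (\<alpha>2 - \<alpha>1)\<close> on the other. The latter is nonzero at an
  eigenvalue.\<close>

lemma mass_pos: "measure \<mu> {a n} > 0"
proof -
  let ?x = "complex_of_real (a n)"
  have h2: "ch2 ?x = 0" by (simp add: ch2_zero_iff)
  then have h1: "ch1 ?x \<noteq> 0" using ch_not_both_zero by blast
  obtain D where "(ch2 has_field_derivative D) (at ?x)"
    using ch_holomorphic(2)[of UNIV] by (auto simp: holomorphic_on_open)
  then have D: "((\<lambda>z. (ch2 z - ch2 ?x) / (z - ?x)) \<longlongrightarrow> D) (at ?x)" by (simp add: has_field_derivative_iff)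
  have "((\<lambda>z. (z - ?x) * m z * ((ch2 z - ch2 ?x) / (z - ?x))) \<longlongrightarrow> - of_real (measure \<mu> {a n}) * D) (at ?x)"
    by (intro tendsto_mult residue_limit D)
  moreover have "((\<lambda>z. (z - ?x) * m z * ((ch2 z - ch2 ?x) / (z - ?x))) \<longlongrightarrow> ch1 ?x / of_real (sin (\<alpha>2 - \<alpha>1))) (at ?x)"
  proof (rule Lim_transform_eventually)
    have "isCont ch1 ?x"
      using holomorphic_on_imp_continuous_on[OF ch_holomorphic(1)[of UNIV]] continuous_on_eq_continuous_at by blast
    then show "((\<lambda>z. ch1 z / of_real (sin (\<alpha>2 - \<alpha>1))) \<longlongrightarrow> ch1 ?x / of_real (sin (\<alpha>2 - \<alpha>1))) (at ?x)"
      using s_nz by (intro tendsto_intros) (auto simp: isCont_def)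
    obtain r where r: "r > 0" "\<And>j. a j \<noteq> a n \<Longrightarrow> r \<le> \<bar>a j - a n\<bar>" using isolated[of "a n"] by blast
    have nz: "ch2 z \<noteq> 0" if "z \<noteq> ?x" "dist z ?x < r" for z
    proof
      assume "ch2 z = 0"
      then obtain j where j: "z = of_real (a j)" by (auto simp: ch2_zero_iff)
      then have "a j \<noteq> a n" using that by auto
      moreover have "dist z ?x = \<bar>a j - a n\<bar>" unfolding j dist_norm by (simp flip: of_real_diff)
      ultimately show False using r(2)[of j] that by linarith
    qed
    have "\<forall>\<^sub>F z in at ?x. z \<noteq> ?x \<and> dist z ?x < r" using r(1) by (auto simp: eventually_at)
    then show "\<forall>\<^sub>F z in at ?x. ch1 z / of_real (sin (\<alpha>2 - \<alpha>1)) = (z - ?x) * m z * ((ch2 z - ch2 ?x) / (z - ?x))"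
    proof eventually_elim
      case (elim z)
      then show ?case using nz[of z] by (simp add: m_eq h2)
    qed
  qed
  ultimately have "- of_real (measure \<mu> {a n}) * D = ch1 ?x / of_real (sin (\<alpha>2 - \<alpha>1))"
    by (rule tendsto_unique[rotated]) simp
  then have "measure \<mu> {a n} \<noteq> 0" using h1 s_nz by auto
  then show ?thesis using measure_nonneg[of \<mu> "{a n}"] by linarith
qed

text \<open>At z = - t^2 one has v = - t u + O(u), so \<open>ch2\<close> is close to (cos \<alpha>2
  + t sin \<alpha>2) u. For sin \<alpha>2 = 0 this has modulus |u|, otherwise order t |u|; here
  \<alpha>2 in [0, pi) ensures that the sine is not negative.\<close>

lemma negative_axis:
  obtains T C where "T \<ge> 1" "C \<ge> 0" "\<And>t. t \<ge> T \<Longrightarrow> u (- (of_real t)\<^sup>2) \<noteq> 0"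
    "\<And>t. t \<ge> T \<Longrightarrow> norm (v (- (of_real t)\<^sup>2) + of_real t * u (- (of_real t)\<^sup>2)) \<le> C * norm (u (- (of_real t)\<^sup>2))"
    "\<And>t x. t \<ge> T \<Longrightarrow> x \<in> {0..pi} \<Longrightarrow> norm (sol q \<beta> (- (of_real t)\<^sup>2) x) \<le> C * exp (- t * x) * norm (u (- (of_real t)\<^sup>2))"
    "\<And>t. t \<ge> T \<Longrightarrow> norm (ch2 (- (of_real t)\<^sup>2)) \<ge> (if sin \<alpha>2 = 0 then 1 else sin \<alpha>2 / 2 * t) * norm (u (- (of_real t)\<^sup>2))"
proof -
  obtain k0 C where k: "k0 \<ge> 1" "C \<ge> 0"
    "\<And>\<kappa>. norm \<kappa> \<ge> k0 \<Longrightarrow> Re \<kappa> \<ge> 1 \<Longrightarrow> sol q \<beta> (- \<kappa>\<^sup>2) 0 \<noteq> 0"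
    "\<And>\<kappa> x. norm \<kappa> \<ge> k0 \<Longrightarrow> Re \<kappa> \<ge> 1 \<Longrightarrow> x \<in> {0..pi} \<Longrightarrow>
       norm (sol q \<beta> (- \<kappa>\<^sup>2) x) \<le> C * exp (- Re \<kappa> * x) * norm (sol q \<beta> (- \<kappa>\<^sup>2) 0)"
    "\<And>t. t \<ge> k0 \<Longrightarrow> norm (d1 (sol q \<beta> (- (of_real t)\<^sup>2)) 0 + of_real t * sol q \<beta> (- (of_real t)\<^sup>2) 0) \<le> C * norm (sol q \<beta> (- (of_real t)\<^sup>2) 0)"
    by (rule sol_asymptotics[OF q, of \<beta>], rule that)
  \<comment> \<open>With these summands t sin \<alpha>2 >= 2 (C sin \<alpha>2 + 1), so the errors
    use up at most half of t sin \<alpha>2.\<close>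
  define T where "T = k0 + 2 * C + (if sin \<alpha>2 = 0 then 0 else 2 / sin \<alpha>2)"
  have s2: "sin \<alpha>2 \<ge> 0" using \<alpha> by (intro sin_ge_zero) auto
  have T: "T \<ge> k0" using k s2 by (simp add: T_def)
  have ev: "norm (v (- (of_real t)\<^sup>2) + of_real t * u (- (of_real t)\<^sup>2)) \<le> C * norm (u (- (of_real t)\<^sup>2))" if "t \<ge> T" for t
    using k(5)[of t] that T by (simp add: u_def v_def)
  show ?thesis
  proof (rule that[of T C])
    show "T \<ge> 1" "C \<ge> 0" using T k by auto
    fix t assume t: "t \<ge> T"
    have kt: "norm (complex_of_real t) \<ge> k0" "Re (complex_of_real t) \<ge> 1" using t T k(1) by auto
    show "u (- (of_real t)\<^sup>2) \<noteq> 0" using k(3)[OF kt] by (simp add: u_def)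
    show "norm (v (- (of_real t)\<^sup>2) + of_real t * u (- (of_real t)\<^sup>2)) \<le> C * norm (u (- (of_real t)\<^sup>2))" by (rule ev[OF t])
    show "norm (sol q \<beta> (- (of_real t)\<^sup>2) x) \<le> C * exp (- t * x) * norm (u (- (of_real t)\<^sup>2))" if "x \<in> {0..pi}" for x
      using k(4)[OF kt that] by (simp add: u_def)
    define U V where "U = u (- (of_real t)\<^sup>2)" and "V = v (- (of_real t)\<^sup>2)"
    have UV: "norm (V + of_real t * U) \<le> C * norm U" using ev[OF t] by (simp add: U_def V_def)
    show "norm (ch2 (- (of_real t)\<^sup>2)) \<ge> (if sin \<alpha>2 = 0 then 1 else sin \<alpha>2 / 2 * t) * norm (u (- (of_real t)\<^sup>2))"
    proof (cases "sin \<alpha>2 = 0")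
      case True
      then have "\<bar>cos \<alpha>2\<bar> = 1" using sin_cos_squared_add[of \<alpha>2] by (auto simp: power2_eq_1_iff)
      then show ?thesis using True by (simp add: ch2_def norm_mult)
    next
      case False
      then have s: "sin \<alpha>2 > 0" using s2 by simp
      have "t \<ge> 2 * C + 2 / sin \<alpha>2" using t False k(1) by (simp add: T_def)
      then have st: "sin \<alpha>2 * t \<ge> sin \<alpha>2 * (2 * C) + 2" using s mult_left_mono[of "2 * C + 2 / sin \<alpha>2" t "sin \<alpha>2"]
        by (simp add: distrib_left)
      have "of_real (sin \<alpha>2 * t) * U = ch2 (- (of_real t)\<^sup>2) - of_real (cos \<alpha>2) * U + of_real (sin \<alpha>2) * (V + of_real t * U)"
        by (simp add: ch2_def U_def V_def algebra_simps)
      then have "norm (of_real (sin \<alpha>2 * t) * U) \<le> norm (ch2 (- (of_real t)\<^sup>2)) + norm (of_real (cos \<alpha>2) * U) + norm (of_real (sin \<alpha>2) * (V + of_real t * U))"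
        by (simp only:) (intro order_trans[OF norm_triangle_ineq] add_right_mono norm_triangle_ineq4)
      moreover have "norm (of_real (cos \<alpha>2) * U) \<le> 1 * norm U" unfolding norm_mult by (intro mult_right_mono) auto
      moreover have "norm (of_real (sin \<alpha>2) * (V + of_real t * U)) \<le> sin \<alpha>2 * (C * norm U)"
        unfolding norm_mult using UV s by (simp add: mult_left_mono)
      moreover have "norm (of_real (sin \<alpha>2 * t) * U) = sin \<alpha>2 * t * norm U"
        unfolding norm_mult norm_of_real using s t T k(1) by simp
      ultimately have "sin \<alpha>2 * t * norm U \<le> norm (ch2 (- (of_real t)\<^sup>2)) + norm U + sin \<alpha>2 * C * norm U" by simp
      moreover have "(sin \<alpha>2 * (2 * C) + 2) * norm U \<le> sin \<alpha>2 * t * norm U" using st by (intro mult_right_mono) auto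
      ultimately have "sin \<alpha>2 / 2 * t * norm U \<le> norm (ch2 (- (of_real t)\<^sup>2))" by (simp add: algebra_simps)
      then show ?thesis using False by (simp add: U_def)
    qed
  qed
qed

lemma neg_nat_sqrt: "- of_nat n = - (complex_of_real (sqrt (real n)))\<^sup>2"
  by (simp flip: of_real_power)

text \<open>On the negative axis \<open>m\<close> is O(sqrt |z|) by the asymptotics of the
  solutions, which is incompatible with a linear term in the representation.\<close>

lemma slope_zero: "c1 = 0"
proof -
  obtain T C where T: "T \<ge> 1" "C \<ge> 0" "\<And>t. t \<ge> T \<Longrightarrow> u (- (of_real t)\<^sup>2) \<noteq> 0"
    "\<And>t. t \<ge> T \<Longrightarrow> norm (v (- (of_real t)\<^sup>2) + of_real t * u (- (of_real t)\<^sup>2)) \<le> C * norm (u (- (of_real t)\<^sup>2))"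
    "\<And>t. t \<ge> T \<Longrightarrow> norm (ch2 (- (of_real t)\<^sup>2)) \<ge> (if sin \<alpha>2 = 0 then 1 else sin \<alpha>2 / 2 * t) * norm (u (- (of_real t)\<^sup>2))"
    by (rule negative_axis, rule that)
  have s2: "sin \<alpha>2 \<ge> 0" using \<alpha> by (intro sin_ge_zero) auto
  define \<delta> where "\<delta> = (if sin \<alpha>2 = 0 then 1 else sin \<alpha>2 / 2)"
  have \<delta>: "\<delta> > 0" using s2 by (auto simp: \<delta>_def)
  define K where "K = 1 / (\<bar>sin (\<alpha>2 - \<alpha>1)\<bar> * \<delta>)"
  have bound: "norm (m (- (of_real t)\<^sup>2)) \<le> K * (1 + C + t)" if t: "t \<ge> T" for t
  proof -
    define U V where "U = u (- (of_real t)\<^sup>2)" and "V = v (- (of_real t)\<^sup>2)"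
    have U: "norm U > 0" using T(3)[OF t] by (simp add: U_def)
    have t1: "t \<ge> 1" using t T by simp
    have "norm V \<le> norm (V + of_real t * U) + norm (of_real t * U)"
      using norm_triangle_ineq4[of "V + of_real t * U" "of_real t * U"] by simp
    then have nV: "norm V \<le> (C + t) * norm U" using T(4)[OF t] t1 by (simp add: U_def V_def norm_mult algebra_simps)
    have "norm (ch1 (- (of_real t)\<^sup>2)) \<le> norm (of_real (cos \<alpha>1) * U) + norm (of_real (sin \<alpha>1) * V)"
      unfolding ch1_def U_def V_def by (rule norm_triangle_ineq4)
    also have "\<dots> \<le> 1 * norm U + 1 * norm V" unfolding norm_mult by (intro add_mono mult_right_mono) auto
    also have "\<dots> \<le> (1 + C + t) * norm U" using nV by (simp add: algebra_simps)
    finally have n1: "norm (ch1 (- (of_real t)\<^sup>2)) \<le> (1 + C + t) * norm U" .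
    have "\<delta> \<le> (if sin \<alpha>2 = 0 then 1 else sin \<alpha>2 / 2 * t)"
      using t1 s2 by (simp add: \<delta>_def mult_le_cancel_left1)
    then have "\<delta> * norm U \<le> (if sin \<alpha>2 = 0 then 1 else sin \<alpha>2 / 2 * t) * norm U" by (rule mult_right_mono) simp
    also have "\<dots> \<le> norm (ch2 (- (of_real t)\<^sup>2))" unfolding U_def by (rule T(5)[OF t])
    finally have n2: "\<delta> * norm U \<le> norm (ch2 (- (of_real t)\<^sup>2))" .
    have "norm (m (- (of_real t)\<^sup>2)) = 1 / \<bar>sin (\<alpha>2 - \<alpha>1)\<bar> * (norm (ch1 (- (of_real t)\<^sup>2)) / norm (ch2 (- (of_real t)\<^sup>2)))"
      unfolding m_eq by (simp add: norm_mult norm_divide)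
    also have "\<dots> \<le> 1 / \<bar>sin (\<alpha>2 - \<alpha>1)\<bar> * (((1 + C + t) * norm U) / (\<delta> * norm U))"
      using n1 n2 \<delta> U T(2) t1 by (intro mult_left_mono frac_le) auto
    also have "\<dots> = K * (1 + C + t)" using U by (simp add: K_def)
    finally show ?thesis .
  qed
  have "(\<lambda>n. Re (m (- of_nat n)) / real n) \<longlonglongrightarrow> 0"
  proof (rule Lim_null_comparison)
    have "\<forall>\<^sub>F n in sequentially. T \<le> sqrt (real n)"
      by real_asymp
    then show "\<forall>\<^sub>F n in sequentially. norm (Re (m (- of_nat n)) / real n) \<le> K * ((1 + C + sqrt (real n)) / real n)"
    proof eventually_elim
      case (elim n)
      have "\<bar>Re (m (- of_nat n))\<bar> \<le> K * (1 + C + sqrt (real n))"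
        unfolding neg_nat_sqrt using abs_Re_le_cmod bound[OF elim] by (rule order_trans)
      then show ?case by (simp add: divide_right_mono)
    qed
    have "(\<lambda>n. (1 + C + sqrt (real n)) / real n) \<longlonglongrightarrow> 0" by real_asymp
    then show "(\<lambda>n. K * ((1 + C + sqrt (real n)) / real n)) \<longlonglongrightarrow> 0" by (rule tendsto_mult_right_zero)
  qed
  then show ?thesis using slope_limit LIMSEQ_unique by fastforce
qed

text \<open>The second pattern requires \<open>m\<close> to be positive below \<open>a 0\<close>. If
  sin \<alpha>2 = 0, then \<alpha>2 = 0 and \<open>m\<close> behaves like - sqrt |z| far to the
  left, which rules this pattern out.\<close>

lemma interlacing:
  "(\<forall>n. b n < a n \<and> a n < b (Suc n)) \<or> (\<forall>n. a n < b n \<and> b n < a (Suc n)) \<and> sin \<alpha>2 \<noteq> 0"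
proof -
  define h where "h = (\<lambda>x. Re (m (of_real x)))"
  have mh: "m (of_real x) = of_real (h x)" if "x \<notin> range a" for x
    using real_rep[OF that] by (simp add: h_def)
  have notin: "complex_of_real x \<notin> range (\<lambda>n. complex_of_real (a n))" if "x \<notin> range a" for x using that by auto
  have "(\<forall>n. b n < a n \<and> a n < b (Suc n)) \<or>
    (\<forall>n. a n < b n \<and> b n < a (Suc n)) \<and> (\<forall>x<a 0. h x > 0)"
  proof (rule zeros_interlace[OF mono_a mono_b a_at_top])
    have "continuous_on (complex_of_real ` (- range a)) m"
      using notin by (intro continuous_on_subset[OF holomorphic_on_imp_continuous_on[OF m_holomorphic]]) auto
    then have "continuous_on (- range a) (\<lambda>x. m (complex_of_real x))"
      by (rule continuous_on_compose2) (intro continuous_intros, simp)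
    then show "continuous_on (- range a) h" unfolding h_def by (rule continuous_on_Re)
    show "h x < h y" if "x < y" "\<And>j. a j \<notin> {x..y}" for x y
      unfolding h_def using that mass_pos slope_zero by (intro strictly_increasing) auto
    show "0 < measure \<mu> {a n}" for n by (rule mass_pos)
    show "((\<lambda>x. (x - a n) * h x) \<longlongrightarrow> - measure \<mu> {a n}) (at (a n))" for n
    proof -
      have "filterlim complex_of_real (at (of_real (a n))) (at (a n))"
        by (auto simp: filterlim_at eventually_at_filter intro!: tendsto_intros)
      from filterlim_compose[OF residue_limit this]
      have "((\<lambda>x. Re ((of_real x - of_real (a n)) * m (of_real x))) \<longlongrightarrow> Re (- of_real (measure \<mu> {a n}))) (at (a n))"
        by (intro tendsto_intros)
      then show ?thesis by (simp add: h_def flip: of_real_diff)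
    qed
    show "h x = 0 \<longleftrightarrow> x \<in> range b" if "x \<notin> range a" for x
    proof -
      have "h x = 0 \<longleftrightarrow> m (of_real x) = 0" using mh[OF that] by simp
      also have "\<dots> \<longleftrightarrow> x \<in> range b" using m_zero_iff[OF notin[OF that]] by auto
      finally show ?thesis .
    qed
    show "range a \<inter> range b = {}" by (rule ab_disjoint)
  qed
  moreover have "\<exists>x<a 0. h x \<le> 0" if s2: "sin \<alpha>2 = 0"
  proof -
    have "\<alpha>2 = 0"
    proof (rule ccontr)
      assume "\<alpha>2 \<noteq> 0"
      then have "sin \<alpha>2 > 0" using \<alpha> by (intro sin_gt_zero) auto
      then show False using s2 by simp
    qed
    have s1: "sin \<alpha>1 > 0"
    proof -
      have "\<alpha>1 \<noteq> 0" using s_nz \<open>\<alpha>2 = 0\<close> by auto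
      then show ?thesis using \<alpha> by (intro sin_gt_zero) auto
    qed
    obtain T C where T: "T \<ge> 1" "C \<ge> 0" "\<And>t. t \<ge> T \<Longrightarrow> u (- (of_real t)\<^sup>2) \<noteq> 0"
      "\<And>t. t \<ge> T \<Longrightarrow> norm (v (- (of_real t)\<^sup>2) + of_real t * u (- (of_real t)\<^sup>2)) \<le> C * norm (u (- (of_real t)\<^sup>2))"
      by (rule negative_axis, rule that)
    \<comment> \<open>C and |cot \<alpha>1| are what t has to outweigh in Re m <= C - t - cot
      \<alpha>1; the last two summands put - t^2 below \<open>a 0\<close>.\<close>
    define t where "t = T + C + \<bar>cos \<alpha>1 / sin \<alpha>1\<bar> + \<bar>a 0\<bar> + 1"
    have t: "t \<ge> T" "t \<ge> 1" using T by (auto simp: t_def)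
    define z where "z = - (complex_of_real t)\<^sup>2"
    have zr: "z = of_real (- t\<^sup>2)" by (simp add: z_def)
    have "t * 1 \<le> t * t" using t by (intro mult_left_mono) auto
    moreover have "t > \<bar>a 0\<bar>" using T(1,2) by (simp add: t_def add_pos_nonneg)
    ultimately have lt: "- t\<^sup>2 < a 0" unfolding power2_eq_square by linarith
    have unz: "u z \<noteq> 0" using T(3)[OF t(1)] by (simp add: z_def)
    have ch: "sin (\<alpha>2 - \<alpha>1) = - sin \<alpha>1" "ch2 z = u z"
      unfolding ch2_def using \<open>\<alpha>2 = 0\<close> by simp_all
    have "m z = v z / u z - of_real (cos \<alpha>1 / sin \<alpha>1)"
      unfolding m_eq ch using unz s1 by (simp add: ch1_def field_simps)
    also have "\<dots> = (v z + of_real t * u z) / u z - of_real t - of_real (cos \<alpha>1 / sin \<alpha>1)"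
      using unz by (simp add: field_simps)
    finally have "Re (m z) = Re ((v z + of_real t * u z) / u z) - t - cos \<alpha>1 / sin \<alpha>1" by (simp only: minus_complex.sel Re_complex_of_real)
    also have "\<dots> \<le> C - t - cos \<alpha>1 / sin \<alpha>1"
    proof -
      have "Re ((v z + of_real t * u z) / u z) \<le> norm ((v z + of_real t * u z) / u z)" by (rule complex_Re_le_cmod)
      also have "\<dots> \<le> C" using T(4)[OF t(1)] unz by (simp add: norm_divide z_def divide_le_eq)
      finally show ?thesis by simp
    qed
    also have "\<dots> \<le> 0" using T by (simp add: t_def abs_if split: if_splits)
    finally show ?thesis using lt zr by (intro exI[of _ "- t\<^sup>2"]) (simp add: h_def)
  qed
  ultimately show ?thesis by (metis not_less)
qed

end

text \<open>Dominated convergence with majorant \<open>f\<close>; the limit is 0 except at the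
  single point x = 0, where the weight is always 1. For a merely integrable \<open>f\<close> this
  gives o(1), which is all that the decay argument uses.\<close>

lemma integral_weighted_tendsto_0:
  fixes f :: "real \<Rightarrow> real"
  assumes f: "f absolutely_integrable_on {0..pi}" and f0: "\<And>x. f x \<ge> 0"
  shows "(\<lambda>n. integral {0..pi} (\<lambda>x. f x * exp (- 2 * sqrt (real n) * x))) \<longlonglongrightarrow> 0"
proof -
  have "(\<lambda>n. integral {0..pi} (\<lambda>x. f x * exp (- 2 * sqrt (real n) * x))) \<longlonglongrightarrow> integral {0..pi} (\<lambda>x. if x = 0 then f 0 else 0)"
  proof (rule dominated_convergence(2))
    show "(\<lambda>x. f x * exp (- 2 * sqrt (real n) * x)) integrable_on {0..pi}" for n
    proof -
      have "(\<lambda>x. f x * exp (- 2 * sqrt (real n) * x)) absolutely_integrable_on {0..pi}"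
        by (intro absolutely_integrable_mult_continuous f continuous_intros)
      then show ?thesis by (simp add: absolutely_integrable_on_def)
    qed
    show "f integrable_on {0..pi}" using f by (simp add: absolutely_integrable_on_def)
    show "norm (f x * exp (- 2 * sqrt (real n) * x)) \<le> f x" if "x \<in> {0..pi}" for n x
    proof -
      have "exp (- 2 * sqrt (real n) * x) \<le> 1" using that by simp
      then show ?thesis using f0[of x] by (simp add: abs_mult mult_left_le)
    qed
    show "(\<lambda>n. f x * exp (- 2 * sqrt (real n) * x)) \<longlonglongrightarrow> (if x = 0 then f 0 else 0)" if x: "x \<in> {0..pi}" for x
    proof (cases "x = 0")
      case False
      then have "x > 0" using x by simp
      then have "(\<lambda>n. exp (- 2 * sqrt (real n) * x)) \<longlonglongrightarrow> 0" by real_asymp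
      then have "(\<lambda>n. f x * exp (- 2 * sqrt (real n) * x)) \<longlonglongrightarrow> 0" by (rule tendsto_mult_right_zero)
      then show ?thesis using False by simp
    qed simp
  qed
  moreover have "integral {0..pi} (\<lambda>x. if x = 0 then f 0 else 0) = integral {0..pi} (\<lambda>x. 0 :: real)"
    by (rule integral_spike[of "{0}"]) auto
  ultimately show ?thesis by simp
qed

section \<open>The mixed data theorem\<close>

context
  fixes q q' :: "real \<Rightarrow> real" and \<alpha>1 \<alpha>2 \<beta> :: real and a b b' :: "nat \<Rightarrow> real"
    and \<mu> \<mu>' :: "real measure" and c1 c0 c1' c0' :: real
  assumes D: "spectral_data q \<alpha>1 \<alpha>2 \<beta> a b \<mu> c1 c0" and E: "spectral_data q' \<alpha>1 \<alpha>2 \<beta> a b' \<mu>' c1' c0'"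
begin

interpretation D: spectral_data q \<alpha>1 \<alpha>2 \<beta> a b \<mu> c1 c0 by (rule D)
interpretation E: spectral_data q' \<alpha>1 \<alpha>2 \<beta> a b' \<mu>' c1' c0' by (rule E)

lemma cross_identity_ch:
  "D.ch1 z * E.ch2 z - E.ch1 z * D.ch2 z = - of_real (sin (\<alpha>2 - \<alpha>1)) * (D.u z * E.v z - D.v z * E.u z)"
  unfolding D.ch1_def D.ch2_def E.ch1_def E.ch2_def sin_diff by (simp add: algebra_simps)

text \<open>The factor sin (\<alpha>2 - \<alpha>1) in front of the m-functions cancels against the
  determinant of the boundary forms, leaving the Wronskian of the two solutions at 0.\<close>

lemma m_difference:
  assumes "D.ch2 z \<noteq> 0" "E.ch2 z \<noteq> 0"
  shows "D.m z - E.m z = - ((D.u z * E.v z - D.v z * E.u z) / (D.ch2 z * E.ch2 z))"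
proof -
  have "D.m z - E.m z = 1 / of_real (sin (\<alpha>2 - \<alpha>1)) * ((D.ch1 z * E.ch2 z - E.ch1 z * D.ch2 z) / (D.ch2 z * E.ch2 z))"
    unfolding D.m_eq E.m_eq diff_frac_eq[OF assms, symmetric] by (rule right_diff_distrib[symmetric])
  also have "\<dots> = - ((D.u z * E.v z - D.v z * E.u z) / (D.ch2 z * E.ch2 z))"
    unfolding cross_identity_ch using D.s_nz by (simp del: minus_diff_eq)
  finally show ?thesis .
qed

text \<open>Both solutions decay like exp (- t x) relative to their values at 0, so their Wronskian
  there is bounded, relative to these values, by an integral of |q' - q| exp (- 2 t x), which is
  o(1). Each denominator contributes \<delta>(t), which is 1 or t sin \<alpha>2 / 2.\<close>

lemma m_difference_decay:
  "(sin \<alpha>2 = 0 \<longrightarrow> (\<lambda>n. D.m (- of_nat n) - E.m (- of_nat n)) \<longlonglongrightarrow> 0) \<and>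
   (sin \<alpha>2 \<noteq> 0 \<longrightarrow> (\<lambda>n. of_nat n * (D.m (- of_nat n) - E.m (- of_nat n))) \<longlonglongrightarrow> 0)"
proof -
  obtain T C where T: "T \<ge> 1" "C \<ge> 0" "\<And>t. t \<ge> T \<Longrightarrow> D.u (- (of_real t)\<^sup>2) \<noteq> 0"
    "\<And>t x. t \<ge> T \<Longrightarrow> x \<in> {0..pi} \<Longrightarrow> norm (sol q \<beta> (- (of_real t)\<^sup>2) x) \<le> C * exp (- t * x) * norm (D.u (- (of_real t)\<^sup>2))"
    "\<And>t. t \<ge> T \<Longrightarrow> norm (D.ch2 (- (of_real t)\<^sup>2)) \<ge> (if sin \<alpha>2 = 0 then 1 else sin \<alpha>2 / 2 * t) * norm (D.u (- (of_real t)\<^sup>2))"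
    by (rule D.negative_axis, rule that)
  obtain T' C' where T': "T' \<ge> 1" "C' \<ge> 0" "\<And>t. t \<ge> T' \<Longrightarrow> E.u (- (of_real t)\<^sup>2) \<noteq> 0"
    "\<And>t x. t \<ge> T' \<Longrightarrow> x \<in> {0..pi} \<Longrightarrow> norm (sol q' \<beta> (- (of_real t)\<^sup>2) x) \<le> C' * exp (- t * x) * norm (E.u (- (of_real t)\<^sup>2))"
    "\<And>t. t \<ge> T' \<Longrightarrow> norm (E.ch2 (- (of_real t)\<^sup>2)) \<ge> (if sin \<alpha>2 = 0 then 1 else sin \<alpha>2 / 2 * t) * norm (E.u (- (of_real t)\<^sup>2))"
    by (rule E.negative_axis, rule that)
  let ?p = "\<lambda>x. complex_of_real (q x)" and ?p' = "\<lambda>x. complex_of_real (q' x)"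
  have p: "?p absolutely_integrable_on {0..pi}" "?p' absolutely_integrable_on {0..pi}"
    by (intro qc_integrable D.q E.q)+
  define f where "f = (\<lambda>x. norm (?p' x - ?p x))"
  have fi: "f absolutely_integrable_on {0..pi}"
    unfolding f_def by (intro set_integrable_norm set_integral_diff(1) p)
  define I where "I = (\<lambda>t::real. integral {0..pi} (\<lambda>x. f x * exp (- 2 * t * x)))"
  define \<delta> where "\<delta> = (\<lambda>t. if sin \<alpha>2 = 0 then 1 else sin \<alpha>2 / 2 * t)"
  have s2: "sin \<alpha>2 \<ge> 0" using D.\<alpha> by (intro sin_ge_zero) auto
  have main: "norm (D.m (- (of_real t)\<^sup>2) - E.m (- (of_real t)\<^sup>2)) \<le> C * C' * I t / (\<delta> t)\<^sup>2" if t: "t \<ge> T" "t \<ge> T'" for t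
  proof -
    define z where "z = - (complex_of_real t)\<^sup>2"
    have \<delta>: "\<delta> t > 0" using t T(1) s2 by (auto simp: \<delta>_def)
    have u: "norm (D.u z) > 0" "norm (E.u z) > 0" using T(3)[OF t(1)] T'(3)[OF t(2)] by (auto simp: z_def)
    have c: "norm (D.ch2 z) \<ge> \<delta> t * norm (D.u z)" "norm (E.ch2 z) \<ge> \<delta> t * norm (E.u z)"
      unfolding z_def \<delta>_def by (rule T(5)[OF t(1)], rule T'(5)[OF t(2)])
    have pos: "\<delta> t * norm (D.u z) > 0" "\<delta> t * norm (E.u z) > 0" using \<delta> u by auto
    then have nz: "D.ch2 z \<noteq> 0" "E.ch2 z \<noteq> 0" using c by auto
    have s: "ivp (\<lambda>x. ?p x - z) (\<lambda>x. 0) (sol q \<beta> z) (d1 (sol q \<beta> z))" "ivp (\<lambda>x. ?p' x - z) (\<lambda>x. 0) (sol q' \<beta> z) (d1 (sol q' \<beta> z))"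
      by (rule sol_ivp D.q E.q)+
    let ?g = "\<lambda>x. (?p' x - z - (?p x - z)) * (sol q \<beta> z x * sol q' \<beta> z x)"
    \<comment> \<open>The two solutions share their data at pi, so the Wronskian vanishes there and
      its value at 0 is minus the integral.\<close>
    have "D.u z * E.v z - D.v z * E.u z = - integral {0..pi} ?g"
      using ivp_wronskian[OF shift_integrable[OF p(1)] shift_integrable[OF p(2)] s, of pi] sol_spec[OF D.q, of \<beta> z] sol_spec[OF E.q, of \<beta> z]
      by (simp add: D.u_def D.v_def E.u_def E.v_def algebra_simps add_eq_0_iff)
    then have "norm (D.u z * E.v z - D.v z * E.u z) = norm (integral {0..pi} ?g)" by simp
    also have "\<dots> \<le> integral {0..pi} (\<lambda>x. (C * C' * (norm (D.u z) * norm (E.u z))) * (f x * exp (- 2 * t * x)))"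
    proof (rule integral_norm_bound_integral)
      have "?g absolutely_integrable_on {0..pi}"
        by (intro absolutely_integrable_mult_continuous set_integral_diff(1) shift_integrable p continuous_intros ivp_cont1[OF s(1)] ivp_cont1[OF s(2)])
      then show "?g integrable_on {0..pi}" by (simp add: absolutely_integrable_on_def)
      have "(\<lambda>x. f x * exp (- 2 * t * x)) absolutely_integrable_on {0..pi}"
        by (intro absolutely_integrable_mult_continuous fi continuous_intros)
      then show "(\<lambda>x. (C * C' * (norm (D.u z) * norm (E.u z))) * (f x * exp (- 2 * t * x))) integrable_on {0..pi}"
        by (intro integrable_on_mult_right) (simp add: absolutely_integrable_on_def)
      fix x assume x: "x \<in> {0..pi}"
      have "norm (?g x) = f x * (norm (sol q \<beta> z x) * norm (sol q' \<beta> z x))" by (simp add: f_def norm_mult)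
      also have "\<dots> \<le> f x * ((C * exp (- t * x) * norm (D.u z)) * (C' * exp (- t * x) * norm (E.u z)))"
        using T(4)[OF t(1) x] T'(4)[OF t(2) x] T(2) by (intro mult_left_mono mult_mono) (auto simp: f_def z_def)
      also have "\<dots> = (C * C' * (norm (D.u z) * norm (E.u z))) * (f x * (exp (- t * x) * exp (- t * x)))" by (simp only: mult_ac)
      also have "exp (- t * x) * exp (- t * x) = exp (- 2 * t * x)" by (simp flip: exp_add)
      finally show "norm (?g x) \<le> (C * C' * (norm (D.u z) * norm (E.u z))) * (f x * exp (- 2 * t * x))" .
    qed
    also have "\<dots> = (C * C' * (norm (D.u z) * norm (E.u z))) * I t" by (simp only: integral_mult_right I_def)
    finally have w: "norm (D.u z * E.v z - D.v z * E.u z) \<le> (C * C' * (norm (D.u z) * norm (E.u z))) * I t" .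
    have "norm (D.m z - E.m z) = norm (D.u z * E.v z - D.v z * E.u z) / (norm (D.ch2 z) * norm (E.ch2 z))"
      unfolding m_difference[OF nz] norm_minus_cancel norm_divide norm_mult ..
    also have "\<dots> \<le> ((C * C' * (norm (D.u z) * norm (E.u z))) * I t) / ((\<delta> t * norm (D.u z)) * (\<delta> t * norm (E.u z)))"
      using w c pos by (intro frac_le mult_mono order_trans[OF norm_ge_zero w]) auto
    also have "\<dots> = C * C' * I t / (\<delta> t)\<^sup>2" using u \<delta> by (simp add: power2_eq_square)
    finally show ?thesis by (simp add: z_def)
  qed
  have I0: "(\<lambda>n. I (sqrt (real n))) \<longlonglongrightarrow> 0"
    unfolding I_def using fi by (rule integral_weighted_tendsto_0) (simp add: f_def)
  have ev: "\<forall>\<^sub>F n in sequentially. max T T' \<le> sqrt (real n)" by real_asymp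
  have ev': "\<forall>\<^sub>F n in sequentially. norm (D.m (- of_nat n) - E.m (- of_nat n)) \<le> C * C' * I (sqrt (real n)) / (\<delta> (sqrt (real n)))\<^sup>2"
    using ev
  proof eventually_elim
    case (elim n)
    then show ?case unfolding D.neg_nat_sqrt by (intro main) auto
  qed
  show ?thesis
  proof (intro conjI impI)
    assume "sin \<alpha>2 = 0"
    then have \<delta>1: "\<delta> t = 1" for t by (simp add: \<delta>_def)
    show "(\<lambda>n. D.m (- of_nat n) - E.m (- of_nat n)) \<longlonglongrightarrow> 0"
      by (rule Lim_null_comparison[OF ev'[unfolded \<delta>1]]) (use tendsto_mult_right_zero[OF I0, of "C * C'"] in simp)
  next
    assume s: "sin \<alpha>2 \<noteq> 0"
    show "(\<lambda>n. of_nat n * (D.m (- of_nat n) - E.m (- of_nat n))) \<longlonglongrightarrow> 0"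
    proof (rule Lim_null_comparison)
      show "\<forall>\<^sub>F n in sequentially. norm (of_nat n * (D.m (- of_nat n) - E.m (- of_nat n))) \<le> (C * C' * 4 / (sin \<alpha>2)\<^sup>2) * I (sqrt (real n))"
        using ev' eventually_gt_at_top[of 0]
      proof eventually_elim
        case (elim n)
        have "norm (of_nat n * (D.m (- of_nat n) - E.m (- of_nat n))) \<le> real n * (C * C' * I (sqrt (real n)) / (\<delta> (sqrt (real n)))\<^sup>2)"
          unfolding norm_mult norm_of_nat using elim by (intro mult_left_mono) auto
        \<comment> \<open>At t = sqrt n the squared denominator is proportional to n and absorbs the
          additional factor n.\<close>
        also have "(\<delta> (sqrt (real n)))\<^sup>2 = (sin \<alpha>2)\<^sup>2 / 4 * real n" using s by (simp add: \<delta>_def power_mult_distrib power_divide)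
        also have "real n * (C * C' * I (sqrt (real n)) / ((sin \<alpha>2)\<^sup>2 / 4 * real n)) = (C * C' * 4 / (sin \<alpha>2)\<^sup>2) * I (sqrt (real n))"
          using elim s by (simp add: field_simps)
        finally show ?case .
      qed
      show "(\<lambda>n. (C * C' * 4 / (sin \<alpha>2)\<^sup>2) * I (sqrt (real n))) \<longlonglongrightarrow> 0" by (rule tendsto_mult_right_zero[OF I0])
    qed
  qed
qed

lemma m_functions_agree:
  assumes bN: "\<And>n. n \<in> N \<Longrightarrow> b' n = b n" and gN: "\<And>n. n \<notin> N \<Longrightarrow> measure \<mu>' {a n} = measure \<mu> {a n}"
    and z: "z \<notin> range (\<lambda>n. complex_of_real (a n))"
  shows "D.m z = E.m z"
proof -
  \<comment> \<open>Translating by \<open>K\<close> makes all eigenvalues positive; \<open>K\<close> is an integer because the decay is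
    tested along \<open>- n\<close>.\<close>
  obtain K :: nat where K: "real K \<ge> \<bar>a 0\<bar> + \<bar>b 0\<bar> + 1" using real_arch_simple by blast
  define M where "M = (\<lambda>z. D.m z - E.m z)"
  have a0: "a 0 \<le> a n" and b0: "b 0 \<le> b n" for n
    using strict_mono_less_eq[OF D.mono_a] strict_mono_less_eq[OF D.mono_b] by simp_all
  \<comment> \<open>In either interlacing pattern \<open>b (Suc n)\<close> lies above
    \<open>a n\<close>.\<close>
  have blim: "filterlim b at_top sequentially"
  proof -
    have "\<forall>n. a n \<le> b (Suc n)"
      using D.interlacing strict_monoD[OF D.mono_b, of _ "Suc _"] by (meson less_imp_le less_trans lessI)
    then have "filterlim (\<lambda>n. b (Suc n)) at_top sequentially"
      by (intro filterlim_at_top_mono[OF D.a_at_top]) auto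
    then show ?thesis by (simp add: filterlim_sequentially_Suc)
  qed
  have "M (z + of_nat K - of_nat K) = 0"
  proof (rule mixed_data_zero[where a = "\<lambda>n. a n + real K" and b = "\<lambda>n. b n + real K" and N = N and z = "z + of_nat K" and M = "\<lambda>z. M (z - of_nat K)"
      and C = "((\<bar>c1\<bar> + \<bar>c0\<bar> + 2 * D.W) + (\<bar>c1'\<bar> + \<bar>c0'\<bar> + 2 * E.W)) * (1 + real K)\<^sup>2"])
    show "0 < a n + real K" "0 < b n + real K" for n using a0[of n] b0[of n] K by linarith+
    show "max (a n + real K) (b n + real K) < min (a (Suc n) + real K) (b (Suc n) + real K)" for n
      using D.interlacing strict_monoD[OF D.mono_a, of n "Suc n"] strict_monoD[OF D.mono_b, of n "Suc n"]
      by (fastforce intro: less_trans)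
    show "a i + real K \<noteq> b j + real K" for i j using D.ab_disjoint by auto
    show "filterlim (\<lambda>n. a n + real K) at_top sequentially" "filterlim (\<lambda>n. b n + real K) at_top sequentially"
      using filterlim_tendsto_add_at_top[OF tendsto_const D.a_at_top, of "real K"] filterlim_tendsto_add_at_top[OF tendsto_const blim, of "real K"]
      by (simp_all add: add.commute)
    have sh: "z - of_nat K \<in> range (\<lambda>n. complex_of_real (a n)) \<longleftrightarrow> z \<in> range (\<lambda>n. complex_of_real (a n + real K))" for z
      by (auto simp: image_iff diff_eq_eq)
    show "(\<lambda>z. M (z - of_nat K)) holomorphic_on - range (\<lambda>n. complex_of_real (a n + real K))"
    proof -
      have "M holomorphic_on - range (\<lambda>n. complex_of_real (a n))"
        unfolding M_def by (intro holomorphic_intros D.m_holomorphic E.m_holomorphic)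
      then have "(M \<circ> (\<lambda>z. z - of_nat K)) holomorphic_on - range (\<lambda>n. complex_of_real (a n + real K))"
        using sh by (intro holomorphic_on_compose_gen[where t = "- range (\<lambda>n. complex_of_real (a n))"] holomorphic_intros) auto
      then show ?thesis by (simp add: o_def)
    qed
    show "z + of_nat K \<notin> range (\<lambda>n. complex_of_real (a n + real K))" using sh[of "z + of_nat K"] z by simp
    show "M (of_real (b n + real K) - of_nat K) = 0" if "n \<in> N" for n
    proof -
      have "b n \<notin> range a" using D.ab_disjoint by blast
      then have n: "complex_of_real (b n) \<notin> range (\<lambda>n. complex_of_real (a n))" by auto
      have "D.m (of_real (b n)) = 0" using D.m_zero_iff[OF n] by auto
      moreover have "E.m (of_real (b n)) = 0" using E.m_zero_iff[OF n] bN[OF that] by (metis rangeI)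
      ultimately show ?thesis by (simp add: M_def)
    qed
    show "norm (M (z - of_nat K)) * \<bar>Im z\<bar> \<le> ((\<bar>c1\<bar> + \<bar>c0\<bar> + 2 * D.W) + (\<bar>c1'\<bar> + \<bar>c0'\<bar> + 2 * E.W)) * (1 + real K)\<^sup>2 * (1 + norm z)\<^sup>2"
      if "Im z \<noteq> 0" for z
    proof -
      let ?z = "z - of_nat K" and ?C = "\<bar>c1\<bar> + \<bar>c0\<bar> + 2 * D.W" and ?C' = "\<bar>c1'\<bar> + \<bar>c0'\<bar> + 2 * E.W"
      have C: "?C \<ge> 0" "?C' \<ge> 0" using D.W_nonneg E.W_nonneg by auto
      have im: "Im ?z = Im z" by simp
      have "norm (M ?z) * \<bar>Im z\<bar> \<le> (norm (D.m ?z) + norm (E.m ?z)) * \<bar>Im z\<bar>"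
        unfolding M_def by (intro mult_right_mono norm_triangle_ineq4) auto
      also have "\<dots> \<le> ?C * (1 + norm ?z)\<^sup>2 + ?C' * (1 + norm ?z)\<^sup>2"
        using D.off_axis_bound[of ?z] E.off_axis_bound[of ?z] that unfolding im by (simp add: distrib_right)
      also have "\<dots> = (?C + ?C') * (1 + norm ?z)\<^sup>2" by (simp add: distrib_right)
      also have "\<dots> \<le> (?C + ?C') * ((1 + real K) * (1 + norm z))\<^sup>2"
      proof (intro mult_left_mono power_mono)
        have "norm ?z \<le> norm z + real K" using norm_triangle_ineq4[of z "of_nat K"] by simp
        moreover have "0 \<le> real K * norm z" by simp
        ultimately show "1 + norm ?z \<le> (1 + real K) * (1 + norm z)"
          unfolding distrib_left distrib_right by linarith
      qed (use C in auto)
      finally show ?thesis by (simp add: power_mult_distrib mult.assoc)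
    qed
    show "\<exists>L. ((\<lambda>z. (z - of_real (a n + real K)) * M (z - of_nat K)) \<longlongrightarrow> L) (at (of_real (a n + real K))) \<and> (n \<notin> N \<longrightarrow> L = 0)" for n
    proof (intro exI conjI impI)
      have "((\<lambda>z. (z - of_real (a n)) * D.m z - (z - of_real (a n)) * E.m z) \<longlongrightarrow> - of_real (measure \<mu> {a n}) - - of_real (measure \<mu>' {a n})) (at (of_real (a n)))"
        by (intro tendsto_diff D.residue_limit E.residue_limit)
      then have "((\<lambda>z. (z - of_real (a n)) * M z) \<longlongrightarrow> of_real (measure \<mu>' {a n}) - of_real (measure \<mu> {a n})) (at (of_real (a n)))"
        by (simp add: M_def right_diff_distrib)
      from LIM_offset[OF this, of "- of_nat K"]
      show "((\<lambda>z. (z - of_real (a n + real K)) * M (z - of_nat K)) \<longlongrightarrow> of_real (measure \<mu>' {a n}) - of_real (measure \<mu> {a n})) (at (of_real (a n + real K)))"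
        by (simp add: algebra_simps)
      show "complex_of_real (measure \<mu>' {a n}) - of_real (measure \<mu> {a n}) = 0" if "n \<notin> N" using gN[OF that] by simp
    qed
    have e: "- of_nat k - of_nat K = (- of_nat (k + K) :: complex)" for k by simp
    show "(\<forall>n. b n + real K \<le> a n + real K) \<and> (\<lambda>k. M (- of_nat k - of_nat K)) \<longlonglongrightarrow> 0 \<or>
        (\<lambda>k. of_nat k * M (- of_nat k - of_nat K)) \<longlonglongrightarrow> 0"
    proof (cases "sin \<alpha>2 = 0")
      case True
      then have "(\<lambda>n. M (- of_nat n)) \<longlonglongrightarrow> 0" using m_difference_decay by (simp add: M_def)
      from LIMSEQ_ignore_initial_segment[OF this, of K]
      have "(\<lambda>k. M (- of_nat k - of_nat K)) \<longlonglongrightarrow> 0" unfolding e .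
      \<comment> \<open>For sin \<alpha>2 = 0 only the pattern starting with \<open>b 0\<close> is
        possible, so all factors of the product are bounded by 1 on the negative axis.\<close>
      moreover have "\<forall>n. b n + real K \<le> a n + real K" using D.interlacing True by (auto intro: less_imp_le)
      ultimately show ?thesis by blast
    next
      case False
      then have "(\<lambda>n. of_nat n * M (- of_nat n)) \<longlonglongrightarrow> 0" using m_difference_decay by (simp add: M_def)
      from tendsto_norm_zero[OF LIMSEQ_ignore_initial_segment[OF this, of K]]
      have l: "(\<lambda>k. norm (of_nat (k + K) * M (- of_nat (k + K)))) \<longlonglongrightarrow> 0" .
      \<comment> \<open>The decay is known with the factor k + K belonging to the point - (k + K);
        the required factor k is smaller.\<close>
      have "(\<lambda>k. of_nat k * M (- of_nat k - of_nat K)) \<longlonglongrightarrow> 0"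
      proof (rule Lim_null_comparison[OF _ l])
        show "\<forall>\<^sub>F k in sequentially. norm (of_nat k * M (- of_nat k - of_nat K)) \<le> norm (of_nat (k + K) * M (- of_nat (k + K)))"
          unfolding e norm_mult norm_of_nat by (intro always_eventually allI mult_right_mono) auto
      qed
      then show ?thesis by blast
    qed
  qed
  then show ?thesis by (simp add: M_def)
qed

text \<open>\<open>borg_marchenko\<close> takes equality of the m-functions in cross-multiplied form
  at every z. Off the poles this follows from \<open>m_difference\<close>; the common poles need a
  separate argument.\<close>

lemma potentials_agree:
  assumes bN: "\<And>n. n \<in> N \<Longrightarrow> b' n = b n" and gN: "\<And>n. n \<notin> N \<Longrightarrow> measure \<mu>' {a n} = measure \<mu> {a n}"
  shows "AE x\<in>{0<..<pi} in lebesgue. q' x = q x"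
proof (rule borg_marchenko[OF D.q E.q, of \<beta>])
  fix z
  have "D.u z * E.v z - D.v z * E.u z = 0"
  proof (cases "D.ch2 z = 0")
    case True
    then have E0: "E.ch2 z = 0" by (simp add: D.ch2_zero_iff E.ch2_zero_iff)
    \<comment> \<open>At a common eigenvalue both \<open>ch2\<close> vanish. Multiplied by cos
      \<alpha>2 and by sin \<alpha>2, the Wronskian becomes a combination of them, and these two
      numbers are not both zero.\<close>
    have "of_real (cos \<alpha>2) * (D.u z * E.v z - D.v z * E.u z) = D.ch2 z * E.v z - E.ch2 z * D.v z"
      "of_real (sin \<alpha>2) * (D.u z * E.v z - D.v z * E.u z) = D.ch2 z * E.u z - E.ch2 z * D.u z"
      by (simp_all add: D.ch2_def E.ch2_def algebra_simps)
    then have "cos \<alpha>2 = 0 \<and> sin \<alpha>2 = 0 \<or> D.u z * E.v z - D.v z * E.u z = 0" using True E0 by auto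
    moreover have "\<not> (cos \<alpha>2 = 0 \<and> sin \<alpha>2 = 0)" using sin_zero_norm_cos_one[of \<alpha>2] by auto
    ultimately show ?thesis by blast
  next
    case False
    then have z: "z \<notin> range (\<lambda>n. complex_of_real (a n))" by (simp add: D.ch2_zero_iff)
    then have E0: "E.ch2 z \<noteq> 0" by (simp add: E.ch2_zero_iff)
    have "D.m z - E.m z = 0" using m_functions_agree[OF bN gN z] by simp
    then show ?thesis using m_difference[OF False E0] False E0 by simp
  qed
  then show "sol q \<beta> z 0 * d1 (sol q' \<beta> z) 0 = d1 (sol q \<beta> z) 0 * sol q' \<beta> z 0"
    by (simp add: D.u_def D.v_def E.u_def E.v_def)
qed

end

lemma spectral_data_exists:
  assumes "q absolutely_integrable_on {0<..<pi}" "\<alpha>1 \<in> {0..<pi}" "\<alpha>2 \<in> {0..<pi}" "sin (\<alpha>2 - \<alpha>1) \<noteq> 0"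
    and a: "enumerates_spectrum a q \<alpha>2 \<beta>" and b: "enumerates_spectrum b q \<alpha>1 \<beta>"
    and \<mu>: "spectral_measure \<mu> q \<alpha>1 \<alpha>2 \<beta>"
  shows "\<exists>c1 c0. spectral_data q \<alpha>1 \<alpha>2 \<beta> (\<lambda>n. a (Suc n)) (\<lambda>n. b (Suc n)) \<mu> c1 c0"
proof -
  obtain c1 c0 where c: "\<And>z. z \<notin> spectrum q \<alpha>2 \<beta> \<Longrightarrow>
        m_fun q \<alpha>1 \<alpha>2 \<beta> z = of_real c1 * z + of_real c0 +
          (LINT t|\<mu>. 1 / (of_real t - z) - of_real (t / (1 + t\<^sup>2)))"
    using \<mu> unfolding spectral_measure_def by blast
  have img: "f ` {1..} = range (\<lambda>n. f (Suc n))" for f :: "nat \<Rightarrow> complex"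
  proof -
    have "{1..} = range Suc" by (auto simp: image_iff gr0_conv_Suc Suc_le_eq)
    then show ?thesis by (simp add: image_image)
  qed
  have "strict_mono (\<lambda>n. f (Suc n))" if "strict_mono_on {1..} f" for f :: "nat \<Rightarrow> real"
    using that by (auto simp: strict_mono_def strict_mono_on_def)
  then have "spectral_data q \<alpha>1 \<alpha>2 \<beta> (\<lambda>n. a (Suc n)) (\<lambda>n. b (Suc n)) \<mu> c1 c0"
    using assms c unfolding enumerates_spectrum_def spectral_measure_def img
    by unfold_locales auto
  then show ?thesis by blast
qed

theorem theorem4p11:
  fixes q q' :: "real \<Rightarrow> real" and A :: "nat set" and \<alpha>1 \<alpha>2 \<beta> :: real
    and a b \<gamma> a' b' \<gamma>' :: "nat \<Rightarrow> real" and \<mu> \<mu>' :: "real measure"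
  assumes "q absolutely_integrable_on {0<..<pi}"
    and "q' absolutely_integrable_on {0<..<pi}"
    and "A \<subseteq> {1..}"
    and "\<alpha>1 \<in> {0..<pi}" "\<alpha>2 \<in> {0..<pi}" "\<beta> \<in> {0..<pi}"
    and "sin (\<alpha>2 - \<alpha>1) \<noteq> 0"
    and "enumerates_spectrum a q \<alpha>2 \<beta>" "enumerates_spectrum b q \<alpha>1 \<beta>"
    and "spectral_measure \<mu> q \<alpha>1 \<alpha>2 \<beta>" "\<And>n. n \<ge> 1 \<Longrightarrow> \<gamma> n = measure \<mu> {a n}"
    and "enumerates_spectrum a' q' \<alpha>2 \<beta>" "enumerates_spectrum b' q' \<alpha>1 \<beta>"
    and "spectral_measure \<mu>' q' \<alpha>1 \<alpha>2 \<beta>" "\<And>n. n \<ge> 1 \<Longrightarrow> \<gamma>' n = measure \<mu>' {a' n}"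
    and "\<And>n. n \<ge> 1 \<Longrightarrow> a' n = a n"
    and "\<And>n. n \<in> {1..} - A \<Longrightarrow> b' n = b n"
    and "\<And>n. n \<in> A \<Longrightarrow> \<gamma>' n = \<gamma> n"
  shows "AE x\<in>{0<..<pi} in lebesgue. q' x = q x"
proof -
  obtain c1 c0 where D: "spectral_data q \<alpha>1 \<alpha>2 \<beta> (\<lambda>n. a (Suc n)) (\<lambda>n. b (Suc n)) \<mu> c1 c0"
    using spectral_data_exists[OF assms(1,4,5,7,8,9,10)] by blast
  obtain c1' c0' where "spectral_data q' \<alpha>1 \<alpha>2 \<beta> (\<lambda>n. a' (Suc n)) (\<lambda>n. b' (Suc n)) \<mu>' c1' c0'"
    using spectral_data_exists[OF assms(2,4,5,7,12,13,14)] by blast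
  moreover have "(\<lambda>n. a' (Suc n)) = (\<lambda>n. a (Suc n))" using assms(16) by auto
  ultimately have E: "spectral_data q' \<alpha>1 \<alpha>2 \<beta> (\<lambda>n. a (Suc n)) (\<lambda>n. b' (Suc n)) \<mu>' c1' c0'" by simp
  show ?thesis
  \<comment> \<open>\<open>N\<close> consists of the positions whose b-eigenvalue is prescribed: the
    complement of A, shifted because the sequences now start at 0. Outside \<open>N\<close> the
    masses are prescribed, and they are compared at the same point because a' = a.\<close>
  proof (rule potentials_agree[OF D E, where N = "{n. Suc n \<notin> A}"])
    show "b' (Suc n) = b (Suc n)" if "n \<in> {n. Suc n \<notin> A}" for n
      using that by (intro assms(17)) auto
    show "measure \<mu>' {a (Suc n)} = measure \<mu> {a (Suc n)}" if "n \<notin> {n. Suc n \<notin> A}" for n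
      using that assms(18)[of "Suc n"] assms(11)[of "Suc n"] assms(15)[of "Suc n"] assms(16)[of "Suc n"] by simp
  qed
qed

end
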